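(* Let $M$ and $N$ be smooth manifolds with $N$ paracompact, let $G$ be a Lie group, and let $\xi$ be a smooth principal fibre bundle over $N$ with structure group $G$, total space $P$ and projection $\pi : P \to N$. Let $f, g : M \to N$ be smooth maps which are smoothly homotopic. Then there is an isomorphism of principal fibre bundles over $M$ with structure group $G$ between the pull-back bundles $f^*\xi$ and $g^*\xi$.
   Context: All manifolds, bundles and maps are smooth, and $I = [0,1]$. A manifold is paracompact if it admits a smooth partition of unity subordinate to every open covering. Two smooth maps $f, g : M \to N$ are smoothly homotopic if there is a smooth map $H : I \times M \to N$ with $H(0,x) = f(x)$ and $H(1,x) = g(x)$ for all $x \in M$. Given a principal fibre bundle $\xi$ with structure group $G$, total space $P$ and projection $\pi : P \to N$ (with $G$ acting on $P$ on the right), and a smooth map $f : M \to N$, the pull-back $f^*\xi$ is the principal fibre bundle over $M$ with structure group $G$ whose total space is $$E = \{ (x,p) \in M \times P \mid f(x) = \pi(p) \},$$ with projection $\pi_E : E \to M$, $\pi_E(x,p) = x$, and right action $(x,p)g = (x, pg)$ for $g \in G$. Its local trivialisations are as follows: if $\varphi : \pi^{-1}(U) \to U \times G$ is a local trivialisation of $\xi$ over an open set $U \subset N$ and $V = f^{-1}(U)$, then $\psi : \pi_E^{-1}(V) \to V \times G$, $\psi(x,p) = (x, \varphi_2(p))$, is a local trivialisation of $f^*\xi$, where $\varphi_2$ is the $G$-component of $\varphi$. A morphism of principal fibre bundles over $M$ with structure group $G$ is a smooth map of total spaces which commutes with the projections to $M$ (i.e. covers the identity of $M$) and with the right $G$-actions.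 An isomorphism is a morphism that has an inverse which is also a morphism. *)

theory Defs
  imports "HOL-Analysis.Analysis" "HOL-Algebra.Group"
begin

section \<open>Smooth functions between subsets of Euclidean spaces\<close>

text \<open>In finite dimensions \<open>f\<close> is of class \<open>C\<^sup>k\<^sup>+\<^sup>1\<close> on an open set iff it is differentiable there
  and all its directional derivatives are of class \<open>C\<^sup>k\<close>.\<close>

primrec Ck_on :: "nat \<Rightarrow> 'a::euclidean_space set \<Rightarrow> ('a \<Rightarrow> 'b::euclidean_space) \<Rightarrow> bool" where
  "Ck_on 0 U f \<longleftrightarrow> continuous_on U f"
| "Ck_on (Suc k) U f \<longleftrightarrow>
     (\<forall>x\<in>U. f differentiable (at x)) \<and> (\<forall>v. Ck_on k U (\<lambda>x. frechet_derivative f (at x) v))"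

text \<open>On an arbitrary set, smooth means locally extendable to a smooth function on an open set.
  For open sets, and for relatively open subsets of linear subspaces or half spaces, this is
  the usual notion.\<close>

definition smooth_on :: "'a::euclidean_space set \<Rightarrow> ('a \<Rightarrow> 'b::euclidean_space) \<Rightarrow> bool" where
  "smooth_on S f \<longleftrightarrow>
     (\<forall>x\<in>S. \<exists>U g. open U \<and> x \<in> U \<and> (\<forall>k. Ck_on k U g) \<and> (\<forall>y\<in>S \<inter> U. f y = g y))"


section \<open>Smooth manifolds and smooth maps\<close>

text \<open>A chart is a pair of its domain and its coordinate map. The atlas need not be maximal.\<close>

record ('a, 'e) mfd =
  mtop :: "'a topology"
  atlas :: "('a set \<times> ('a \<Rightarrow> 'e)) set"

abbreviation mspace :: "('a, 'e) mfd \<Rightarrow> 'a set" where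
  "mspace M \<equiv> topspace (mtop M)"

text \<open>Every type of class \<open>euclidean_space\<close> has positive dimension. So that manifolds of dimension
  zero (for instance discrete Lie groups) are included, coordinate maps take their values in
  \<open>d\<close>-dimensional linear subspaces of the coordinate type, \<open>d\<close> being the dimension of the
  manifold. No countability axiom is imposed.\<close>

definition smooth_manifold :: "('a, 'e::euclidean_space) mfd \<Rightarrow> bool" where
  "smooth_manifold M \<longleftrightarrow>
     Hausdorff_space (mtop M) \<and>
     (\<Union>(U, \<phi>)\<in>atlas M. U) = mspace M \<and>
     (\<exists>d. \<forall>(U, \<phi>)\<in>atlas M.
        openin (mtop M) U \<and>
        homeomorphic_map (subtopology (mtop M) U) (top_of_set (\<phi> ` U)) \<phi> \<and>
        (\<exists>V. subspace V \<and> dim V = d \<and> openin (top_of_set V) (\<phi> ` U))) \<and>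
     (\<forall>(U, \<phi>)\<in>atlas M. \<forall>(U', \<phi>')\<in>atlas M.
        smooth_on (\<phi> ` (U \<inter> U')) (\<phi>' \<circ> inv_into U \<phi>))"

definition smooth_map ::
  "('a, 'e::euclidean_space) mfd \<Rightarrow> ('b, 'f::euclidean_space) mfd \<Rightarrow> ('a \<Rightarrow> 'b) \<Rightarrow> bool" where
  "smooth_map M N f \<longleftrightarrow>
     continuous_map (mtop M) (mtop N) f \<and>
     (\<forall>(U, \<phi>)\<in>atlas M. \<forall>(W, \<psi>)\<in>atlas N.
        smooth_on (\<phi> ` {x \<in> U. f x \<in> W}) (\<psi> \<circ> f \<circ> inv_into U \<phi>))"

definition prod_mfd ::
  "('a, 'e::euclidean_space) mfd \<Rightarrow> ('b, 'f::euclidean_space) mfd \<Rightarrow> ('a \<times> 'b, 'e \<times> 'f) mfd" where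
  "prod_mfd M N =
     \<lparr>mtop = prod_topology (mtop M) (mtop N),
      atlas = {(U \<times> W, map_prod \<phi> \<psi>) | U \<phi> W \<psi>. (U, \<phi>) \<in> atlas M \<and> (W, \<psi>) \<in> atlas N}\<rparr>"

definition restr_mfd :: "('a, 'e::euclidean_space) mfd \<Rightarrow> 'a set \<Rightarrow> ('a, 'e) mfd" where
  "restr_mfd M S =
     \<lparr>mtop = subtopology (mtop M) S, atlas = {(U \<inter> S, \<phi>) | U \<phi>. (U, \<phi>) \<in> atlas M}\<rparr>"

definition real_mfd :: "(real, real) mfd" where
  "real_mfd = \<lparr>mtop = euclidean, atlas = {(UNIV, id)}\<rparr>"

text \<open>A manifold with boundary, hence not a \<^const>\<open>smooth_manifold\<close>; \<^const>\<open>smooth_map\<close> and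
  \<^const>\<open>prod_mfd\<close> nevertheless have their usual meaning for it, because \<^const>\<open>smooth_on\<close> is
  defined by local extension.\<close>

definition unit_interval_mfd :: "(real, real) mfd" where
  "unit_interval_mfd = \<lparr>mtop = top_of_set {0..1}, atlas = {({0..1}, id)}\<rparr>"

definition diffeomorphism ::
  "('a, 'e::euclidean_space) mfd \<Rightarrow> ('b, 'f::euclidean_space) mfd \<Rightarrow> ('a \<Rightarrow> 'b) \<Rightarrow> bool" where
  "diffeomorphism M N f \<longleftrightarrow>
     smooth_map M N f \<and>
     (\<exists>h. smooth_map N M h \<and> (\<forall>x\<in>mspace M. h (f x) = x) \<and> (\<forall>y\<in>mspace N. f (h y) = y))"

definition smoothly_homotopic ::
  "('a, 'e::euclidean_space) mfd \<Rightarrow> ('b, 'f::euclidean_space) mfd \<Rightarrow> ('a \<Rightarrow> 'b) \<Rightarrow> ('a \<Rightarrow> 'b) \<Rightarrow> bool"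
  where
  "smoothly_homotopic M N f g \<longleftrightarrow>
     (\<exists>H. smooth_map (prod_mfd unit_interval_mfd M) N H \<and>
          (\<forall>x\<in>mspace M. H (0, x) = f x \<and> H (1, x) = g x))"

text \<open>A partition of unity subordinate to a covering is indexed by the covering itself.\<close>

definition smooth_partition_of_unity ::
  "('a, 'e::euclidean_space) mfd \<Rightarrow> 'a set set \<Rightarrow> ('a set \<Rightarrow> 'a \<Rightarrow> real) \<Rightarrow> bool" where
  "smooth_partition_of_unity M \<U> \<rho> \<longleftrightarrow>
     (\<forall>U\<in>\<U>. smooth_map M real_mfd (\<rho> U) \<and> (\<forall>x\<in>mspace M. 0 \<le> \<rho> U x) \<and>
            mtop M closure_of {x \<in> mspace M. \<rho> U x \<noteq> 0} \<subseteq> U) \<and>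
     (\<forall>x\<in>mspace M. \<exists>W. openin (mtop M) W \<and> x \<in> W \<and>
            finite {U \<in> \<U>. W \<inter> mtop M closure_of {y \<in> mspace M. \<rho> U y \<noteq> 0} \<noteq> {}}) \<and>
     (\<forall>x\<in>mspace M. (\<Sum>U\<in>{U \<in> \<U>. \<rho> U x \<noteq> 0}. \<rho> U x) = 1)"

definition paracompact_manifold :: "('a, 'e::euclidean_space) mfd \<Rightarrow> bool" where
  "paracompact_manifold M \<longleftrightarrow>
     (\<forall>\<U>. (\<forall>U\<in>\<U>. openin (mtop M) U) \<and> \<Union>\<U> = mspace M \<longrightarrow>
          (\<exists>\<rho>. smooth_partition_of_unity M \<U> \<rho>))"


section \<open>Lie groups\<close>

record ('g, 'k) lie_struct = "'g monoid" +
  lmfd :: "('g, 'k) mfd"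

definition lie_group :: "('g, 'k::euclidean_space) lie_struct \<Rightarrow> bool" where
  "lie_group G \<longleftrightarrow>
     group G \<and> smooth_manifold (lmfd G) \<and> mspace (lmfd G) = carrier G \<and>
     smooth_map (prod_mfd (lmfd G) (lmfd G)) (lmfd G) (\<lambda>(a, b). a \<otimes>\<^bsub>G\<^esub> b) \<and>
     smooth_map (lmfd G) (lmfd G) (\<lambda>a. inv\<^bsub>G\<^esub> a)"


section \<open>Principal fibre bundles\<close>

text \<open>The base manifold and the structure group are kept outside the record.\<close>

record ('p, 'e, 'b, 'g) pbundle =
  tot :: "('p, 'e) mfd"
  bproj :: "'p \<Rightarrow> 'b"
  ract :: "'p \<Rightarrow> 'g \<Rightarrow> 'p"

definition local_trivialisation ::
  "('g, 'k::euclidean_space) lie_struct \<Rightarrow> ('b, 'f::euclidean_space) mfd \<Rightarrow>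
   ('p, 'e::euclidean_space, 'b, 'g) pbundle \<Rightarrow> 'b set \<Rightarrow> ('p \<Rightarrow> 'b \<times> 'g) \<Rightarrow> bool" where
  "local_trivialisation G B \<xi> U \<tau> \<longleftrightarrow>
     openin (mtop B) U \<and>
     diffeomorphism (restr_mfd (tot \<xi>) {p \<in> mspace (tot \<xi>). bproj \<xi> p \<in> U})
       (prod_mfd (restr_mfd B U) (lmfd G)) \<tau> \<and>
     (\<forall>p\<in>mspace (tot \<xi>). bproj \<xi> p \<in> U \<longrightarrow>
        fst (\<tau> p) = bproj \<xi> p \<and>
        (\<forall>a\<in>carrier G. snd (\<tau> (ract \<xi> p a)) = snd (\<tau> p) \<otimes>\<^bsub>G\<^esub> a))"

definition principal_bundle ::
  "('g, 'k::euclidean_space) lie_struct \<Rightarrow> ('b, 'f::euclidean_space) mfd \<Rightarrow>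
   ('p, 'e::euclidean_space, 'b, 'g) pbundle \<Rightarrow> bool" where
  "principal_bundle G B \<xi> \<longleftrightarrow>
     lie_group G \<and> smooth_manifold B \<and> smooth_manifold (tot \<xi>) \<and>
     smooth_map (tot \<xi>) B (bproj \<xi>) \<and>
     smooth_map (prod_mfd (tot \<xi>) (lmfd G)) (tot \<xi>) (\<lambda>(p, a). ract \<xi> p a) \<and>
     (\<forall>p\<in>mspace (tot \<xi>). ract \<xi> p \<one>\<^bsub>G\<^esub> = p \<and>
        (\<forall>a\<in>carrier G. bproj \<xi> (ract \<xi> p a) = bproj \<xi> p \<and>
          (\<forall>b\<in>carrier G. ract \<xi> (ract \<xi> p a) b = ract \<xi> p (a \<otimes>\<^bsub>G\<^esub> b)))) \<and>
     (\<forall>x\<in>mspace B. \<exists>U \<tau>. x \<in> U \<and> local_trivialisation G B \<xi> U \<tau>)"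

text \<open>The smooth structure of the total space of the pull-back is the one for which the maps
  \<open>\<psi> (x, p) = (x, snd (\<tau> p))\<close>, for \<open>\<tau>\<close> a local trivialisation of \<open>\<xi>\<close> over \<open>U\<close>, are local
  trivialisations over \<open>f\<inverse>(U)\<close>: its charts are these \<open>\<psi>\<close> followed by product charts of \<open>M \<times> G\<close>.\<close>

definition pullback_space ::
  "('a, 'h) mfd \<Rightarrow> ('a \<Rightarrow> 'b) \<Rightarrow> ('p, 'e, 'b, 'g) pbundle \<Rightarrow> ('a \<times> 'p) set" where
  "pullback_space M f \<xi> = {(x, p). x \<in> mspace M \<and> p \<in> mspace (tot \<xi>) \<and> f x = bproj \<xi> p}"

definition pullback_bundle ::
  "('g, 'k::euclidean_space) lie_struct \<Rightarrow> ('a, 'h::euclidean_space) mfd \<Rightarrow>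
   ('b, 'f::euclidean_space) mfd \<Rightarrow> ('a \<Rightarrow> 'b) \<Rightarrow>
   ('p, 'e::euclidean_space, 'b, 'g) pbundle \<Rightarrow> ('a \<times> 'p, 'h \<times> 'k, 'a, 'g) pbundle" where
  "pullback_bundle G M N f \<xi> =
     \<lparr>tot = \<lparr>mtop = subtopology (prod_topology (mtop M) (mtop (tot \<xi>))) (pullback_space M f \<xi>),
             atlas = {({(x, p) \<in> pullback_space M f \<xi>. f x \<in> U \<and> x \<in> A \<and> snd (\<tau> p) \<in> C},
                       \<lambda>(x, p). (\<alpha> x, \<gamma> (snd (\<tau> p)))) | U \<tau> A \<alpha> C \<gamma>.
                      local_trivialisation G N \<xi> U \<tau> \<and>
                      (A, \<alpha>) \<in> atlas M \<and> (C, \<gamma>) \<in> atlas (lmfd G)}\<rparr>,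
      bproj = fst,
      ract = \<lambda>(x, p) a. (x, ract \<xi> p a)\<rparr>"

definition pb_morphism ::
  "('g, 'k::euclidean_space) lie_struct \<Rightarrow> ('b, 'f::euclidean_space) mfd \<Rightarrow>
   ('p, 'e::euclidean_space, 'b, 'g) pbundle \<Rightarrow> ('q, 'd::euclidean_space, 'b, 'g) pbundle \<Rightarrow>
   ('p \<Rightarrow> 'q) \<Rightarrow> bool" where
  "pb_morphism G B \<xi> \<eta> \<Phi> \<longleftrightarrow>
     principal_bundle G B \<xi> \<and> principal_bundle G B \<eta> \<and>
     smooth_map (tot \<xi>) (tot \<eta>) \<Phi> \<and>
     (\<forall>p\<in>mspace (tot \<xi>). bproj \<eta> (\<Phi> p) = bproj \<xi> p \<and>
        (\<forall>a\<in>carrier G. \<Phi> (ract \<xi> p a) = ract \<eta> (\<Phi> p) a))"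

definition pb_isomorphism ::
  "('g, 'k::euclidean_space) lie_struct \<Rightarrow> ('b, 'f::euclidean_space) mfd \<Rightarrow>
   ('p, 'e::euclidean_space, 'b, 'g) pbundle \<Rightarrow> ('q, 'd::euclidean_space, 'b, 'g) pbundle \<Rightarrow>
   ('p \<Rightarrow> 'q) \<Rightarrow> bool" where
  "pb_isomorphism G B \<xi> \<eta> \<Phi> \<longleftrightarrow>
     pb_morphism G B \<xi> \<eta> \<Phi> \<and>
     (\<exists>\<Psi>. pb_morphism G B \<eta> \<xi> \<Psi> \<and>
          (\<forall>p\<in>mspace (tot \<xi>). \<Psi> (\<Phi> p) = p) \<and> (\<forall>q\<in>mspace (tot \<eta>). \<Phi> (\<Psi> q) = q))"

end

theory Submission
  imports Defs
begin

text \<open>\<open>M\<close> need not be paracompact, so everything that is patched together has to come from \<open>N\<close>.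
  Extend the homotopy to \<open>H\<close> on \<open>\<real> \<times> M\<close>, constant in time before 0 and after 1. A partition of unity
  on \<open>N\<close> gives weights \<open>w\<^sub>U\<close> indexed by the trivialising open sets \<open>U\<close>, and a smooth step size
  \<open>\<epsilon> > 0\<close> on \<open>M\<close>, obtained from the integrals over \<open>[0, 1]\<close> of the squared time derivatives of functions on \<open>N\<close>
  pulled back along \<open>H\<close>, such that \<open>H (s, x)\<close> stays in \<open>U\<close> for \<open>t \<le> s \<le> t + \<epsilon> x\<close> whenever
  \<open>w\<^sub>U (H (t, x)) \<noteq> 0\<close>. To transport the fibre over \<open>H (t, x)\<close> to the fibre over \<open>H (t + \<epsilon> x, x)\<close>,
  order the sets \<open>U\<close> linearly and advance time for each of them in turn by \<open>\<epsilon> x w\<^sub>U (H (t, x))\<close>, moving the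
  point by means of the trivialisation over \<open>U\<close>; only finitely many of these steps are not the identity
  near a given point. Infinitely many such transports lead from \<open>f\<close> to \<open>g\<close>, but since \<open>H\<close> is
  constant after time 1, near each point all but finitely many of them are the identity.\<close>

section \<open>Calculus of \<open>C\<^sup>k\<close> functions\<close>

text \<open>With a partition of unity on \<open>M\<close> one could choose step sizes locally and
  patch them; without one, a global formula smooth in \<open>x\<close> is required. The maximal
  speed of the path \<open>H (-, x)\<close> need not depend smoothly on \<open>x\<close>, whereas
  the integral of a squared speed does, and it still bounds how far a function can change in a short
  time. Functions on \<open>N\<close> detect when a path leaves \<open>U\<close>: the weight
  \<open>w\<^sub>U\<close> is nonzero only where an auxiliary \<open>q\<^sub>U\<close>, vanishing
  off \<open>U\<close>, exceeds 1/2, and during one step \<open>q\<^sub>U\<close> changes by at most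
  1/4. Compactness of \<open>[0, 1]\<close> makes the functions \<open>q\<^sub>U\<close> pulled back
  along \<open>H\<close> a locally finite family on \<open>M\<close>, so one step size can serve all
  \<open>U\<close>. As \<epsilon> may have infimum 0, no fixed number of steps reaches time 1
  everywhere; hence the infinite composition, and the need that later transports be the identity
  itself, not just some automorphism of the fibre. Fibrewise maps are described by group-valued
  functions on \<open>M\<close>, so that total spaces of pull-backs enter only when such a map is
  finally turned into a morphism.\<close>

lemma Ck_on_subset: "Ck_on k U f \<Longrightarrow> V \<subseteq> U \<Longrightarrow> Ck_on k V f"
  by (induction k arbitrary: f) (auto intro: continuous_on_subset)

lemma frechet_derivative_cong_open:
  assumes "open U" "x \<in> U" "\<And>y. y \<in> U \<Longrightarrow> f y = g y"
  shows "frechet_derivative f (at x) = frechet_derivative g (at x)"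
proof -
  have "(f has_derivative D) (at x) \<longleftrightarrow> (g has_derivative D) (at x)" for D
    using assms by (metis has_derivative_transform_within_open)
  then show ?thesis by (simp add: frechet_derivative_def)
qed

text \<open>\<open>frechet_derivative\<close> is taken along the full neighbourhood filter, so
  agreement on \<open>U\<close> carries over to derivatives because \<open>U\<close> is
  open.\<close>

lemma Ck_on_cong:
  assumes "open U" "\<And>y. y \<in> U \<Longrightarrow> f y = g y" "Ck_on k U f"
  shows "Ck_on k U g"
  using assms(2,3)
proof (induction k arbitrary: f g)
  case 0
  then show ?case by (simp cong: continuous_on_cong)
next
  case (Suc k)
  have "g differentiable (at x)" if "x \<in> U" for x
    using Suc.prems assms(1) that unfolding differentiable_def Ck_on.simps
    by (metis has_derivative_transform_within_open)
  moreover have "Ck_on k U (\<lambda>x. frechet_derivative g (at x) v)" for v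
  proof (rule Suc.IH)
    show "Ck_on k U (\<lambda>x. frechet_derivative f (at x) v)" using Suc.prems by simp
    show "frechet_derivative f (at y) v = frechet_derivative g (at y) v" if "y \<in> U" for y
      using frechet_derivative_cong_open[OF assms(1) that Suc.prems(1)] by simp
  qed
  ultimately show ?case by simp
qed

lemma Ck_on_local:
  assumes "\<And>x. x \<in> U \<Longrightarrow> \<exists>V. open V \<and> x \<in> V \<and> Ck_on k (U \<inter> V) f"
  shows "Ck_on k U f"
  using assms
proof (induction k arbitrary: f)
  case 0
  have "continuous_on U f"
    unfolding continuous_on_eq_continuous_within
  proof
    fix x assume x: "x \<in> U"
    then obtain V where V: "open V" "x \<in> V" "continuous_on (U \<inter> V) f" using 0 by auto
    then have "continuous (at x within U \<inter> V) f" using x by (auto simp: continuous_on_eq_continuous_within)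
    then show "continuous (at x within U) f"
      using at_within_nhd[OF V(2,1), of U "U \<inter> V"] by (simp add: continuous_within Int_assoc)
  qed
  then show ?case by simp
next
  case (Suc k)
  have "f differentiable (at x)" if "x \<in> U" for x
    using Suc.prems[OF that] that by auto
  moreover have "Ck_on k U (\<lambda>x. frechet_derivative f (at x) v)" for v
    by (rule Suc.IH) (use Suc.prems in fastforce)
  ultimately show ?case by simp
qed

lemma Ck_on_SucD: "Ck_on (Suc k) U f \<Longrightarrow> Ck_on k U f"
proof (induction k arbitrary: f)
  case 0
  then show ?case
    by (auto intro!: continuous_at_imp_continuous_on differentiable_imp_continuous_within)
qed auto

text \<open>\<open>Ck_on\<close> speaks of \<open>frechet_derivative\<close>; uniqueness of
  derivatives allows any explicit family \<open>f'\<close> instead. The closure properties below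
  rest on this rule and an induction on \<open>k\<close>.\<close>

lemma Ck_on_SucI:
  assumes "open U" "\<And>x. x \<in> U \<Longrightarrow> (f has_derivative f' x) (at x)"
    "\<And>v. Ck_on k U (\<lambda>x. f' x v)"
  shows "Ck_on (Suc k) U f"
proof -
  have "frechet_derivative f (at x) = f' x" if "x \<in> U" for x
    using assms(2)[OF that] frechet_derivative_at by metis
  then have "Ck_on k U (\<lambda>x. frechet_derivative f (at x) v)" for v
    by (intro Ck_on_cong[OF assms(1) _ assms(3)[of v]]) simp
  then show ?thesis using assms(2) by (auto simp: differentiable_def)
qed

lemma Ck_on_has_derivative:
  "Ck_on (Suc k) U f \<Longrightarrow> x \<in> U \<Longrightarrow> (f has_derivative frechet_derivative f (at x)) (at x)"
  by (simp add: frechet_derivative_works)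

lemma Ck_on_const: "open U \<Longrightarrow> Ck_on k U (\<lambda>x. c)"
proof (induction k arbitrary: c)
  case (Suc k)
  show ?case by (rule Ck_on_SucI[where f'="\<lambda>x v. 0"]) (use Suc in auto)
qed simp

lemma Ck_on_bounded_linear_comp:
  assumes "open U" "bounded_linear L" "Ck_on k U f"
  shows "Ck_on k U (\<lambda>x. L (f x))"
  using assms(3)
proof (induction k arbitrary: f)
  case 0
  then show ?case using assms(2) by (auto intro: bounded_linear.continuous_on)
next
  case (Suc k)
  show ?case
  proof (rule Ck_on_SucI[OF assms(1)])
    show "((\<lambda>x. L (f x)) has_derivative (\<lambda>v. L (frechet_derivative f (at x) v))) (at x)" if "x \<in> U" for x
      using bounded_linear.has_derivative[OF assms(2) Ck_on_has_derivative[OF Suc.prems that]] .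
    show "Ck_on k U (\<lambda>x. L (frechet_derivative f (at x) v))" for v
      using Suc by auto
  qed
qed

lemma Ck_on_bounded_linear:
  assumes "open U" "bounded_linear L"
  shows "Ck_on k U L"
proof (cases k)
  case 0
  then show ?thesis using assms by (simp add: linear_continuous_on)
next
  case (Suc j)
  show ?thesis unfolding Suc
    by (rule Ck_on_SucI[OF assms(1), where f'="\<lambda>x v. L v"])
      (use assms in \<open>auto intro: bounded_linear_imp_has_derivative Ck_on_const\<close>)
qed

lemma Ck_on_add:
  assumes "open U" "Ck_on k U f" "Ck_on k U g"
  shows "Ck_on k U (\<lambda>x. f x + g x)"
  using assms(2,3)
proof (induction k arbitrary: f g)
  case 0
  then show ?case by (auto intro: continuous_on_add)
next
  case (Suc k)
  show ?case
  proof (rule Ck_on_SucI[OF assms(1)])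
    show "((\<lambda>x. f x + g x) has_derivative
        (\<lambda>v. frechet_derivative f (at x) v + frechet_derivative g (at x) v)) (at x)" if "x \<in> U" for x
      using Ck_on_has_derivative[OF Suc.prems(1) that] Ck_on_has_derivative[OF Suc.prems(2) that]
      by (rule has_derivative_add)
    show "Ck_on k U (\<lambda>x. frechet_derivative f (at x) v + frechet_derivative g (at x) v)" for v
      using Suc by auto
  qed
qed

lemma Ck_on_sum:
  assumes "open U" "\<And>i. i \<in> I \<Longrightarrow> Ck_on k U (f i)"
  shows "Ck_on k U (\<lambda>x. \<Sum>i\<in>I. f i x)"
  using assms(2)
  by (induction I rule: infinite_finite_induct) (auto intro: Ck_on_add Ck_on_const assms(1))

lemma Ck_on_bilinear:
  assumes "open U" "bounded_bilinear B" "Ck_on k U f" "Ck_on k U g"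
  shows "Ck_on k U (\<lambda>x. B (f x) (g x))"
  using assms(3,4)
proof (induction k arbitrary: f g)
  case 0
  then show ?case using assms(2) by (auto intro: bounded_bilinear.continuous_on)
next
  case (Suc k)
  show ?case
  proof (rule Ck_on_SucI[OF assms(1)])
    show "((\<lambda>x. B (f x) (g x)) has_derivative
        (\<lambda>v. B (f x) (frechet_derivative g (at x) v) + B (frechet_derivative f (at x) v) (g x))) (at x)"
      if "x \<in> U" for x
      using bounded_bilinear.FDERIV[OF assms(2) Ck_on_has_derivative[OF Suc.prems(1) that]
          Ck_on_has_derivative[OF Suc.prems(2) that]] .
    show "Ck_on k U (\<lambda>x. B (f x) (frechet_derivative g (at x) v) + B (frechet_derivative f (at x) v) (g x))" for v
      using Suc.prems Ck_on_SucD[OF Suc.prems(1)] Ck_on_SucD[OF Suc.prems(2)]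
      by (auto intro!: Ck_on_add assms(1) Suc.IH)
  qed
qed

lemma Ck_on_Pair:
  assumes "open U" "Ck_on k U f" "Ck_on k U g"
  shows "Ck_on k U (\<lambda>x. (f x, g x))"
proof -
  have "Ck_on k U (\<lambda>x. (f x, 0) + (0, g x))"
    by (intro Ck_on_add assms(1)
        Ck_on_bounded_linear_comp[OF assms(1) _ assms(2), where L="\<lambda>a. (a, 0)"]
        Ck_on_bounded_linear_comp[OF assms(1) _ assms(3), where L="\<lambda>a. (0, a)"]
        bounded_linear_Pair bounded_linear_ident bounded_linear_zero)
  then show ?thesis by simp
qed

text \<open>The chain rule gives \<open>g' (f x) (f' x v)\<close>, whose direction varies with
  \<open>x\<close>, while the induction hypothesis covers derivatives of \<open>g\<close> in fixed
  directions. Expanding \<open>f' x v\<close> in the basis leaves a finite sum of products to which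
  the hypothesis applies.\<close>

lemma Ck_on_compose:
  fixes f :: "'a::euclidean_space \<Rightarrow> 'b::euclidean_space" and g :: "'b \<Rightarrow> 'c::euclidean_space"
  assumes "open U" "Ck_on k U f" "Ck_on k V g" "f ` U \<subseteq> V"
  shows "Ck_on k U (g \<circ> f)"
  using assms(2,3)
proof (induction k arbitrary: g)
  case 0
  then show ?case using assms(4) continuous_on_compose2[of V g U f] by (auto simp: o_def)
next
  case (Suc k)
  let ?f' = "\<lambda>x. frechet_derivative f (at x)" and ?g' = "\<lambda>y. frechet_derivative g (at y)"
  show ?case
  proof (rule Ck_on_SucI[OF assms(1)])
    show "((g \<circ> f) has_derivative (\<lambda>v. \<Sum>b\<in>Basis. (?f' x v \<bullet> b) *\<^sub>R ?g' (f x) b)) (at x)" if "x \<in> U" for x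
    proof -
      have g: "(g has_derivative ?g' (f x)) (at (f x))"
        using that assms(4) Suc.prems(2) by (intro Ck_on_has_derivative) auto
      have "(\<lambda>v. \<Sum>b\<in>Basis. (?f' x v \<bullet> b) *\<^sub>R ?g' (f x) b) = ?g' (f x) \<circ> ?f' x"
      proof
        fix v
        have l: "linear (?g' (f x))" using has_derivative_linear[OF g] .
        have "?g' (f x) (?f' x v) = ?g' (f x) (\<Sum>b\<in>Basis. (?f' x v \<bullet> b) *\<^sub>R b)"
          by (simp add: euclidean_representation)
        also have "\<dots> = (\<Sum>b\<in>Basis. (?f' x v \<bullet> b) *\<^sub>R ?g' (f x) b)"
          by (simp add: linear_sum[OF l] linear_scale[OF l])
        finally show "(\<Sum>b\<in>Basis. (?f' x v \<bullet> b) *\<^sub>R ?g' (f x) b) = (?g' (f x) \<circ> ?f' x) v" by simp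
      qed
      then show ?thesis
        using diff_chain_at[OF Ck_on_has_derivative[OF Suc.prems(1) that] g] by simp
    qed
    fix v
    have "Ck_on k U (\<lambda>x. ?g' (f x) b)" for b
    proof -
      have "Ck_on k V (\<lambda>y. ?g' y b)" using Suc.prems by simp
      from Suc.IH[OF Ck_on_SucD[OF Suc.prems(1)] this] show ?thesis by (simp add: o_def)
    qed
    then show "Ck_on k U (\<lambda>x. \<Sum>b\<in>Basis. (?f' x v \<bullet> b) *\<^sub>R ?g' (f x) b)"
      using Suc.prems
      by (intro Ck_on_sum assms(1) Ck_on_bilinear[OF assms(1) bounded_bilinear_scaleR]
          Ck_on_bounded_linear_comp[OF assms(1) bounded_linear_inner_left]) auto
  qed
qed

section \<open>Smooth functions of one real variable\<close>

lemma Ck_on_coinduct_real: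
  fixes \<F> :: "(real \<Rightarrow> real) set"
  assumes "open U" "f \<in> \<F>"
    "\<And>f. f \<in> \<F> \<Longrightarrow> \<exists>f'\<in>\<F>. \<forall>x\<in>U. (f has_real_derivative f' x) (at x)"
  shows "Ck_on k U f"
proof -
  \<comment> \<open>Induction on \<open>k\<close> for the whole family at once: a derivative is
    again a member, so closure of \<open>\<F>\<close> under one differentiation replaces a formula
    for all higher derivatives.\<close>
  have "\<forall>f\<in>\<F>. Ck_on k U f"
  proof (induction k)
    case 0
    then show ?case using assms(1,3)
      by (auto intro!: continuous_at_imp_continuous_on intro: DERIV_isCont)
  next
    case (Suc k)
    show ?case
    proof
      fix f assume "f \<in> \<F>"
      then obtain f' where f': "f' \<in> \<F>" "\<And>x. x \<in> U \<Longrightarrow> (f has_real_derivative f' x) (at x)"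
        using assms(3) by blast
      show "Ck_on (Suc k) U f"
      proof (rule Ck_on_SucI[OF assms(1)])
        show "(f has_derivative (\<lambda>v. v * f' x)) (at x)" if "x \<in> U" for x
          using f'(2)[OF that] by (simp add: has_field_derivative_def mult.commute[of _ "f' x"] lambda_one)
        show "Ck_on k U (\<lambda>x. v * f' x)" for v
          using Suc f'(1) by (intro Ck_on_bounded_linear_comp[OF assms(1) bounded_linear_mult_right]) auto
      qed
    qed
  qed
  then show ?thesis using assms(2) by blast
qed

text \<open>The family is that of polynomials in \<open>1/x\<close>; as the derivative of
  \<open>1/x\<close> is the negative of its square, differentiation acts on polynomials as
  \<open>p \<mapsto> pderiv p * [:0,0,-1:]\<close>.\<close>

lemma Ck_on_inverse_real: "Ck_on k (- {0}) (inverse :: real \<Rightarrow> real)"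
proof (rule Ck_on_coinduct_real)
  show "inverse \<in> range (\<lambda>p x. poly p (inverse x :: real))"
    by (auto intro!: image_eqI[where x="[:0,1:]"])
  fix f assume "f \<in> range (\<lambda>p x. poly p (inverse x :: real))"
  then obtain p where f: "f = (\<lambda>x. poly p (inverse x))" by auto
  have "\<forall>x\<in>- {0}. (f has_real_derivative poly (pderiv p * [:0,0,-1:]) (inverse x)) (at x)"
  proof
    fix x :: real assume "x \<in> - {0}"
    then have "(inverse has_real_derivative - (inverse x * inverse x)) (at x)"
      using DERIV_inverse[of x UNIV] by (simp add: power2_eq_square)
    from DERIV_chain2[OF poly_DERIV this, of p]
    show "(f has_real_derivative poly (pderiv p * [:0,0,-1:]) (inverse x)) (at x)"
      unfolding f by (simp add: mult_ac)
  qed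
  then show "\<exists>f'\<in>range (\<lambda>p x. poly p (inverse x :: real)). \<forall>x\<in>- {0}. (f has_real_derivative f' x) (at x)"
    by (intro bexI[of _ "\<lambda>x. poly (pderiv p * [:0,0,-1:]) (inverse x)"]) (assumption, rule rangeI)
qed auto

text \<open>The classical smooth, non-analytic function, flat to infinite order at 0. Since it
  vanishes exactly on the nonpositive half line, it is the source of the cut-offs below.\<close>

definition flat :: "real \<Rightarrow> real" where
  "flat x = (if x \<le> 0 then 0 else exp (- inverse x))"

lemma flat_nonneg: "0 \<le> flat x" and flat_eq_0_iff: "flat x = 0 \<longleftrightarrow> x \<le> 0"
  by (auto simp: flat_def)

lemma tendsto_poly_div_exp: "((\<lambda>y. poly p y / exp y) \<longlongrightarrow> (0::real)) at_top"
proof -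
  have "((\<lambda>y. \<Sum>i\<le>degree p. coeff p i * (y ^ i / exp y)) \<longlongrightarrow> (\<Sum>i\<le>degree p. coeff p i * 0)) at_top"
    by (intro tendsto_intros tendsto_power_div_exp_0)
  then show ?thesis by (simp add: poly_altdef sum_divide_distrib)
qed

text \<open>The functions \<open>p (1/x) * exp (- 1/x)\<close>, continued by 0, are closed under
  differentiation. Only the point 0 needs an argument, and there the exponential beats every
  polynomial.\<close>

lemma Ck_on_flat: "Ck_on k UNIV flat"
proof (rule Ck_on_coinduct_real)
  define F where "F = (\<lambda>p (x::real). if x \<le> 0 then 0 else poly p (inverse x) * exp (- inverse x))"
  show "flat \<in> range F"
    by (auto simp: F_def flat_def intro!: image_eqI[where x="[:1:]"])
  fix f assume "f \<in> range F"
  then obtain p where f: "f = F p" by auto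
  \<comment> \<open>The second summand comes from the factor \<open>exp (- inverse x)\<close>, whose
    logarithmic derivative is the square of \<open>1/x\<close>.\<close>
  let ?q = "pderiv p * [:0,0,-1:] + p * [:0,0,1:]"
  have "(F p has_real_derivative F ?q x) (at x)" for x
  proof -
    consider "x < 0" | "x = 0" | "x > 0" by linarith
    then show ?thesis
    proof cases
      case 1
      have "eventually (\<lambda>x. F p x = 0) (nhds x)"
        using eventually_nhds_in_open[of "{..<0}" x] 1
        by (auto elim!: eventually_mono simp: F_def)
      then have "(F p has_real_derivative 0) (at x)"
        by (simp add: DERIV_cong_ev[of x x "F p" "\<lambda>x. 0" 0 0])
      then show ?thesis using 1 by (simp add: F_def)
    next
      case 3
      have "((\<lambda>x. poly p (inverse x) * exp (- inverse x)) has_real_derivative F ?q x) (at x)"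
      proof -
        have i: "(inverse has_real_derivative - (inverse x * inverse x)) (at x)"
          using 3 DERIV_inverse[of x UNIV] by (simp add: power2_eq_square)
        have "((\<lambda>x. exp (- inverse x)) has_real_derivative exp (- inverse x) * - (- (inverse x * inverse x))) (at x)"
          by (rule DERIV_chain2[OF DERIV_exp DERIV_minus[OF i]])
        from DERIV_mult[OF DERIV_chain2[OF poly_DERIV i, of p] this]
        show ?thesis using 3 by (simp add: F_def algebra_simps)
      qed
      moreover have "eventually (\<lambda>x. poly p (inverse x) * exp (- inverse x) = F p x) (nhds x)"
        using eventually_nhds_in_open[of "{0<..}" x] 3
        by (auto elim!: eventually_mono simp: F_def)
      ultimately show ?thesis
        by (simp add: DERIV_cong_ev[of x x "\<lambda>x. poly p (inverse x) * exp (- inverse x)" "F p"])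
    next
      case 2
      have "((\<lambda>h. F p h / h) \<longlongrightarrow> 0) (at_right 0)"
      proof -
        \<comment> \<open>With \<open>y = 1/h\<close> the difference quotient at 0 becomes
          \<open>y * p y / exp y\<close>, and \<open>pCons 0 p\<close> is the polynomial in the
          numerator.\<close>
        have "((\<lambda>y. poly (pCons 0 p) y / exp y) \<longlongrightarrow> (0::real)) at_top" by (rule tendsto_poly_div_exp)
        then have "((\<lambda>h. poly (pCons 0 p) (inverse h) / exp (inverse h)) \<longlongrightarrow> (0::real)) (at_right 0)"
          using filterlim_compose[OF _ filterlim_inverse_at_top_right] by blast
        then show ?thesis
          by (rule Lim_transform_eventually)
            (auto simp: eventually_at_right[of 0 1] F_def exp_minus field_simps intro!: exI[of _ 1])
      qed
      moreover have "((\<lambda>h. F p h / h) \<longlongrightarrow> 0) (at_left 0)"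
        by (rule tendsto_eventually) (auto simp: eventually_at_left[of "-1" 0] F_def intro!: exI[of _ "-1"])
      ultimately have "((\<lambda>h. F p h / h) \<longlongrightarrow> 0) (at 0)"
        by (simp add: filterlim_split_at)
      moreover have "F p 0 = 0" "F ?q 0 = 0" by (simp_all add: F_def)
      ultimately show ?thesis using 2 by (simp add: DERIV_def)
    qed
  qed
  then show "\<exists>f'\<in>range F. \<forall>x\<in>UNIV. (f has_real_derivative f' x) (at x)"
    using f by blast
qed simp


section \<open>Smooth functions on arbitrary sets\<close>

lemma smooth_onE:
  assumes "smooth_on S f" "x \<in> S"
  obtains U g where "open U" "x \<in> U" "\<forall>k. Ck_on k U g" "\<forall>y\<in>S \<inter> U. f y = g y"
proof -
  have "\<exists>U g. open U \<and> x \<in> U \<and> (\<forall>k. Ck_on k U g) \<and> (\<forall>y\<in>S \<inter> U. f y = g y)"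
    using assms unfolding smooth_on_def by (rule bspec)
  then show thesis using that by (elim exE conjE)
qed

lemma smooth_onI:
  assumes "\<And>x. x \<in> S \<Longrightarrow> \<exists>U g. open U \<and> x \<in> U \<and> (\<forall>k. Ck_on k U g) \<and> (\<forall>y\<in>S \<inter> U. f y = g y)"
  shows "smooth_on S f"
  using assms unfolding smooth_on_def by (rule ballI)

lemma smooth_on_open:
  assumes "open S"
  shows "smooth_on S f \<longleftrightarrow> (\<forall>k. Ck_on k S f)"
proof
  assume L: "smooth_on S f"
  show "\<forall>k. Ck_on k S f"
  proof
    fix k
    show "Ck_on k S f"
    proof (rule Ck_on_local)
      fix x assume "x \<in> S"
      then obtain U g where U: "open U" "x \<in> U" "\<forall>k. Ck_on k U g" "\<forall>y\<in>S \<inter> U. f y = g y"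
        by (rule smooth_onE[OF L])
      have "Ck_on k (S \<inter> U) f"
        by (rule Ck_on_cong[where f=g]) (use U assms Ck_on_subset[OF U(3)[rule_format], of "S \<inter> U"] in auto)
      then show "\<exists>V. open V \<and> x \<in> V \<and> Ck_on k (S \<inter> V) f" using U by blast
    qed
  qed
qed (use assms in \<open>auto simp: smooth_on_def\<close>)

lemma smooth_on_subset: "smooth_on S f \<Longrightarrow> T \<subseteq> S \<Longrightarrow> smooth_on T f"
proof (rule smooth_onI)
  fix x assume f: "smooth_on S f" and "T \<subseteq> S" "x \<in> T"
  then have "x \<in> S" by blast
  from smooth_onE[OF f this] obtain U g
    where "open U" "x \<in> U" "\<forall>k. Ck_on k U g" "\<forall>y\<in>S \<inter> U. f y = g y" .
  then show "\<exists>U g. open U \<and> x \<in> U \<and> (\<forall>k. Ck_on k U g) \<and> (\<forall>y\<in>T \<inter> U. f y = g y)"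
    using \<open>T \<subseteq> S\<close> by (intro exI[of _ U] exI[of _ g]) auto
qed

lemma smooth_on_cong:
  assumes "smooth_on S f" "\<And>x. x \<in> S \<Longrightarrow> f x = g x"
  shows "smooth_on S g"
proof (rule smooth_onI)
  fix x assume "x \<in> S"
  from smooth_onE[OF assms(1) this] obtain U h
    where "open U" "x \<in> U" "\<forall>k. Ck_on k U h" "\<forall>y\<in>S \<inter> U. f y = h y" .
  then show "\<exists>U h. open U \<and> x \<in> U \<and> (\<forall>k. Ck_on k U h) \<and> (\<forall>y\<in>S \<inter> U. g y = h y)"
    using assms(2) by (intro exI[of _ U] exI[of _ h]) auto
qed

lemma smooth_on_local:
  assumes "\<And>x. x \<in> S \<Longrightarrow> \<exists>T. open T \<and> x \<in> T \<and> smooth_on (S \<inter> T) f"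
  shows "smooth_on S f"
proof (rule smooth_onI)
  fix x assume x: "x \<in> S"
  then obtain T where T: "open T" "x \<in> T" "smooth_on (S \<inter> T) f" using assms by blast
  from x T have "x \<in> S \<inter> T" by blast
  from smooth_onE[OF T(3) this] obtain U g
    where U: "open U" "x \<in> U" "\<forall>k. Ck_on k U g" "\<forall>y\<in>S \<inter> T \<inter> U. f y = g y" .
  then have "open (T \<inter> U) \<and> x \<in> T \<inter> U \<and> (\<forall>k. Ck_on k (T \<inter> U) g) \<and> (\<forall>y\<in>S \<inter> (T \<inter> U). f y = g y)"
    using T by (auto intro: Ck_on_subset)
  then show "\<exists>U g. open U \<and> x \<in> U \<and> (\<forall>k. Ck_on k U g) \<and> (\<forall>y\<in>S \<inter> U. f y = g y)" by blast
qed

lemma smooth_on_compose: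
  assumes f: "smooth_on S f" and g: "smooth_on T g" and "f ` S \<subseteq> T"
  shows "smooth_on S (g \<circ> f)"
proof (rule smooth_onI)
  fix x assume x: "x \<in> S"
  from smooth_onE[OF f this] obtain U f'
    where U: "open U" "x \<in> U" "\<forall>k. Ck_on k U f'" "\<forall>y\<in>S \<inter> U. f y = f' y" .
  have "f x \<in> T" using x assms(3) by blast
  from smooth_onE[OF g this] obtain V g'
    where V: "open V" "f x \<in> V" "\<forall>k. Ck_on k V g'" "\<forall>y\<in>T \<inter> V. g y = g' y" .
  let ?W = "U \<inter> f' -` V"
  have o: "open ?W"
    using U(1) U(3)[rule_format, of 0] V(1) by (simp add: continuous_open_preimage)
  have "Ck_on k ?W (g' \<circ> f')" for k
    by (rule Ck_on_compose[OF o Ck_on_subset[OF U(3)[rule_format]] V(3)[rule_format]]) auto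
  moreover have "x \<in> ?W" using x U(2,4) V(2) by auto
  moreover have "\<forall>y\<in>S \<inter> ?W. (g \<circ> f) y = (g' \<circ> f') y" using U(4) V(4) assms(3) by fastforce
  ultimately show "\<exists>U h. open U \<and> x \<in> U \<and> (\<forall>k. Ck_on k U h) \<and> (\<forall>y\<in>S \<inter> U. (g \<circ> f) y = h y)"
    using o by blast
qed

lemma smooth_on_Pair:
  assumes "smooth_on S f" "smooth_on S g"
  shows "smooth_on S (\<lambda>x. (f x, g x))"
proof (rule smooth_onI)
  fix x assume x: "x \<in> S"
  from smooth_onE[OF assms(1) this] obtain U f'
    where U: "open U" "x \<in> U" "\<forall>k. Ck_on k U f'" "\<forall>y\<in>S \<inter> U. f y = f' y" .
  from smooth_onE[OF assms(2) x] obtain V g'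
    where V: "open V" "x \<in> V" "\<forall>k. Ck_on k V g'" "\<forall>y\<in>S \<inter> V. g y = g' y" .
  have "Ck_on k (U \<inter> V) (\<lambda>x. (f' x, g' x))" for k
    using U V by (intro Ck_on_Pair Ck_on_subset[OF U(3)[rule_format]] Ck_on_subset[OF V(3)[rule_format]]) auto
  moreover have "open (U \<inter> V)" "x \<in> U \<inter> V" "\<forall>y\<in>S \<inter> (U \<inter> V). (f y, g y) = (f' y, g' y)" using U V by auto
  ultimately show "\<exists>U h. open U \<and> x \<in> U \<and> (\<forall>k. Ck_on k U h) \<and> (\<forall>y\<in>S \<inter> U. (f y, g y) = h y)"
    by (intro exI[of _ "U \<inter> V"] exI[of _ "\<lambda>x. (f' x, g' x)"]) auto
qed

lemma smooth_on_bounded_linear: "bounded_linear L \<Longrightarrow> smooth_on S L"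
  unfolding smooth_on_def by (intro ballI exI[of _ UNIV] exI[of _ L]) (auto intro: Ck_on_bounded_linear)

lemma smooth_on_const: "smooth_on S (\<lambda>x. c)"
  unfolding smooth_on_def by (intro ballI exI[of _ UNIV] exI[of _ "\<lambda>x. c"]) (auto intro: Ck_on_const)


section \<open>Smooth maps between spaces with a smooth atlas\<close>

text \<open>Compared with \<^const>\<open>smooth_manifold\<close>, neither the Hausdorff axiom nor any condition on the
  images of the charts is imposed, so the unit interval is included.\<close>

definition smooth_atlas :: "('a, 'e::euclidean_space) mfd \<Rightarrow> bool" where
  "smooth_atlas M \<longleftrightarrow>
     (\<Union>(U, \<phi>)\<in>atlas M. U) = mspace M \<and>
     (\<forall>(U, \<phi>)\<in>atlas M. openin (mtop M) U \<and>
        homeomorphic_map (subtopology (mtop M) U) (top_of_set (\<phi> ` U)) \<phi>) \<and>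
     (\<forall>(U, \<phi>)\<in>atlas M. \<forall>(U', \<phi>')\<in>atlas M.
        smooth_on (\<phi> ` (U \<inter> U')) (\<phi>' \<circ> inv_into U \<phi>))"

lemma smooth_atlasI:
  assumes "(\<Union>(U, \<phi>)\<in>atlas M. U) = mspace M"
    and "\<And>U \<phi>. (U, \<phi>) \<in> atlas M \<Longrightarrow> openin (mtop M) U"
    and "\<And>U \<phi>. (U, \<phi>) \<in> atlas M \<Longrightarrow>
      homeomorphic_map (subtopology (mtop M) U) (top_of_set (\<phi> ` U)) \<phi>"
    and "\<And>U \<phi> U' \<phi>'. (U, \<phi>) \<in> atlas M \<Longrightarrow> (U', \<phi>') \<in> atlas M \<Longrightarrow>
      smooth_on (\<phi> ` (U \<inter> U')) (\<phi>' \<circ> inv_into U \<phi>)"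
  shows "smooth_atlas M"
  unfolding smooth_atlas_def by (intro conjI assms(1)) (use assms(2-4) in \<open>auto simp: split_beta\<close>)

lemma smooth_manifold_imp_smooth_atlas: "smooth_manifold M \<Longrightarrow> smooth_atlas M"
  unfolding smooth_manifold_def smooth_atlas_def by fast

lemma chart_at:
  assumes "smooth_atlas M" "x \<in> mspace M"
  obtains U \<phi> where "(U, \<phi>) \<in> atlas M" "x \<in> U"
  using assms unfolding smooth_atlas_def by blast

lemma chart_openin: "smooth_atlas M \<Longrightarrow> (U, \<phi>) \<in> atlas M \<Longrightarrow> openin (mtop M) U"
  unfolding smooth_atlas_def by blast

lemma chart_subset: "smooth_atlas M \<Longrightarrow> (U, \<phi>) \<in> atlas M \<Longrightarrow> U \<subseteq> mspace M"
  using chart_openin openin_subset by blast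

lemma chart_homeomorphic_map:
  "smooth_atlas M \<Longrightarrow> (U, \<phi>) \<in> atlas M \<Longrightarrow>
    homeomorphic_map (subtopology (mtop M) U) (top_of_set (\<phi> ` U)) \<phi>"
  unfolding smooth_atlas_def by blast

lemma chart_inj_on: "smooth_atlas M \<Longrightarrow> (U, \<phi>) \<in> atlas M \<Longrightarrow> inj_on \<phi> U"
  using homeomorphic_imp_injective_map[OF chart_homeomorphic_map] chart_subset
  by (metis inf.absorb_iff2 topspace_subtopology)

lemma chart_inv:
  "smooth_atlas M \<Longrightarrow> (U, \<phi>) \<in> atlas M \<Longrightarrow> x \<in> U \<Longrightarrow> inv_into U \<phi> (\<phi> x) = x"
  by (simp add: chart_inj_on)

lemma chart_transition:
  "smooth_atlas M \<Longrightarrow> (U, \<phi>) \<in> atlas M \<Longrightarrow> (U', \<phi>') \<in> atlas M \<Longrightarrow>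
    smooth_on (\<phi> ` (U \<inter> U')) (\<phi>' \<circ> inv_into U \<phi>)"
  unfolding smooth_atlas_def by blast

text \<open>A chart image need not be open in the coordinate space, so an open set \<open>D\<close>
  of the manifold corresponds only to the trace of some open \<open>T\<close>. One \<open>T\<close>
  serves all \<open>S\<close>, which is what localising smoothness to \<open>D\<close>
  needs.\<close>

lemma chart_image_Int_open:
  assumes M: "smooth_atlas M" "(U, \<phi>) \<in> atlas M" and D: "openin (mtop M) D"
  obtains T where "open T" "\<And>S. S \<subseteq> U \<Longrightarrow> \<phi> ` (S \<inter> D) = \<phi> ` S \<inter> T"
proof -
  have "openin (subtopology (mtop M) U) (U \<inter> D)"
    using D by (simp add: openin_subtopology_Int2)
  then have "openin (top_of_set (\<phi> ` U)) (\<phi> ` (U \<inter> D))"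
    using homeomorphic_imp_open_map[OF chart_homeomorphic_map[OF M]] by (simp add: open_map_def)
  then obtain T where T: "open T" "\<phi> ` (U \<inter> D) = \<phi> ` U \<inter> T" by (auto simp: openin_open)
  have "\<phi> ` (S \<inter> D) = \<phi> ` S \<inter> T" if "S \<subseteq> U" for S
    using T(2) that chart_inj_on[OF M] unfolding inj_on_def by blast
  with T(1) show thesis by (rule that)
qed

lemma smooth_mapI:
  assumes "continuous_map (mtop M) (mtop N) f"
    and "\<And>U \<phi> W \<psi>. (U, \<phi>) \<in> atlas M \<Longrightarrow> (W, \<psi>) \<in> atlas N \<Longrightarrow>
      smooth_on (\<phi> ` {x \<in> U. f x \<in> W}) (\<psi> \<circ> f \<circ> inv_into U \<phi>)"
  shows "smooth_map M N f"
  unfolding smooth_map_def by (intro conjI assms(1)) (use assms(2) in auto)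

lemma smooth_mapD:
  assumes "smooth_map M N f" "(U, \<phi>) \<in> atlas M" "(W, \<psi>) \<in> atlas N"
  shows "smooth_on (\<phi> ` {x \<in> U. f x \<in> W}) (\<psi> \<circ> f \<circ> inv_into U \<phi>)"
  using assms unfolding smooth_map_def by blast

lemma smooth_map_continuous: "smooth_map M N f \<Longrightarrow> continuous_map (mtop M) (mtop N) f"
  unfolding smooth_map_def by blast

lemma smooth_map_in: "smooth_map M N f \<Longrightarrow> x \<in> mspace M \<Longrightarrow> f x \<in> mspace N"
  using continuous_map_image_subset_topspace[OF smooth_map_continuous] by blast

lemma smooth_mapD_local:
  assumes f: "smooth_map M N f" and M: "smooth_atlas M" and N: "smooth_atlas N"
    and c: "(U, \<phi>) \<in> atlas M" "(W, \<psi>) \<in> atlas N" and x: "x \<in> U" "f x \<in> W"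
  obtains D where "openin (mtop M) D" "x \<in> D" "D \<subseteq> U" "f ` D \<subseteq> W"
    "smooth_on (\<phi> ` D) (\<psi> \<circ> f \<circ> inv_into U \<phi>)"
proof (rule that[of "{x \<in> U. f x \<in> W}"])
  show "openin (mtop M) {x \<in> U. f x \<in> W}"
    using openin_continuous_map_preimage_gen[OF smooth_map_continuous[OF f]]
      chart_openin[OF M c(1)] chart_openin[OF N c(2)] by blast
qed (use smooth_mapD[OF f c] x in auto)

abbreviation smooth_near ::
  "('a, 'e::euclidean_space) mfd \<Rightarrow> ('b, 'f::euclidean_space) mfd \<Rightarrow> ('a \<Rightarrow> 'b) \<Rightarrow> 'a \<Rightarrow> bool" where
  "smooth_near M N f x \<equiv> \<exists>U \<phi> W \<psi> D. (U, \<phi>) \<in> atlas M \<and> (W, \<psi>) \<in> atlas N \<and>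
     openin (mtop M) D \<and> x \<in> D \<and> D \<subseteq> U \<and> f ` D \<subseteq> W \<and> smooth_on (\<phi> ` D) (\<psi> \<circ> f \<circ> inv_into U \<phi>)"

text \<open>Smoothness in one pair of charts around each point passes to every other pair by
  composing with transition maps on both sides.\<close>

lemma smooth_mapI_local:
  assumes M: "smooth_atlas M" and N: "smooth_atlas N"
    and cont: "continuous_map (mtop M) (mtop N) f"
    and loc: "\<And>x. x \<in> mspace M \<Longrightarrow> smooth_near M N f x"
  shows "smooth_map M N f"
proof -
  have "smooth_on (\<phi>' ` {x \<in> U'. f x \<in> W'}) (\<psi>' \<circ> f \<circ> inv_into U' \<phi>')" (is "smooth_on ?S _")
    if c': "(U', \<phi>') \<in> atlas M" "(W', \<psi>') \<in> atlas N" for U' \<phi>' W' \<psi>'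
  proof (rule smooth_on_local)
    fix y assume "y \<in> ?S"
    then obtain x where x: "x \<in> U'" "f x \<in> W'" "y = \<phi>' x" by auto
    then have "x \<in> mspace M" using chart_subset[OF M c'(1)] by blast
    from loc[OF this] obtain U \<phi> W \<psi> D
      where c: "(U, \<phi>) \<in> atlas M" "(W, \<psi>) \<in> atlas N" and D: "openin (mtop M) D" "x \<in> D" "D \<subseteq> U" "f ` D \<subseteq> W"
        and sm: "smooth_on (\<phi> ` D) (\<psi> \<circ> f \<circ> inv_into U \<phi>)" by blast
    obtain T where T: "open T" "\<And>S. S \<subseteq> U' \<Longrightarrow> \<phi>' ` (S \<inter> D) = \<phi>' ` S \<inter> T"
      using chart_image_Int_open[OF M c'(1) D(1)] by metis
    let ?Q = "{x \<in> U'. f x \<in> W'} \<inter> D"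
    have Q: "?S \<inter> T = \<phi>' ` ?Q" using T(2)[of "{x \<in> U'. f x \<in> W'}"] by auto
    have 1: "smooth_on (\<phi>' ` ?Q) (\<phi> \<circ> inv_into U' \<phi>')"
      by (rule smooth_on_subset[OF chart_transition[OF M c'(1) c(1)]]) (use D in auto)
    have 2: "smooth_on (\<phi>' ` ?Q) ((\<psi> \<circ> f \<circ> inv_into U \<phi>) \<circ> (\<phi> \<circ> inv_into U' \<phi>'))"
      by (rule smooth_on_compose[OF 1 sm]) (use D chart_inv[OF M c'(1)] in auto)
    have 3: "smooth_on (\<phi>' ` ?Q) ((\<psi>' \<circ> inv_into W \<psi>) \<circ> ((\<psi> \<circ> f \<circ> inv_into U \<phi>) \<circ> (\<phi> \<circ> inv_into U' \<phi>')))"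
    proof (rule smooth_on_compose[OF 2 chart_transition[OF N c(2) c'(2)]], clarify)
      fix q assume q: "q \<in> U'" "f q \<in> W'" "q \<in> D"
      then have "q \<in> U" "f q \<in> W" using D by auto
      then have "((\<psi> \<circ> f \<circ> inv_into U \<phi>) \<circ> (\<phi> \<circ> inv_into U' \<phi>')) (\<phi>' q) = \<psi> (f q)"
        using q(1) by (simp add: chart_inv[OF M c'(1)] chart_inv[OF M c(1)])
      then show "((\<psi> \<circ> f \<circ> inv_into U \<phi>) \<circ> (\<phi> \<circ> inv_into U' \<phi>')) (\<phi>' q) \<in> \<psi> ` (W \<inter> W')"
        using \<open>f q \<in> W\<close> q(2) by auto
    qed
    have "smooth_on (\<phi>' ` ?Q) (\<psi>' \<circ> f \<circ> inv_into U' \<phi>')"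
    proof (rule smooth_on_cong[OF 3])
      fix z assume "z \<in> \<phi>' ` ?Q"
      then obtain q where q: "q \<in> U'" "f q \<in> W'" "q \<in> D" "z = \<phi>' q" by auto
      then have "q \<in> U" "f q \<in> W" using D by auto
      then show "((\<psi>' \<circ> inv_into W \<psi>) \<circ> ((\<psi> \<circ> f \<circ> inv_into U \<phi>) \<circ> (\<phi> \<circ> inv_into U' \<phi>'))) z
          = (\<psi>' \<circ> f \<circ> inv_into U' \<phi>') z"
        using q(1) by (simp add: q(4) chart_inv[OF M c'(1)] chart_inv[OF M c(1)] chart_inv[OF N c(2)])
    qed
    then have "smooth_on (?S \<inter> T) (\<psi>' \<circ> f \<circ> inv_into U' \<phi>')" using Q by simp
    moreover have "y \<in> T" using T(2)[of "U'"] x D(2) by auto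
    ultimately show "\<exists>T. open T \<and> y \<in> T \<and> smooth_on (?S \<inter> T) (\<psi>' \<circ> f \<circ> inv_into U' \<phi>')"
      using T(1) by blast
  qed
  then show ?thesis using cont unfolding smooth_map_def by blast
qed

lemma smooth_map_cong:
  assumes M: "smooth_atlas M" and f: "smooth_map M N f" and eq: "\<And>x. x \<in> mspace M \<Longrightarrow> f x = g x"
  shows "smooth_map M N g"
proof (rule smooth_mapI)
  show "continuous_map (mtop M) (mtop N) g"
    using continuous_map_eq[OF smooth_map_continuous[OF f] eq] .
  fix U \<phi> W \<psi> assume c: "(U, \<phi>) \<in> atlas M" "(W, \<psi>) \<in> atlas N"
  have e: "{x \<in> U. g x \<in> W} = {x \<in> U. f x \<in> W}" using chart_subset[OF M c(1)] eq by auto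
  show "smooth_on (\<phi> ` {x \<in> U. g x \<in> W}) (\<psi> \<circ> g \<circ> inv_into U \<phi>)"
    unfolding e
    by (rule smooth_on_cong[OF smooth_mapD[OF f c]])
      (use chart_subset[OF M c(1)] eq in \<open>auto simp: chart_inv[OF M c(1)]\<close>)
qed

lemma smooth_map_id:
  assumes M: "smooth_atlas M"
  shows "smooth_map M M (\<lambda>x. x)"
proof (rule smooth_mapI)
  fix U \<phi> W \<psi> assume c: "(U, \<phi>) \<in> atlas M" "(W, \<psi>) \<in> atlas M"
  show "smooth_on (\<phi> ` {x \<in> U. x \<in> W}) (\<psi> \<circ> (\<lambda>x. x) \<circ> inv_into U \<phi>)"
    by (rule smooth_on_cong[OF smooth_on_subset[OF chart_transition[OF M c]]]) auto
qed simp

lemma smooth_map_const: "c \<in> mspace N \<Longrightarrow> smooth_map M N (\<lambda>x. c)"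
  unfolding smooth_map_def
  by (auto simp: o_def intro: smooth_on_const)

lemma smooth_map_compose:
  assumes M: "smooth_atlas M" and N: "smooth_atlas N" and K: "smooth_atlas K"
    and f: "smooth_map M N f" and g: "smooth_map N K g"
  shows "smooth_map M K (\<lambda>x. g (f x))"
proof (rule smooth_mapI_local[OF M K])
  show "continuous_map (mtop M) (mtop K) (\<lambda>x. g (f x))"
    using continuous_map_compose[OF smooth_map_continuous[OF f] smooth_map_continuous[OF g]]
    by (simp add: o_def)
  fix x assume x: "x \<in> mspace M"
  obtain U \<phi> where U: "(U, \<phi>) \<in> atlas M" "x \<in> U" using chart_at[OF M x] .
  obtain W \<psi> where W: "(W, \<psi>) \<in> atlas N" "f x \<in> W" using chart_at[OF N smooth_map_in[OF f x]] .
  obtain Z \<kappa> where Z: "(Z, \<kappa>) \<in> atlas K" "g (f x) \<in> Z"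
    using chart_at[OF K smooth_map_in[OF g smooth_map_in[OF f x]]] .
  obtain O1 where O1: "openin (mtop M) O1" "x \<in> O1" "O1 \<subseteq> U" "f ` O1 \<subseteq> W"
    "smooth_on (\<phi> ` O1) (\<psi> \<circ> f \<circ> inv_into U \<phi>)"
    using smooth_mapD_local[OF f M N U(1) W(1) U(2) W(2)] .
  obtain O2 where O2: "openin (mtop N) O2" "f x \<in> O2" "O2 \<subseteq> W" "g ` O2 \<subseteq> Z"
    "smooth_on (\<psi> ` O2) (\<kappa> \<circ> g \<circ> inv_into W \<psi>)"
    using smooth_mapD_local[OF g N K W(1) Z(1) W(2) Z(2)] .
  let ?D = "{x \<in> O1. f x \<in> O2}"
  have D: "openin (mtop M) ?D"
    using openin_continuous_map_preimage_gen[OF smooth_map_continuous[OF f] O1(1) O2(1)] .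
  have 1: "smooth_on (\<phi> ` ?D) ((\<kappa> \<circ> g \<circ> inv_into W \<psi>) \<circ> (\<psi> \<circ> f \<circ> inv_into U \<phi>))"
  proof (rule smooth_on_compose[OF smooth_on_subset[OF O1(5)] O2(5)])
    show "(\<psi> \<circ> f \<circ> inv_into U \<phi>) ` \<phi> ` ?D \<subseteq> \<psi> ` O2"
      using O1(3) chart_inv[OF M U(1)] by (auto simp: subset_iff)
  qed auto
  have "smooth_on (\<phi> ` ?D) (\<kappa> \<circ> (\<lambda>x. g (f x)) \<circ> inv_into U \<phi>)"
    by (rule smooth_on_cong[OF 1])
      (use O1(3) O2(3) in \<open>auto simp: chart_inv[OF M U(1)] chart_inv[OF N W(1)] subset_iff\<close>)
  then show "smooth_near M K (\<lambda>x. g (f x)) x"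
    using U(1) Z(1) D O1(2,3) O2(2,4) by (intro exI[of _ U] exI[of _ \<phi>] exI[of _ Z] exI[of _ \<kappa>] exI[of _ ?D]) auto
qed


subsection \<open>Open submanifolds\<close>

lemma mspace_restr [simp]: "mspace (restr_mfd M S) = mspace M \<inter> S"
  and mtop_restr [simp]: "mtop (restr_mfd M S) = subtopology (mtop M) S"
  by (simp_all add: restr_mfd_def)

lemma restr_restr: "restr_mfd (restr_mfd M S) T = restr_mfd M (S \<inter> T)"
  by (auto simp: restr_mfd_def subtopology_subtopology Int_assoc) (metis Int_assoc)

lemma restr_mspace:
  assumes "smooth_atlas M"
  shows "restr_mfd M (mspace M) = M"
proof -
  have "U \<inter> mspace M = U" if "(U, \<phi>) \<in> atlas M" for U \<phi>
    using chart_subset[OF assms that] by blast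
  then have "{(U \<inter> mspace M, \<phi>) |U \<phi>. (U, \<phi>) \<in> atlas M} = atlas M" by fastforce
  then show ?thesis by (simp add: restr_mfd_def)
qed

lemma restr_chartE:
  assumes "(U', \<phi>) \<in> atlas (restr_mfd M S)"
  obtains U where "(U, \<phi>) \<in> atlas M" "U' = U \<inter> S"
  using assms unfolding restr_mfd_def by auto

lemma restr_chartI: "(U, \<phi>) \<in> atlas M \<Longrightarrow> (U \<inter> S, \<phi>) \<in> atlas (restr_mfd M S)"
  unfolding restr_mfd_def by auto

lemma chart_inv_restr:
  assumes "smooth_atlas M" "(U, \<phi>) \<in> atlas M" "x \<in> U \<inter> S"
  shows "inv_into (U \<inter> S) \<phi> (\<phi> x) = x"
  using assms by (intro inv_into_f_f inj_on_subset[OF chart_inj_on]) auto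

lemma smooth_atlas_restr:
  assumes M: "smooth_atlas M" and S: "openin (mtop M) S"
  shows "smooth_atlas (restr_mfd M S)"
proof (rule smooth_atlasI)
  have "(\<Union>(U, \<phi>)\<in>atlas (restr_mfd M S). U) = (\<Union>(U, \<phi>)\<in>atlas M. U) \<inter> S"
    by (auto simp: restr_mfd_def)
  then show "(\<Union>(U, \<phi>)\<in>atlas (restr_mfd M S). U) = mspace (restr_mfd M S)"
    using M by (simp add: smooth_atlas_def)
next
  fix U' \<phi> assume "(U', \<phi>) \<in> atlas (restr_mfd M S)"
  then obtain U where U: "(U, \<phi>) \<in> atlas M" "U' = U \<inter> S" by (rule restr_chartE)
  show "openin (mtop (restr_mfd M S)) U'"
    using U chart_openin[OF M U(1)] by (simp add: openin_subtopology_Int)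
  have "homeomorphic_map (subtopology (subtopology (mtop M) U) S)
      (subtopology (top_of_set (\<phi> ` U)) (\<phi> ` (U \<inter> S))) \<phi>"
    by (rule homeomorphic_map_subtopologies[OF chart_homeomorphic_map[OF M U(1)]])
      (use chart_subset[OF M U(1)] in auto)
  moreover have "\<phi> ` U \<inter> \<phi> ` (U \<inter> S) = \<phi> ` (U \<inter> S)" by auto
  ultimately show "homeomorphic_map (subtopology (mtop (restr_mfd M S)) U') (top_of_set (\<phi> ` U')) \<phi>"
    unfolding U(2) by (simp add: subtopology_subtopology Int_left_commute Int_commute)
next
  fix U' \<phi> W' \<psi> assume "(U', \<phi>) \<in> atlas (restr_mfd M S)" "(W', \<psi>) \<in> atlas (restr_mfd M S)"
  then obtain U W where U: "(U, \<phi>) \<in> atlas M" "U' = U \<inter> S" and W: "(W, \<psi>) \<in> atlas M" "W' = W \<inter> S"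
    by (metis restr_chartE)
  show "smooth_on (\<phi> ` (U' \<inter> W')) (\<psi> \<circ> inv_into U' \<phi>)"
    unfolding U(2) W(2)
    by (rule smooth_on_cong[OF smooth_on_subset[OF chart_transition[OF M U(1) W(1)]]])
      (auto simp: chart_inv[OF M U(1)] chart_inv_restr[OF M U(1)])
qed

lemma smooth_map_restr:
  assumes M: "smooth_atlas M" and f: "smooth_map M N f"
  shows "smooth_map (restr_mfd M S) N f"
proof (rule smooth_mapI)
  show "continuous_map (mtop (restr_mfd M S)) (mtop N) f"
    using smooth_map_continuous[OF f] by (simp add: continuous_map_from_subtopology)
  fix U' \<phi> W \<psi> assume "(U', \<phi>) \<in> atlas (restr_mfd M S)" and W: "(W, \<psi>) \<in> atlas N"
  then obtain U where U: "(U, \<phi>) \<in> atlas M" "U' = U \<inter> S" by (metis restr_chartE)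
  show "smooth_on (\<phi> ` {x \<in> U'. f x \<in> W}) (\<psi> \<circ> f \<circ> inv_into U' \<phi>)"
    unfolding U(2)
    by (rule smooth_on_cong[OF smooth_on_subset[OF smooth_mapD[OF f U(1) W]]])
      (auto simp: chart_inv[OF M U(1)] chart_inv_restr[OF M U(1)])
qed

lemma smooth_map_restr_mono:
  assumes M: "smooth_atlas M" "openin (mtop M) S" and f: "smooth_map (restr_mfd M S) N f" and "T \<subseteq> S"
  shows "smooth_map (restr_mfd M T) N f"
  using smooth_map_restr[OF smooth_atlas_restr[OF M] f, of T] \<open>T \<subseteq> S\<close>
  by (simp add: restr_restr inf.absorb2)

lemma smooth_map_into_restr:
  assumes f: "smooth_map M N f" and S: "\<And>x. x \<in> mspace M \<Longrightarrow> f x \<in> S"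
  shows "smooth_map M (restr_mfd N S) f"
proof (rule smooth_mapI)
  show "continuous_map (mtop M) (mtop (restr_mfd N S)) f"
    using smooth_map_continuous[OF f] S by (auto simp: continuous_map_in_subtopology)
  fix U \<phi> W' \<psi> assume c: "(U, \<phi>) \<in> atlas M" "(W', \<psi>) \<in> atlas (restr_mfd N S)"
  then obtain W where W: "(W, \<psi>) \<in> atlas N" "W' = W \<inter> S" by (metis restr_chartE)
  show "smooth_on (\<phi> ` {x \<in> U. f x \<in> W'}) (\<psi> \<circ> f \<circ> inv_into U \<phi>)"
    by (rule smooth_on_subset[OF smooth_mapD[OF f c(1) W(1)]]) (use W(2) in auto)
qed

lemma smooth_map_compose_restr:
  assumes M: "smooth_atlas M" and N: "smooth_atlas N" and K: "smooth_atlas K"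
    and f: "smooth_map M N f" and g: "smooth_map (restr_mfd N S) K g" and S: "openin (mtop N) S"
    and "\<And>x. x \<in> mspace M \<Longrightarrow> f x \<in> S"
  shows "smooth_map M K (\<lambda>x. g (f x))"
  using smooth_map_compose[OF M smooth_atlas_restr[OF N S] K smooth_map_into_restr[OF f] g] assms(7) by blast

lemma smooth_map_from_restr_codomain:
  assumes M: "smooth_atlas M" and N: "smooth_atlas N" and S: "openin (mtop N) S"
    and f: "smooth_map M (restr_mfd N S) f"
  shows "smooth_map M N f"
  using smooth_map_compose[OF M smooth_atlas_restr[OF N S] N f smooth_map_restr[OF N smooth_map_id[OF N]]] .

text \<open>The sheaf property. Maps into and out of total spaces, and locally finite sums, are
  shown to be smooth by checking them on trivialising or finiteness neighbourhoods.\<close>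

lemma smooth_map_local:
  assumes M: "smooth_atlas M" and N: "smooth_atlas N"
    and loc: "\<And>x. x \<in> mspace M \<Longrightarrow> \<exists>D. openin (mtop M) D \<and> x \<in> D \<and> smooth_map (restr_mfd M D) N f"
  shows "smooth_map M N f"
proof (rule smooth_mapI_local[OF M N])
  show "continuous_map (mtop M) (mtop N) f"
  proof (rule pasting_lemma[where I="{D. openin (mtop M) D \<and> smooth_map (restr_mfd M D) N f}" and T="\<lambda>D. D" and f="\<lambda>_. f"])
    show "continuous_map (subtopology (mtop M) D) (mtop N) f"
      if "D \<in> {D. openin (mtop M) D \<and> smooth_map (restr_mfd M D) N f}" for D
      using that smooth_map_continuous[of "restr_mfd M D" N f] by simp
  qed (use loc in auto)
  fix x assume x: "x \<in> mspace M"
  from loc[OF this] obtain D where D: "openin (mtop M) D" "x \<in> D" and f: "smooth_map (restr_mfd M D) N f" by blast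
  have xO: "x \<in> mspace (restr_mfd M D)" using x D(2) by simp
  obtain U \<phi> where U: "(U, \<phi>) \<in> atlas M" "x \<in> U" using chart_at[OF M x] .
  obtain W \<psi> where W: "(W, \<psi>) \<in> atlas N" "f x \<in> W" using chart_at[OF N smooth_map_in[OF f xO]] .
  have U': "(U \<inter> D, \<phi>) \<in> atlas (restr_mfd M D)" using U(1) by (auto simp: restr_mfd_def)
  obtain Q where Q: "openin (mtop (restr_mfd M D)) Q" "x \<in> Q" "Q \<subseteq> U \<inter> D" "f ` Q \<subseteq> W"
    "smooth_on (\<phi> ` Q) (\<psi> \<circ> f \<circ> inv_into (U \<inter> D) \<phi>)"
    using smooth_mapD_local[OF f smooth_atlas_restr[OF M D(1)] N U' W(1)] U(2) D(2) W(2) by blast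
  have "openin (mtop M) Q" using Q(1) D(1) openin_trans_full by fastforce
  moreover have "smooth_on (\<phi> ` Q) (\<psi> \<circ> f \<circ> inv_into U \<phi>)"
    by (rule smooth_on_cong[OF Q(5)])
      (use Q(3) in \<open>auto simp: chart_inv[OF M U(1)] chart_inv_restr[OF M U(1)] subset_iff\<close>)
  ultimately show "smooth_near M N f x"
    using U(1) W(1) Q by (intro exI[of _ U] exI[of _ \<phi>] exI[of _ W] exI[of _ \<psi>] exI[of _ Q]) auto
qed


subsection \<open>Products\<close>

lemma mspace_prod [simp]: "mspace (prod_mfd M N) = mspace M \<times> mspace N"
  and mtop_prod [simp]: "mtop (prod_mfd M N) = prod_topology (mtop M) (mtop N)"
  by (simp_all add: prod_mfd_def)

lemma prod_chartE:
  assumes "(A, \<kappa>) \<in> atlas (prod_mfd M N)"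
  obtains U \<phi> W \<psi> where "(U, \<phi>) \<in> atlas M" "(W, \<psi>) \<in> atlas N" "A = U \<times> W" "\<kappa> = map_prod \<phi> \<psi>"
  using assms unfolding prod_mfd_def by auto

lemma prod_chartI:
  "(U, \<phi>) \<in> atlas M \<Longrightarrow> (W, \<psi>) \<in> atlas N \<Longrightarrow> (U \<times> W, map_prod \<phi> \<psi>) \<in> atlas (prod_mfd M N)"
  unfolding prod_mfd_def by auto

lemma inv_into_map_prod:
  assumes "inj_on \<phi> U" "inj_on \<psi> W" "a \<in> \<phi> ` U" "b \<in> \<psi> ` W"
  shows "inv_into (U \<times> W) (map_prod \<phi> \<psi>) (a, b) = (inv_into U \<phi> a, inv_into W \<psi> b)"
proof -
  have "map_prod \<phi> \<psi> (inv_into U \<phi> a, inv_into W \<psi> b) = (a, b)"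
    using assms(3,4) by (simp add: f_inv_into_f)
  moreover have "inj_on (map_prod \<phi> \<psi>) (U \<times> W)" using assms(1,2) by (rule map_prod_inj_on)
  ultimately show ?thesis
    using assms(3,4) inv_into_f_eq[of "map_prod \<phi> \<psi>" "U \<times> W" "(inv_into U \<phi> a, inv_into W \<psi> b)" "(a, b)"]
    by (simp add: inv_into_into)
qed

lemma smooth_on_map_prod:
  assumes "smooth_on S f" "smooth_on T g"
  shows "smooth_on (S \<times> T) (map_prod f g)"
proof -
  have 1: "smooth_on (S \<times> T) (f \<circ> fst)" "smooth_on (S \<times> T) (g \<circ> snd)"
    by (rule smooth_on_compose[OF smooth_on_bounded_linear[OF bounded_linear_fst] assms(1)]
        smooth_on_compose[OF smooth_on_bounded_linear[OF bounded_linear_snd] assms(2)]; auto)+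
  show ?thesis by (rule smooth_on_cong[OF smooth_on_Pair[OF 1]]) auto
qed

lemma smooth_atlas_prod:
  assumes M: "smooth_atlas M" and N: "smooth_atlas N"
  shows "smooth_atlas (prod_mfd M N)"
proof (rule smooth_atlasI)
  have "(\<Union>(A, \<kappa>)\<in>atlas (prod_mfd M N). A) = (\<Union>(U, \<phi>)\<in>atlas M. U) \<times> (\<Union>(W, \<psi>)\<in>atlas N. W)"
    unfolding prod_mfd_def by auto blast
  then show "(\<Union>(A, \<kappa>)\<in>atlas (prod_mfd M N). A) = mspace (prod_mfd M N)"
    using M N by (simp add: smooth_atlas_def)
next
  fix A \<kappa> assume "(A, \<kappa>) \<in> atlas (prod_mfd M N)"
  then obtain U \<phi> W \<psi> where c: "(U, \<phi>) \<in> atlas M" "(W, \<psi>) \<in> atlas N" and A: "A = U \<times> W" "\<kappa> = map_prod \<phi> \<psi>"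
    by (rule prod_chartE)
  show "openin (mtop (prod_mfd M N)) A"
    using chart_openin[OF M c(1)] chart_openin[OF N c(2)] by (simp add: A openin_prod_Times_iff)
  obtain f' g' where h: "homeomorphic_maps (subtopology (mtop M) U) (top_of_set (\<phi> ` U)) \<phi> f'"
    "homeomorphic_maps (subtopology (mtop N) W) (top_of_set (\<psi> ` W)) \<psi> g'"
    using chart_homeomorphic_map[OF M c(1)] chart_homeomorphic_map[OF N c(2)] by (auto simp: homeomorphic_map_maps)
  have e: "(\<lambda>(x,y). (\<phi> x, \<psi> y)) ` (U \<times> W) = \<phi> ` U \<times> \<psi> ` W" by auto
  have "homeomorphic_maps (prod_topology (subtopology (mtop M) U) (subtopology (mtop N) W))
      (prod_topology (top_of_set (\<phi> ` U)) (top_of_set (\<psi> ` W))) (\<lambda>(x,y). (\<phi> x, \<psi> y)) (\<lambda>(x,y). (f' x, g' y))"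
    using h unfolding homeomorphic_maps_prod by blast
  then show "homeomorphic_map (subtopology (mtop (prod_mfd M N)) A) (top_of_set (\<kappa> ` A)) \<kappa>"
    unfolding homeomorphic_map_maps A mtop_prod subtopology_Times map_prod_def e
      prod_topology_subtopology_eu by blast
next
  fix A \<kappa> A' \<kappa>' assume a: "(A, \<kappa>) \<in> atlas (prod_mfd M N)" "(A', \<kappa>') \<in> atlas (prod_mfd M N)"
  from a(1) obtain U \<phi> W \<psi> where c: "(U, \<phi>) \<in> atlas M" "(W, \<psi>) \<in> atlas N" and A: "A = U \<times> W" "\<kappa> = map_prod \<phi> \<psi>"
    by (rule prod_chartE)
  from a(2) obtain U' \<phi>' W' \<psi>' where c': "(U', \<phi>') \<in> atlas M" "(W', \<psi>') \<in> atlas N"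
    and A': "A' = U' \<times> W'" "\<kappa>' = map_prod \<phi>' \<psi>'"
    by (rule prod_chartE)
  have e: "\<kappa> ` (A \<inter> A') = \<phi> ` (U \<inter> U') \<times> \<psi> ` (W \<inter> W')"
    by (simp add: A A' Times_Int_Times map_prod_surj_on[OF refl refl])
  have "smooth_on (\<kappa> ` (A \<inter> A')) (map_prod (\<phi>' \<circ> inv_into U \<phi>) (\<psi>' \<circ> inv_into W \<psi>))"
    unfolding e by (rule smooth_on_map_prod[OF chart_transition[OF M c(1) c'(1)] chart_transition[OF N c(2) c'(2)]])
  then show "smooth_on (\<kappa> ` (A \<inter> A')) (\<kappa>' \<circ> inv_into A \<kappa>)"
    by (rule smooth_on_cong)
      (auto simp: A A' inv_into_map_prod[OF chart_inj_on[OF M c(1)] chart_inj_on[OF N c(2)]])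
qed

lemma smooth_map_Pair:
  assumes f: "smooth_map K M f" and g: "smooth_map K N g"
  shows "smooth_map K (prod_mfd M N) (\<lambda>x. (f x, g x))"
proof (rule smooth_mapI)
  show "continuous_map (mtop K) (mtop (prod_mfd M N)) (\<lambda>x. (f x, g x))"
    using f g by (simp add: continuous_map_paired smooth_map_continuous)
  fix Z \<zeta> A \<kappa> assume Z: "(Z, \<zeta>) \<in> atlas K" and "(A, \<kappa>) \<in> atlas (prod_mfd M N)"
  then obtain U \<phi> W \<psi> where c: "(U, \<phi>) \<in> atlas M" "(W, \<psi>) \<in> atlas N" and A: "A = U \<times> W" "\<kappa> = map_prod \<phi> \<psi>"
    by (metis prod_chartE)
  let ?S = "\<zeta> ` {x \<in> Z. (f x, g x) \<in> A}"
  have "smooth_on ?S (\<lambda>z. ((\<phi> \<circ> f \<circ> inv_into Z \<zeta>) z, (\<psi> \<circ> g \<circ> inv_into Z \<zeta>) z))"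
    by (rule smooth_on_Pair; rule smooth_on_subset[OF smooth_mapD]) (use f g Z c A in auto)
  then show "smooth_on ?S (\<kappa> \<circ> (\<lambda>x. (f x, g x)) \<circ> inv_into Z \<zeta>)"
    by (rule smooth_on_cong) (simp add: A)
qed

lemma smooth_map_fst:
  assumes M: "smooth_atlas M" and N: "smooth_atlas N"
  shows "smooth_map (prod_mfd M N) M fst"
proof (rule smooth_mapI)
  show "continuous_map (mtop (prod_mfd M N)) (mtop M) fst" by (simp add: continuous_map_fst)
  fix A \<kappa> Z \<zeta> assume "(A, \<kappa>) \<in> atlas (prod_mfd M N)" and Z: "(Z, \<zeta>) \<in> atlas M"
  then obtain U \<phi> W \<psi> where c: "(U, \<phi>) \<in> atlas M" "(W, \<psi>) \<in> atlas N" and A: "A = U \<times> W" "\<kappa> = map_prod \<phi> \<psi>"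
    by (metis prod_chartE)
  have "smooth_on (\<kappa> ` {z \<in> A. fst z \<in> Z}) ((\<zeta> \<circ> inv_into U \<phi>) \<circ> fst)"
    by (rule smooth_on_compose[OF smooth_on_bounded_linear[OF bounded_linear_fst] chart_transition[OF M c(1) Z]])
      (auto simp: A)
  then show "smooth_on (\<kappa> ` {z \<in> A. fst z \<in> Z}) (\<zeta> \<circ> fst \<circ> inv_into A \<kappa>)"
    by (rule smooth_on_cong)
      (auto simp: A inv_into_map_prod[OF chart_inj_on[OF M c(1)] chart_inj_on[OF N c(2)]])
qed

lemma smooth_map_snd:
  assumes M: "smooth_atlas M" and N: "smooth_atlas N"
  shows "smooth_map (prod_mfd M N) N snd"
proof (rule smooth_mapI)
  show "continuous_map (mtop (prod_mfd M N)) (mtop N) snd" by (simp add: continuous_map_snd)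
  fix A \<kappa> Z \<zeta> assume "(A, \<kappa>) \<in> atlas (prod_mfd M N)" and Z: "(Z, \<zeta>) \<in> atlas N"
  then obtain U \<phi> W \<psi> where c: "(U, \<phi>) \<in> atlas M" "(W, \<psi>) \<in> atlas N" and A: "A = U \<times> W" "\<kappa> = map_prod \<phi> \<psi>"
    by (metis prod_chartE)
  have "smooth_on (\<kappa> ` {z \<in> A. snd z \<in> Z}) ((\<zeta> \<circ> inv_into W \<psi>) \<circ> snd)"
    by (rule smooth_on_compose[OF smooth_on_bounded_linear[OF bounded_linear_snd] chart_transition[OF N c(2) Z]])
      (auto simp: A)
  then show "smooth_on (\<kappa> ` {z \<in> A. snd z \<in> Z}) (\<zeta> \<circ> snd \<circ> inv_into A \<kappa>)"
    by (rule smooth_on_cong)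
      (auto simp: A inv_into_map_prod[OF chart_inj_on[OF M c(1)] chart_inj_on[OF N c(2)]])
qed

text \<open>An equality of structures, not merely a diffeomorphism:
  \<open>local_trivialisation\<close> is phrased with products of restrictions, while domains of
  maps appear as open subsets of products.\<close>

lemma prod_restr: "prod_mfd (restr_mfd M S) (restr_mfd N T) = restr_mfd (prod_mfd M N) (S \<times> T)"
proof -
  have "atlas (prod_mfd (restr_mfd M S) (restr_mfd N T)) = atlas (restr_mfd (prod_mfd M N) (S \<times> T))"
  proof (rule subset_antisym; rule subsetI)
    fix C assume "C \<in> atlas (prod_mfd (restr_mfd M S) (restr_mfd N T))"
    then obtain A \<kappa> U \<phi> W \<psi> where "(U, \<phi>) \<in> atlas M" "(W, \<psi>) \<in> atlas N" "A = (U \<inter> S) \<times> (W \<inter> T)" "\<kappa> = map_prod \<phi> \<psi>"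
        "C = (A, \<kappa>)"
      by (metis prod_chartE restr_chartE surj_pair)
    then show "C \<in> atlas (restr_mfd (prod_mfd M N) (S \<times> T))"
      using prod_chartI[of U \<phi> M W \<psi> N] by (auto simp: restr_mfd_def Times_Int_Times[symmetric])
  next
    fix C assume "C \<in> atlas (restr_mfd (prod_mfd M N) (S \<times> T))"
    then obtain A \<kappa> U \<phi> W \<psi> where "(U, \<phi>) \<in> atlas M" "(W, \<psi>) \<in> atlas N"
      "A = (U \<times> W) \<inter> (S \<times> T)" "\<kappa> = map_prod \<phi> \<psi>" "C = (A, \<kappa>)"
      by (metis prod_chartE restr_chartE surj_pair)
    then show "C \<in> atlas (prod_mfd (restr_mfd M S) (restr_mfd N T))"
      using prod_chartI[of "U \<inter> S" \<phi> "restr_mfd M S" "W \<inter> T" \<psi> "restr_mfd N T"]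
      by (auto simp: restr_mfd_def Times_Int_Times)
  qed
  moreover have "mtop (prod_mfd (restr_mfd M S) (restr_mfd N T)) = mtop (restr_mfd (prod_mfd M N) (S \<times> T))"
    by (simp add: subtopology_Times)
  ultimately show ?thesis by (intro mfd.equality) simp_all
qed

lemma prod_restr_left:
  "smooth_atlas N \<Longrightarrow> prod_mfd (restr_mfd M S) N = restr_mfd (prod_mfd M N) (S \<times> mspace N)"
  using prod_restr[of M S N "mspace N"] by (simp add: restr_mspace)


subsection \<open>Real-valued functions\<close>

lemma mspace_real [simp]: "mspace real_mfd = UNIV"
  and mtop_real [simp]: "mtop real_mfd = euclidean"
  and atlas_real [simp]: "atlas real_mfd = {(UNIV, id)}"
  by (simp_all add: real_mfd_def)

lemma smooth_atlas_real: "smooth_atlas real_mfd"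
  unfolding smooth_atlas_def
  by (auto simp: homeomorphic_map_id intro: smooth_on_cong[OF smooth_on_bounded_linear[OF bounded_linear_ident]])

text \<open>The real line has a single chart with domain \<open>UNIV\<close>, so the coordinate
  expressions cover all of each \<open>U\<close>, and continuity, a separate clause of
  \<open>smooth_map\<close>, follows from them.\<close>

lemma smooth_map_realI:
  assumes M: "smooth_atlas M"
    and f: "\<And>U \<phi>. (U, \<phi>) \<in> atlas M \<Longrightarrow> smooth_on (\<phi> ` U) (f \<circ> inv_into U \<phi>)"
  shows "smooth_map M real_mfd f"
proof -
  have "continuous_map (mtop M) euclidean f"
  proof (rule pasting_lemma[where I="fst ` atlas M" and T="\<lambda>U. U" and f="\<lambda>_. f"])
    fix U assume "U \<in> fst ` atlas M"
    then obtain \<phi> where U: "(U, \<phi>) \<in> atlas M" by auto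
    then show "openin (mtop M) U" using chart_openin[OF M] by blast
    have "continuous_on (\<phi> ` U) (f \<circ> inv_into U \<phi>)"
      unfolding continuous_on_eq_continuous_within
    proof
      fix y assume y: "y \<in> \<phi> ` U"
      from smooth_onE[OF f[OF U] y] obtain T g where T: "open T" "y \<in> T" "\<forall>k. Ck_on k T g"
        "\<forall>z\<in>\<phi> ` U \<inter> T. (f \<circ> inv_into U \<phi>) z = g z" .
      have "continuous_on T g" using T(3)[rule_format, of 0] by simp
      then have "continuous_on (\<phi> ` U \<inter> T) (f \<circ> inv_into U \<phi>)"
        using T(4) by (subst continuous_on_cong[OF refl, of _ _ g]) (auto intro: continuous_on_subset)
      then have "continuous (at y within \<phi> ` U \<inter> T) (f \<circ> inv_into U \<phi>)"
        using y T(2) unfolding continuous_on_eq_continuous_within by blast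
      then show "continuous (at y within \<phi> ` U) (f \<circ> inv_into U \<phi>)"
        using at_within_nhd[OF T(2,1), of "\<phi> ` U" "\<phi> ` U \<inter> T"] by (simp add: continuous_within Int_assoc)
    qed
    then have "continuous_map (top_of_set (\<phi> ` U)) euclidean (f \<circ> inv_into U \<phi>)" by simp
    from continuous_map_compose[OF homeomorphic_imp_continuous_map[OF chart_homeomorphic_map[OF M U]] this]
    show "continuous_map (subtopology (mtop M) U) euclidean f"
      by (rule continuous_map_eq) (auto simp: chart_inv[OF M U])
  next
    show "\<exists>U. U \<in> fst ` atlas M \<and> x \<in> U \<and> f x = f x" if "x \<in> mspace M" for x
      using chart_at[OF M that] by (metis fst_conv image_eqI)
  qed auto
  then show ?thesis using f unfolding smooth_map_def by (auto simp: o_assoc[symmetric])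
qed

lemma smooth_map_realD:
  "smooth_map M real_mfd f \<Longrightarrow> (U, \<phi>) \<in> atlas M \<Longrightarrow> smooth_on (\<phi> ` U) (f \<circ> inv_into U \<phi>)"
  using smooth_mapD[of M real_mfd f U \<phi> UNIV id] by simp

lemma smooth_map_real_compose:
  fixes h :: "real \<Rightarrow> real"
  assumes M: "smooth_atlas M" and f: "smooth_map M real_mfd f" and h: "\<And>k. Ck_on k T h"
    and T: "open T" "\<And>x. x \<in> mspace M \<Longrightarrow> f x \<in> T"
  shows "smooth_map M real_mfd (\<lambda>x. h (f x))"
proof (rule smooth_map_realI[OF M])
  fix U \<phi> assume U: "(U, \<phi>) \<in> atlas M"
  have "smooth_on (\<phi> ` U) (h \<circ> (f \<circ> inv_into U \<phi>))"
  proof (rule smooth_on_compose[OF smooth_map_realD[OF f U]])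
    show "smooth_on T h" using h T(1) by (simp add: smooth_on_open)
    show "(f \<circ> inv_into U \<phi>) ` \<phi> ` U \<subseteq> T"
      using T(2) chart_subset[OF M U] by (auto simp: chart_inv[OF M U])
  qed
  then show "smooth_on (\<phi> ` U) ((\<lambda>x. h (f x)) \<circ> inv_into U \<phi>)" by (simp add: o_def)
qed

lemma smooth_map_real_binop:
  fixes B :: "real \<times> real \<Rightarrow> real"
  assumes M: "smooth_atlas M" and f: "smooth_map M real_mfd f" and g: "smooth_map M real_mfd g"
    and B: "\<And>k. Ck_on k UNIV B"
  shows "smooth_map M real_mfd (\<lambda>x. B (f x, g x))"
proof (rule smooth_map_realI[OF M])
  fix U \<phi> assume U: "(U, \<phi>) \<in> atlas M"
  have "smooth_on (\<phi> ` U) (B \<circ> (\<lambda>z. ((f \<circ> inv_into U \<phi>) z, (g \<circ> inv_into U \<phi>) z)))"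
    by (rule smooth_on_compose[OF smooth_on_Pair[OF smooth_map_realD[OF f U] smooth_map_realD[OF g U]], of UNIV])
      (use B in \<open>auto simp: smooth_on_open\<close>)
  then show "smooth_on (\<phi> ` U) ((\<lambda>x. B (f x, g x)) \<circ> inv_into U \<phi>)" by (simp add: o_def)
qed

lemma smooth_map_real_add:
  assumes "smooth_atlas M" "smooth_map M real_mfd f" "smooth_map M real_mfd g"
  shows "smooth_map M real_mfd (\<lambda>x. f x + g x)"
  using smooth_map_real_binop[OF assms, of "\<lambda>z. fst z + snd z"]
  by (simp add: Ck_on_add Ck_on_bounded_linear bounded_linear_fst bounded_linear_snd)

lemma smooth_map_real_mult:
  assumes "smooth_atlas M" "smooth_map M real_mfd f" "smooth_map M real_mfd g"
  shows "smooth_map M real_mfd (\<lambda>x. f x * g x)"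
  using smooth_map_real_binop[OF assms, of "\<lambda>z. fst z * snd z"]
  by (simp add: Ck_on_bilinear[OF _ bounded_bilinear_mult] Ck_on_bounded_linear bounded_linear_fst bounded_linear_snd)

lemma smooth_map_real_divide:
  assumes M: "smooth_atlas M" and "smooth_map M real_mfd f" "smooth_map M real_mfd g"
    and "\<And>x. x \<in> mspace M \<Longrightarrow> g x \<noteq> 0"
  shows "smooth_map M real_mfd (\<lambda>x. f x / g x)"
proof -
  have "smooth_map M real_mfd (\<lambda>x. inverse (g x))"
    by (rule smooth_map_real_compose[OF M assms(3) Ck_on_inverse_real]) (use assms(4) in auto)
  from smooth_map_real_mult[OF M assms(2) this] show ?thesis by (simp add: divide_inverse)
qed

lemma smooth_map_real_sum:
  assumes M: "smooth_atlas M" and "\<And>i. i \<in> I \<Longrightarrow> smooth_map M real_mfd (f i)"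
  shows "smooth_map M real_mfd (\<lambda>x. \<Sum>i\<in>I. f i x)"
  using assms(2)
  by (induction I rule: infinite_finite_induct) (auto intro: smooth_map_real_add[OF M] smooth_map_const)

abbreviation locally_finite_near :: "'a topology \<Rightarrow> 'i set \<Rightarrow> ('i \<Rightarrow> 'a \<Rightarrow> real) \<Rightarrow> 'a \<Rightarrow> bool" where
  "locally_finite_near X I f x \<equiv> \<exists>D F. openin X D \<and> x \<in> D \<and> finite F \<and> F \<subseteq> I \<and>
     (\<forall>y\<in>D. \<forall>i\<in>I - F. f i y = 0)"

text \<open>The index set of the sum changes with the point; on a neighbourhood it can be replaced
  by the fixed finite \<open>F\<close>, since the added terms are 0.\<close>

lemma smooth_map_real_sum_locally_finite:
  assumes M: "smooth_atlas M" and f: "\<And>i. i \<in> I \<Longrightarrow> smooth_map M real_mfd (f i)"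
    and lf: "\<And>x. x \<in> mspace M \<Longrightarrow> locally_finite_near (mtop M) I f x"
  shows "smooth_map M real_mfd (\<lambda>x. \<Sum>i\<in>{i\<in>I. f i x \<noteq> 0}. f i x)"
proof (rule smooth_map_local[OF M smooth_atlas_real])
  fix x assume "x \<in> mspace M"
  from lf[OF this] obtain D F where D: "openin (mtop M) D" "x \<in> D" "finite F" "F \<subseteq> I"
    "\<forall>y\<in>D. \<forall>i\<in>I - F. f i y = 0" by blast
  have "smooth_map (restr_mfd M D) real_mfd (\<lambda>x. \<Sum>i\<in>{i\<in>I. f i x \<noteq> 0}. f i x)"
  proof (rule smooth_map_cong[OF smooth_atlas_restr[OF M D(1)]])
    show "smooth_map (restr_mfd M D) real_mfd (\<lambda>x. \<Sum>i\<in>F. f i x)"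
      using D(4) f by (intro smooth_map_restr[OF M] smooth_map_real_sum[OF M]) auto
    show "(\<Sum>i\<in>F. f i y) = (\<Sum>i\<in>{i\<in>I. f i y \<noteq> 0}. f i y)" if "y \<in> mspace (restr_mfd M D)" for y
      using that D by (intro sum.mono_neutral_right) auto
  qed
  then show "\<exists>D. openin (mtop M) D \<and> x \<in> D \<and> smooth_map (restr_mfd M D) real_mfd (\<lambda>x. \<Sum>i\<in>{i\<in>I. f i x \<noteq> 0}. f i x)"
    using D by blast
qed

lemma smooth_map_flat: "smooth_atlas M \<Longrightarrow> smooth_map M real_mfd f \<Longrightarrow> smooth_map M real_mfd (\<lambda>x. flat (f x))"
  by (rule smooth_map_real_compose[OF _ _ Ck_on_flat]) auto


section \<open>Integrals depending smoothly on a parameter\<close>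

lemma Ck_on_imp_continuous_on: "Ck_on k U f \<Longrightarrow> continuous_on U f"
proof (induction k)
  case (Suc k)
  then show ?case using Ck_on_SucD by blast
qed simp

text \<open>Differentiation under the integral sign: the derivative in direction \<open>v\<close> is
  again such an integral, its integrand being the derivative of \<open>F\<close> in direction
  \<open>(0, v)\<close>, so induction on \<open>k\<close> applies.\<close>

lemma Ck_on_integral_param:
  fixes F :: "real \<times> 'a::euclidean_space \<Rightarrow> 'b::euclidean_space"
  assumes \<Omega>: "open \<Omega>" and "Ck_on k (UNIV \<times> \<Omega>) F"
  shows "Ck_on k \<Omega> (\<lambda>a. integral {0..1} (\<lambda>t. F (t, a)))"
  using assms(2)
proof (induction k arbitrary: F)
  case 0
  have "continuous_on (\<Omega> \<times> cbox 0 1) (\<lambda>(a, t). F (t, a))"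
    unfolding case_prod_unfold
    by (rule continuous_on_compose2[of "UNIV \<times> \<Omega>" F]) (use 0 in \<open>auto intro!: continuous_intros\<close>)
  from integral_continuous_on_param[OF this] show ?case by simp
next
  case (Suc k)
  let ?F' = "\<lambda>z. frechet_derivative F (at z)"
  have F': "(F has_derivative ?F' (t, a)) (at (t, a))" if "a \<in> \<Omega>" for t a
    by (rule Ck_on_has_derivative[OF Suc.prems]) (use that in auto)
  have bl: "bounded_linear (\<lambda>v. ?F' (t, a) (0, v))" if "a \<in> \<Omega>" for t a
    by (rule bounded_linear_compose[OF has_derivative_bounded_linear[OF F'[OF that]]])
      (intro bounded_linear_Pair bounded_linear_zero bounded_linear_ident)
  have cF': "continuous_on (UNIV \<times> \<Omega>) (\<lambda>z. ?F' z (0, v))" for v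
    by (rule Ck_on_imp_continuous_on) (use Suc.prems in auto)
  show ?case
  proof (rule Ck_on_SucI[OF \<Omega>])
    fix a assume a: "a \<in> \<Omega>"
    then obtain r where r: "r > 0" "ball a r \<subseteq> \<Omega>" using \<Omega> openE by blast
    let ?B = "ball a r"
    \<comment> \<open>\<open>leibniz_rule\<close> asks for continuity in the operator norm, hence
      the packaging as bounded linear maps; in finite dimension it suffices to check continuity on
      basis vectors.\<close>
    define D where "D = (\<lambda>x t. Blinfun (\<lambda>v. ?F' (t, x) (0, v)))"
    have D: "blinfun_apply (D x t) v = ?F' (t, x) (0, v)" if "x \<in> \<Omega>" for x t v
      unfolding D_def using bounded_linear_Blinfun_apply[OF bl[OF that]] by simp
    have cD: "continuous_on (\<Omega> \<times> cbox 0 1) (\<lambda>(x, t). D x t)"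
    proof (rule continuous_on_blinfun_componentwise)
      fix i :: 'a
      have "continuous_on (\<Omega> \<times> cbox 0 1) (\<lambda>z. ?F' (snd z, fst z) (0, i))"
        by (rule continuous_on_compose2[OF cF', of _ "\<lambda>z. (snd z, fst z)"]) (auto intro!: continuous_intros)
      then show "continuous_on (\<Omega> \<times> cbox 0 1) (\<lambda>z. blinfun_apply (case z of (x, t) \<Rightarrow> D x t) i)"
        by (rule continuous_on_eq) (auto simp: D)
    qed
    have "((\<lambda>x. integral (cbox 0 1) (\<lambda>t. F (t, x))) has_derivative integral (cbox 0 1) (D a)) (at a within ?B)"
    proof (rule leibniz_rule)
      fix x t assume x: "x \<in> ?B" and "t \<in> cbox (0::real) 1"
      have "((\<lambda>x. (t, x)) has_derivative (\<lambda>v. (0, v))) (at x)"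
        by (intro has_derivative_Pair has_derivative_const has_derivative_ident)
      moreover have "x \<in> \<Omega>" using x r(2) by blast
      ultimately have "(F \<circ> Pair t has_derivative ?F' (t, x) \<circ> (\<lambda>v. (0, v))) (at x)"
        using diff_chain_at F' by blast
      moreover have "blinfun_apply (D x t) = ?F' (t, x) \<circ> (\<lambda>v. (0, v))"
        using D[OF \<open>x \<in> \<Omega>\<close>] by (simp add: fun_eq_iff)
      ultimately show "((\<lambda>x. F (t, x)) has_derivative blinfun_apply (D x t)) (at x within ?B)"
        by (simp add: o_def has_derivative_at_withinI)
    next
      fix x assume x: "x \<in> ?B"
      have "continuous_on (cbox 0 1) (\<lambda>t. F (t, x))"
        by (rule continuous_on_compose2[OF Ck_on_imp_continuous_on[OF Suc.prems], of _ "\<lambda>t. (t, x)"])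
          (use x r(2) in \<open>auto intro!: continuous_intros\<close>)
      then show "(\<lambda>t. F (t, x)) integrable_on cbox 0 1" by (rule integrable_continuous)
    qed (use r cD in \<open>auto intro: continuous_on_subset\<close>)
    then have d: "((\<lambda>x. integral {0..1} (\<lambda>t. F (t, x))) has_derivative integral (cbox 0 1) (D a)) (at a)"
      using r(1) at_within_open[of a ?B] by simp
    have "continuous_on (cbox 0 1) (D a)"
    proof -
      have "continuous_on (cbox 0 1) ((\<lambda>(x, t). D x t) \<circ> Pair a)"
        by (rule continuous_on_compose[OF _ continuous_on_subset[OF cD]])
          (use a in \<open>auto intro!: continuous_on_Pair\<close>)
      then show ?thesis by (simp add: o_def)
    qed
    from blinfun_apply_integral[OF integrable_continuous[OF this]]
    have "blinfun_apply (integral (cbox 0 1) (D a)) = (\<lambda>v. integral {0..1} (\<lambda>t. ?F' (t, a) (0, v)))"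
      using a by (simp add: D fun_eq_iff)
    with d show "((\<lambda>x. integral {0..1} (\<lambda>t. F (t, x))) has_derivative
        (\<lambda>v. integral {0..1} (\<lambda>t. ?F' (t, a) (0, v)))) (at a)" by simp
  next
    show "Ck_on k \<Omega> (\<lambda>a. integral {0..1} (\<lambda>t. ?F' (t, a) (0, v)))" for v
      using Suc.IH[of "\<lambda>z. ?F' z (0, v)"] Suc.prems by simp
  qed
qed

section \<open>Time derivatives of paths and their energy\<close>

lemma smooth_map_real_real: "smooth_map real_mfd real_mfd f \<Longrightarrow> Ck_on k UNIV f"
  using smooth_map_realD[of real_mfd f UNIV id] by (simp add: smooth_on_open)

lemma smooth_map_real_real_deriv:
  assumes "smooth_map real_mfd real_mfd f"
  shows "(f has_real_derivative deriv f t) (at t)" "continuous_on UNIV (deriv f)"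
    "frechet_derivative f (at t) 1 = deriv f t"
proof -
  have C: "Ck_on (Suc 0) UNIV f" by (rule smooth_map_real_real[OF assms])
  have d: "(f has_real_derivative frechet_derivative f (at t) 1) (at t)" for t
  proof -
    have "(f has_derivative frechet_derivative f (at t)) (at t)" using Ck_on_has_derivative[OF C] by simp
    moreover have "frechet_derivative f (at t) = (*) (frechet_derivative f (at t) 1)"
    proof
      fix v
      have l: "linear (frechet_derivative f (at t))" using calculation by (rule has_derivative_linear)
      show "frechet_derivative f (at t) v = frechet_derivative f (at t) 1 * v"
        using linear_scale[OF l, of v 1] by (simp add: mult.commute)
    qed
    ultimately show ?thesis by (simp add: has_field_derivative_def)
  qed
  then show *: "frechet_derivative f (at t) 1 = deriv f t" for t by (metis DERIV_imp_deriv)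
  show "(f has_real_derivative deriv f t) (at t)" using d[of t] * by simp
  have "continuous_on UNIV (\<lambda>t. frechet_derivative f (at t) 1)" using C by simp
  then show "continuous_on UNIV (deriv f)" by (simp add: *)
qed

lemma smooth_map_slice:
  assumes M: "smooth_atlas M" and N: "smooth_atlas N" and K: "smooth_atlas K"
    and h: "smooth_map (prod_mfd N M) K h" and x: "x \<in> mspace M"
  shows "smooth_map N K (\<lambda>s. h (s, x))"
  by (rule smooth_map_compose[OF N smooth_atlas_prod[OF N M] K smooth_map_Pair h])
    (use x in \<open>auto intro: smooth_map_id[OF N] smooth_map_const\<close>)

text \<open>The Dirichlet energy of the path. Squaring keeps the integrand smooth, and integrating
  keeps the result smooth in \<open>x\<close>; an absolute value or a maximum over time would in
  general do neither.\<close>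

definition energy :: "(real \<times> 'a \<Rightarrow> real) \<Rightarrow> 'a \<Rightarrow> real" where
  "energy h x = integral {0..1} (\<lambda>t. (deriv (\<lambda>s. h (s, x)) t)\<^sup>2)"

text \<open>By convention a non-integrable integrand has integral 0, so the bound holds for
  arbitrary \<open>h\<close>.\<close>

lemma energy_nonneg: "0 \<le> energy h x"
  unfolding energy_def
  by (metis Henstock_Kurzweil_Integration.integral_nonneg not_integrable_integral order_refl zero_le_power2)

lemma smooth_map_energy:
  fixes M :: "('a, 'h::euclidean_space) mfd"
  assumes M: "smooth_manifold M" and h: "smooth_map (prod_mfd real_mfd M) real_mfd h"
  shows "smooth_map M real_mfd (energy h)"
proof -
  note sM = smooth_manifold_imp_smooth_atlas[OF M]
  show ?thesis
  proof (rule smooth_map_realI[OF sM])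
    fix U \<phi> assume U: "(U, \<phi>) \<in> atlas M"
    then obtain V where V: "subspace V" "openin (top_of_set V) (\<phi> ` U)"
      using M unfolding smooth_manifold_def by blast
    then obtain T where T: "open T" "\<phi> ` U = V \<inter> T" by (auto simp: openin_open)
    obtain P :: "'h \<Rightarrow> 'h" where P: "range P \<subseteq> V" "linear P" "\<And>v. v \<in> V \<Longrightarrow> P v = v"
      using linear_exists_left_inverse_on[OF linear_ident V(1)] by auto
    \<comment> \<open>The image of a chart is open only in a subspace; composing with a projection onto it gives
      functions on an open set, whose derivatives make sense.\<close>
    define \<Omega> where "\<Omega> = P -` T"
    have bP: "bounded_linear P" using P(2) linear_conv_bounded_linear by blast
    have \<Omega>: "open \<Omega>" unfolding \<Omega>_def
      by (rule open_vimage[OF T(1) linear_continuous_on[OF bP]])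
    have P\<Omega>: "P a \<in> \<phi> ` U" if "a \<in> \<Omega>" for a using that P(1) T(2) by (auto simp: \<Omega>_def)
    define k where "k = (\<lambda>z. h (fst z, inv_into U \<phi> (P (snd z))))"
    have "smooth_on (UNIV \<times> \<Omega>) ((h \<circ> inv_into (UNIV \<times> U) (map_prod id \<phi>)) \<circ> map_prod (\<lambda>x. x) P)"
    proof (rule smooth_on_compose)
      show "smooth_on (UNIV \<times> \<Omega>) (map_prod (\<lambda>x. x) P)"
        by (intro smooth_on_map_prod smooth_on_bounded_linear bP bounded_linear_ident)
      show "smooth_on (map_prod id \<phi> ` (UNIV \<times> U)) (h \<circ> inv_into (UNIV \<times> U) (map_prod id \<phi>))"
        by (rule smooth_map_realD[OF h prod_chartI]) (use U in auto)
      show "map_prod (\<lambda>x. x) P ` (UNIV \<times> \<Omega>) \<subseteq> map_prod id \<phi> ` (UNIV \<times> U)"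
        using P\<Omega> by (auto simp: map_prod_surj_on[OF refl refl])
    qed
    then have "smooth_on (UNIV \<times> \<Omega>) k"
      by (rule smooth_on_cong)
        (auto simp: k_def P\<Omega> inv_into_map_prod[OF inj_on_id chart_inj_on[OF sM U]])
    then have Ck: "Ck_on n (UNIV \<times> \<Omega>) k" for n
      using \<Omega> by (simp add: smooth_on_open open_Times)
    \<comment> \<open>The time derivative of a slice is the partial derivative of \<open>k\<close>
      in direction \<open>(1, 0)\<close>; in this form the integrand of the energy is jointly smooth
      in time and parameter.\<close>
    have D: "frechet_derivative k (at (t, a)) (1, 0) = deriv (\<lambda>s. h (s, inv_into U \<phi> (P a))) t"
      if a: "a \<in> \<Omega>" for t a
    proof -
      have x: "inv_into U \<phi> (P a) \<in> mspace M"
        using inv_into_into[OF P\<Omega>[OF a]] chart_subset[OF sM U] by blast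
      have "(k has_derivative frechet_derivative k (at (t, a))) (at (t, a))"
        by (rule Ck_on_has_derivative[OF Ck]) (use a in auto)
      moreover have "((\<lambda>s. (s, a)) has_derivative (\<lambda>v. (v, 0))) (at t)"
        by (intro has_derivative_Pair has_derivative_const has_derivative_ident)
      ultimately have "((\<lambda>s. h (s, inv_into U \<phi> (P a))) has_derivative
          (\<lambda>v. frechet_derivative k (at (t, a)) (v, 0))) (at t)"
        using diff_chain_at[of "\<lambda>s. (s, a)" _ t k] by (simp add: o_def k_def)
      then have "frechet_derivative (\<lambda>s. h (s, inv_into U \<phi> (P a))) (at t)
          = (\<lambda>v. frechet_derivative k (at (t, a)) (v, 0))"
        by (rule frechet_derivative_at[symmetric])
      then show ?thesis
        using smooth_map_real_real_deriv(3)[OF smooth_map_slice[OF sM smooth_atlas_real smooth_atlas_real h x]]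
        by metis
    qed
    have "Ck_on n \<Omega> (\<lambda>a. energy h (inv_into U \<phi> (P a)))" for n
    proof -
      have "Ck_on n (UNIV \<times> \<Omega>) (\<lambda>z. frechet_derivative k (at z) (1, 0))" using Ck[of "Suc n"] by simp
      then have "Ck_on n (UNIV \<times> \<Omega>) (\<lambda>z. frechet_derivative k (at z) (1, 0) * frechet_derivative k (at z) (1, 0))"
        using \<Omega> by (intro Ck_on_bilinear[OF _ bounded_bilinear_mult]) (auto intro: open_Times)
      from Ck_on_integral_param[OF \<Omega> this]
      show ?thesis
        by (rule Ck_on_cong[OF \<Omega>, rotated]) (simp add: D energy_def power2_eq_square)
    qed
    then have "smooth_on \<Omega> (\<lambda>a. energy h (inv_into U \<phi> (P a)))" using \<Omega> by (simp add: smooth_on_open)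
    then have "smooth_on (\<phi> ` U) (\<lambda>a. energy h (inv_into U \<phi> (P a)))"
      by (rule smooth_on_subset) (use T(2) P(3) in \<open>auto simp: \<Omega>_def\<close>)
    then show "smooth_on (\<phi> ` U) (energy h \<circ> inv_into U \<phi>)"
      by (rule smooth_on_cong) (use T(2) P(3) in auto)
  qed
qed

text \<open>AM-GM in the form \<open>|h'| \<le> \<mu> h'\<^sup>2 + 1 / (4 \<mu>)\<close> replaces the Cauchy-Schwarz inequality.\<close>

lemma energy_bound:
  assumes h: "smooth_map real_mfd real_mfd (\<lambda>t. h (t, x))"
    and st: "0 \<le> s" "s \<le> t" "t \<le> 1" and E: "energy h x \<le> E" and d: "16 * (1 + E) * (t - s) \<le> 1"
  shows "\<bar>h (t, x) - h (s, x)\<bar> \<le> 1/4"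
proof -
  let ?h = "\<lambda>t. h (t, x)"
  let ?d = "deriv ?h"
  have E0: "0 \<le> E" using energy_nonneg[of h x] E by linarith
  \<comment> \<open>The change will be at most \<open>\<mu> * E + (t - s) / (4 * \<mu>)\<close>.
    This \<mu> makes the first term at most 1/8, and the second equals
    \<open>2 * (1 + E) * (t - s)\<close>, at most 1/8 by the bound on \<open>t - s\<close>. The
    summand 1 covers \<open>E = 0\<close>.\<close>
  define \<mu> where "\<mu> = 1 / (8 * (1 + E))"
  have \<mu>: "\<mu> > 0" using E0 by (simp add: \<mu>_def)
  have c: "continuous_on A ?d" for A
    using smooth_map_real_real_deriv(2)[OF h] by (rule continuous_on_subset) simp
  have i: "(\<lambda>r. (?d r)\<^sup>2) integrable_on {a..b}" for a b
    by (intro integrable_continuous_real continuous_intros c)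
  have "(?d has_integral (?h t - ?h s)) {s..t}"
    by (rule fundamental_theorem_of_calculus[OF st(2)])
      (metis smooth_map_real_real_deriv(1)[OF h] has_field_derivative_at_within has_real_derivative_iff_has_vector_derivative)
  then have "norm (?h t - ?h s) \<le> integral {s..t} (\<lambda>r. \<mu> * (?d r)\<^sup>2 + 1 / (4 * \<mu>))"
    unfolding has_integral_iff
  proof (elim conjE, hypsubst?)
    assume a: "?d integrable_on {s..t}" "integral {s..t} ?d = ?h t - ?h s"
    have "norm (integral {s..t} ?d) \<le> integral {s..t} (\<lambda>r. \<mu> * (?d r)\<^sup>2 + 1 / (4 * \<mu>))"
    proof (rule integral_norm_bound_integral[OF a(1)])
      show "(\<lambda>r. \<mu> * (?d r)\<^sup>2 + 1 / (4 * \<mu>)) integrable_on {s..t}"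
        by (intro integrable_continuous_real continuous_intros c)
      fix r
      have "0 \<le> (2 * \<mu> * \<bar>?d r\<bar> - 1)\<^sup>2" by simp
      then have "4 * \<mu> * \<bar>?d r\<bar> \<le> 4 * \<mu> * (\<mu> * (?d r)\<^sup>2 + 1 / (4 * \<mu>))"
        using \<mu> by (simp add: power2_eq_square algebra_simps)
      then show "norm (?d r) \<le> \<mu> * (?d r)\<^sup>2 + 1 / (4 * \<mu>)"
        using \<mu> by (simp only: mult_le_cancel_left_pos real_norm_def zero_less_mult_iff) simp
    qed
    then show ?thesis using a(2) by simp
  qed
  also have "\<dots> = \<mu> * integral {s..t} (\<lambda>r. (?d r)\<^sup>2) + (t - s) / (4 * \<mu>)"
    using st(2) by (subst Henstock_Kurzweil_Integration.integral_add)
      (auto intro!: integrable_on_mult_right i)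
  also have "\<dots> \<le> \<mu> * E + (t - s) / (4 * \<mu>)"
  proof -
    have "integral {s..t} (\<lambda>r. (?d r)\<^sup>2) \<le> integral {0..1} (\<lambda>r. (?d r)\<^sup>2)"
      by (rule integral_subset_le) (use st i in auto)
    then show ?thesis using E \<mu> by (simp add: energy_def)
  qed
  also have "\<mu> * E \<le> 1 / 8" using E0 by (simp add: \<mu>_def divide_simps)
  also have "(t - s) / (4 * \<mu>) \<le> 1 / 8"
    using d E0 by (simp add: \<mu>_def divide_simps algebra_simps)
  finally show ?thesis by simp
qed


section \<open>Extending a homotopy to the whole real line\<close>

lemma smooth_atlas_unit_interval: "smooth_atlas unit_interval_mfd"
  by (rule smooth_atlasI)
    (auto simp: unit_interval_mfd_def homeomorphic_map_id subtopology_subtopology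
      intro: smooth_on_cong[OF smooth_on_bounded_linear[OF bounded_linear_ident]])

lemma smooth_map_into_unit_interval:
  assumes f: "smooth_map M real_mfd f" and 01: "\<And>x. x \<in> mspace M \<Longrightarrow> f x \<in> {0..1}"
  shows "smooth_map M unit_interval_mfd f"
proof (rule smooth_mapI)
  show "continuous_map (mtop M) (mtop unit_interval_mfd) f"
    using smooth_map_continuous[OF f] 01 by (auto simp: unit_interval_mfd_def continuous_map_in_subtopology)
  fix U \<phi> W \<psi> assume "(U, \<phi>) \<in> atlas M" "(W, \<psi>) \<in> atlas unit_interval_mfd"
  then have "(U, \<phi>) \<in> atlas M" "\<psi> = id" by (auto simp: unit_interval_mfd_def)
  then show "smooth_on (\<phi> ` {x \<in> U. f x \<in> W}) (\<psi> \<circ> f \<circ> inv_into U \<phi>)"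
    using smooth_on_subset[OF smooth_map_realD[OF f]] by (simp add: image_mono)
qed

section \<open>A smooth transition function and the extended homotopy\<close>

definition smooth_step :: "real \<Rightarrow> real" where
  "smooth_step t = flat t / (flat t + flat (1 - t))"

lemma flat_sum_pos: "0 < flat t + flat (1 - t)"
  by (smt (verit) flat_nonneg flat_eq_0_iff)

lemma smooth_step_01: "smooth_step t \<in> {0..1}"
  using flat_sum_pos[of t] flat_nonneg[of t] flat_nonneg[of "1 - t"]
  by (simp add: smooth_step_def divide_simps)

lemma smooth_step_eq_0: "t \<le> 0 \<Longrightarrow> smooth_step t = 0"
  by (simp add: smooth_step_def flat_eq_0_iff)

lemma smooth_step_eq_1: "1 \<le> t \<Longrightarrow> smooth_step t = 1"
  using flat_sum_pos[of t] flat_eq_0_iff[of "1 - t"] by (simp add: smooth_step_def)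

lemma smooth_map_smooth_step: "smooth_map real_mfd unit_interval_mfd smooth_step"
proof (rule smooth_map_into_unit_interval)
  have i: "smooth_map real_mfd real_mfd (\<lambda>t. t)" by (rule smooth_map_id[OF smooth_atlas_real])
  have "smooth_map real_mfd real_mfd (\<lambda>t. 1 + (- 1) * t)"
    by (intro smooth_map_real_add smooth_map_real_mult smooth_map_const i smooth_atlas_real) auto
  then have r: "smooth_map real_mfd real_mfd (\<lambda>t. 1 - t)" by simp
  show "smooth_map real_mfd real_mfd smooth_step"
    unfolding smooth_step_def[abs_def]
    by (intro smooth_map_real_divide smooth_map_real_add smooth_map_flat i r smooth_atlas_real)
      (use flat_sum_pos in \<open>simp add: less_imp_neq[symmetric]\<close>)
qed (rule smooth_step_01)

text \<open>Reparametrising time by \<open>smooth_step\<close>, which takes values in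
  \<open>[0, 1]\<close>, trades the interval for a manifold without boundary and lets steps run past
  time 1 without leaving the domain.\<close>

lemma smoothly_homotopic_extend:
  assumes M: "smooth_atlas M" and N: "smooth_atlas N" and "smoothly_homotopic M N f g"
  obtains H where "smooth_map (prod_mfd real_mfd M) N H"
    "\<And>t x. x \<in> mspace M \<Longrightarrow> t \<le> 0 \<Longrightarrow> H (t, x) = f x" "\<And>t x. x \<in> mspace M \<Longrightarrow> 1 \<le> t \<Longrightarrow> H (t, x) = g x"
proof -
  obtain H where H: "smooth_map (prod_mfd unit_interval_mfd M) N H"
    "\<forall>x\<in>mspace M. H (0, x) = f x \<and> H (1, x) = g x"
    using assms(3) unfolding smoothly_homotopic_def by blast
  note RM = smooth_atlas_prod[OF smooth_atlas_real M] and IM = smooth_atlas_prod[OF smooth_atlas_unit_interval M]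
  have "smooth_map (prod_mfd real_mfd M) N (\<lambda>z. H (smooth_step (fst z), snd z))"
    by (rule smooth_map_compose[OF RM IM N _ H(1)])
      (intro smooth_map_Pair smooth_map_snd smooth_atlas_real M
        smooth_map_compose[OF RM smooth_atlas_real smooth_atlas_unit_interval smooth_map_fst smooth_map_smooth_step])
  then show thesis
    by (rule that) (use H(2) in \<open>auto simp: smooth_step_eq_0 smooth_step_eq_1\<close>)
qed


section \<open>Gluing along homeomorphisms with smooth transitions\<close>

definition uniform_dim :: "('a, 'e::euclidean_space) mfd \<Rightarrow> bool" where
  "uniform_dim M \<longleftrightarrow> (\<exists>d. \<forall>(U, \<phi>)\<in>atlas M. \<exists>V. subspace V \<and> dim V = d \<and> openin (top_of_set V) (\<phi> ` U))"

text \<open>Separates three clauses that a glued space inherits in different ways: the Hausdorff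
  axiom from its topology, the atlas from the gluing maps, the dimension from the model.\<close>

lemma smooth_manifold_iff:
  "smooth_manifold M \<longleftrightarrow> Hausdorff_space (mtop M) \<and> smooth_atlas M \<and> uniform_dim M"
proof
  assume M: "smooth_manifold M"
  then have "uniform_dim M" unfolding smooth_manifold_def uniform_dim_def by fast
  then show "Hausdorff_space (mtop M) \<and> smooth_atlas M \<and> uniform_dim M"
    using M smooth_manifold_imp_smooth_atlas by (auto simp: smooth_manifold_def)
next
  assume M: "Hausdorff_space (mtop M) \<and> smooth_atlas M \<and> uniform_dim M"
  then obtain d where d: "\<forall>z\<in>atlas M. \<exists>V. subspace V \<and> dim V = d \<and> openin (top_of_set V) (snd z ` fst z)"
    unfolding uniform_dim_def by (auto simp: split_beta)
  have "\<forall>(U, \<phi>)\<in>atlas M. openin (mtop M) U \<and>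
        homeomorphic_map (subtopology (mtop M) U) (top_of_set (\<phi> ` U)) \<phi> \<and>
        (\<exists>V. subspace V \<and> dim V = d \<and> openin (top_of_set V) (\<phi> ` U))"
    using M d by (auto simp: split_beta smooth_atlas_def)
  moreover have "\<forall>(U, \<phi>)\<in>atlas M. \<forall>(U', \<phi>')\<in>atlas M. smooth_on (\<phi> ` (U \<inter> U')) (\<phi>' \<circ> inv_into U \<phi>)"
    "(\<Union>(U, \<phi>)\<in>atlas M. U) = mspace M"
    using M unfolding smooth_atlas_def by simp_all
  ultimately show "smooth_manifold M"
    using M unfolding smooth_manifold_def by (intro conjI exI[of _ d]) simp_all
qed

lemma uniform_dim_prod:
  assumes "uniform_dim M" "uniform_dim N"
  shows "uniform_dim (prod_mfd M N)"
proof -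
  obtain d d' where d: "\<forall>(U, \<phi>)\<in>atlas M. \<exists>V. subspace V \<and> dim V = d \<and> openin (top_of_set V) (\<phi> ` U)"
    "\<forall>(U, \<phi>)\<in>atlas N. \<exists>V. subspace V \<and> dim V = d' \<and> openin (top_of_set V) (\<phi> ` U)"
    using assms unfolding uniform_dim_def by blast
  have "\<exists>V. subspace V \<and> dim V = d + d' \<and> openin (top_of_set V) (\<kappa> ` A)"
    if "(A, \<kappa>) \<in> atlas (prod_mfd M N)" for A \<kappa>
  proof -
    from that obtain U \<phi> W \<psi> where c: "(U, \<phi>) \<in> atlas M" "(W, \<psi>) \<in> atlas N" "A = U \<times> W" "\<kappa> = map_prod \<phi> \<psi>"
      by (rule prod_chartE)
    from d c obtain V V' where V: "subspace V" "dim V = d" "openin (top_of_set V) (\<phi> ` U)"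
      "subspace V'" "dim V' = d'" "openin (top_of_set V') (\<psi> ` W)" by blast
    have "openin (prod_topology (top_of_set V) (top_of_set V')) (\<phi> ` U \<times> \<psi> ` W)"
      using V by (simp add: openin_prod_Times_iff del: prod_topology_subtopology_eu)
    then show ?thesis
      using V c by (intro exI[of _ "V \<times> V'"]) (simp add: subspace_Times dim_Times map_prod_surj_on[OF refl refl])
  qed
  then show ?thesis unfolding uniform_dim_def by (intro exI[of _ "d + d'"]) auto
qed

text \<open>The members of \<open>I\<close> identify open pieces of \<open>T\<close> with open
  subsets of a model \<open>Q\<close>, and charts of \<open>Q\<close> are pulled back along them.
  With \<open>Q = M \<times> G\<close> and the trivialisations as pieces this is literally the atlas
  of \<open>pullback_bundle\<close>.\<close>

definition glued_mfd :: "'z topology \<Rightarrow> ('q, 'e) mfd \<Rightarrow> ('z set \<times> ('z \<Rightarrow> 'q)) set \<Rightarrow> ('z, 'e) mfd" where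
  "glued_mfd T Q I = \<lparr>mtop = T,
     atlas = {({z \<in> X. \<psi> z \<in> B}, \<beta> \<circ> \<psi>) | X \<psi> B \<beta>. (X, \<psi>) \<in> I \<and> (B, \<beta>) \<in> atlas Q}\<rparr>"

locale gluing =
  fixes T :: "'z topology" and Q :: "('q, 'e::euclidean_space) mfd" and I :: "('z set \<times> ('z \<Rightarrow> 'q)) set"
  assumes Q: "smooth_atlas Q"
    and cover: "(\<Union>(X, \<psi>)\<in>I. X) = topspace T"
    and open_domain: "(X, \<psi>) \<in> I \<Longrightarrow> openin T X"
    and open_image: "(X, \<psi>) \<in> I \<Longrightarrow> openin (mtop Q) (\<psi> ` X)"
    and homeomorphic: "(X, \<psi>) \<in> I \<Longrightarrow> homeomorphic_map (subtopology T X) (subtopology (mtop Q) (\<psi> ` X)) \<psi>"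
    and transition: "(X, \<psi>) \<in> I \<Longrightarrow> (Y, \<theta>) \<in> I \<Longrightarrow>
      smooth_map (restr_mfd Q (\<psi> ` (X \<inter> Y))) Q (\<theta> \<circ> inv_into X \<psi>)"
begin

abbreviation "E \<equiv> glued_mfd T Q I"

lemma mtop_glued [simp]: "mtop E = T"
  by (simp add: glued_mfd_def)

lemma glued_chartE:
  assumes "(A, \<kappa>) \<in> atlas E"
  obtains X \<psi> B \<beta> where "(X, \<psi>) \<in> I" "(B, \<beta>) \<in> atlas Q" "A = {z \<in> X. \<psi> z \<in> B}" "\<kappa> = \<beta> \<circ> \<psi>"
  using assms unfolding glued_mfd_def by auto

lemma glued_chartI: "(X, \<psi>) \<in> I \<Longrightarrow> (B, \<beta>) \<in> atlas Q \<Longrightarrow> ({z \<in> X. \<psi> z \<in> B}, \<beta> \<circ> \<psi>) \<in> atlas E"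
  unfolding glued_mfd_def by auto

lemma glue_inj_on: "(X, \<psi>) \<in> I \<Longrightarrow> inj_on \<psi> X"
  using homeomorphic_imp_injective_map[OF homeomorphic] openin_subset[OF open_domain]
  by (metis inf.absorb_iff2 topspace_subtopology)

lemma glued_chart_inj_on:
  assumes "(X, \<psi>) \<in> I" "(B, \<beta>) \<in> atlas Q"
  shows "inj_on (\<beta> \<circ> \<psi>) {z \<in> X. \<psi> z \<in> B}"
  using glue_inj_on[OF assms(1)] chart_inj_on[OF Q assms(2)] unfolding inj_on_def by auto

lemma glued_chart_inv:
  assumes "(X, \<psi>) \<in> I" "(B, \<beta>) \<in> atlas Q" "z \<in> X" "\<psi> z \<in> B"
  shows "inv_into {z \<in> X. \<psi> z \<in> B} (\<beta> \<circ> \<psi>) (\<beta> (\<psi> z)) = z"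
  using inv_into_f_f[OF glued_chart_inj_on[OF assms(1,2)], of z] assms(3,4) by simp

lemma glued_chart_openin:
  assumes "(X, \<psi>) \<in> I" "(B, \<beta>) \<in> atlas Q"
  shows "openin T {z \<in> X. \<psi> z \<in> B}"
proof -
  have "continuous_map (subtopology T X) (mtop Q) \<psi>"
    using homeomorphic_imp_continuous_map[OF homeomorphic[OF assms(1)]] continuous_map_into_fulltopology by blast
  from openin_continuous_map_preimage[OF this chart_openin[OF Q assms(2)]]
  have "openin (subtopology T X) {z \<in> X. \<psi> z \<in> B}"
    using openin_subset[OF open_domain[OF assms(1)]] by (simp add: Collect_conj_eq inf.absorb2)
  then show ?thesis using openin_trans_full open_domain[OF assms(1)] by blast
qed

lemma glued_chart_image: "\<psi> ` {z \<in> X. \<psi> z \<in> B} = B \<inter> \<psi> ` X"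
  by auto

lemma smooth_atlas_glued: "smooth_atlas E"
proof (rule smooth_atlasI)
  have ex: "\<exists>B \<beta>. (B, \<beta>) \<in> atlas Q \<and> \<psi> z \<in> B" if "(X, \<psi>) \<in> I" "z \<in> X" for X \<psi> z
  proof -
    have "\<psi> z \<in> mspace Q" using openin_subset[OF open_image[OF that(1)]] that(2) by blast
    then show ?thesis using chart_at[OF Q] by metis
  qed
  have 1: "z \<in> (\<Union>(A, \<kappa>)\<in>atlas E. A)" if X: "(X, \<psi>) \<in> I" "z \<in> X" for X \<psi> z
  proof -
    obtain B \<beta> where "(B, \<beta>) \<in> atlas Q" "\<psi> z \<in> B" using ex[OF X] by blast
    then show ?thesis
      using X(2) by (intro UN_I[OF glued_chartI[OF X(1)]]) auto
  qed
  have 2: "z \<in> (\<Union>(X, \<psi>)\<in>I. X)" if "(A, \<kappa>) \<in> atlas E" "z \<in> A" for A \<kappa> z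
    using that by (elim glued_chartE) auto
  have "(\<Union>(A, \<kappa>)\<in>atlas E. A) = (\<Union>(X, \<psi>)\<in>I. X)"
    by (rule subset_antisym; rule subsetI; elim UN_E; clarify; rule 1 2; assumption)
  then show "(\<Union>(A, \<kappa>)\<in>atlas E. A) = mspace E" using cover by simp
next
  fix A \<kappa> assume "(A, \<kappa>) \<in> atlas E"
  then obtain X \<psi> B \<beta> where c: "(X, \<psi>) \<in> I" "(B, \<beta>) \<in> atlas Q" and A: "A = {z \<in> X. \<psi> z \<in> B}" "\<kappa> = \<beta> \<circ> \<psi>"
    by (rule glued_chartE)
  show "openin (mtop E) A" using glued_chart_openin[OF c] by (simp add: A)
  have AX: "topspace T \<inter> X \<inter> A = A" "X \<inter> A = A" using openin_subset[OF open_domain[OF c(1)]] by (auto simp: A)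
  have im: "mspace Q \<inter> \<psi> ` X \<inter> \<psi> ` A = \<psi> ` A" "\<psi> ` X \<inter> \<psi> ` A = \<psi> ` A"
    using openin_subset[OF open_image[OF c(1)]] by (auto simp: A)
  have "homeomorphic_map (subtopology (subtopology T X) A) (subtopology (subtopology (mtop Q) (\<psi> ` X)) (\<psi> ` A)) \<psi>"
    by (rule homeomorphic_map_subtopologies[OF homeomorphic[OF c(1)]]) (use AX im in simp)
  then have 1: "homeomorphic_map (subtopology T A) (subtopology (mtop Q) (\<psi> ` A)) \<psi>"
    by (simp add: subtopology_subtopology AX im)
  have b: "\<psi> ` A \<subseteq> B" by (auto simp: A)
  have "homeomorphic_map (subtopology (subtopology (mtop Q) B) (\<psi> ` A)) (subtopology (top_of_set (\<beta> ` B)) (\<beta> ` \<psi> ` A)) \<beta>"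
    by (rule homeomorphic_map_subtopologies[OF chart_homeomorphic_map[OF Q c(2)]])
      (use b chart_subset[OF Q c(2)] in \<open>auto simp: image_iff\<close>)
  moreover have "B \<inter> \<psi> ` A = \<psi> ` A" "\<beta> ` B \<inter> \<beta> ` \<psi> ` A = \<beta> ` \<psi> ` A" using b by auto
  ultimately have 2: "homeomorphic_map (subtopology (mtop Q) (\<psi> ` A)) (top_of_set (\<beta> ` \<psi> ` A)) \<beta>"
    by (simp add: subtopology_subtopology)
  from homeomorphic_map_compose[OF 1 2]
  show "homeomorphic_map (subtopology (mtop E) A) (top_of_set (\<kappa> ` A)) \<kappa>" by (simp add: A(2) image_comp)
next
  fix A \<kappa> A' \<kappa>' assume a: "(A, \<kappa>) \<in> atlas E" "(A', \<kappa>') \<in> atlas E"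
  from a(1) obtain X \<psi> B \<beta> where c: "(X, \<psi>) \<in> I" "(B, \<beta>) \<in> atlas Q" and A: "A = {z \<in> X. \<psi> z \<in> B}" "\<kappa> = \<beta> \<circ> \<psi>"
    by (rule glued_chartE)
  from a(2) obtain Y \<theta> C \<gamma> where c': "(Y, \<theta>) \<in> I" "(C, \<gamma>) \<in> atlas Q" and A': "A' = {z \<in> Y. \<theta> z \<in> C}" "\<kappa>' = \<gamma> \<circ> \<theta>"
    by (rule glued_chartE)
  let ?P = "\<psi> ` (X \<inter> Y)"
  have "(B \<inter> ?P, \<beta>) \<in> atlas (restr_mfd Q ?P)" using c(2) by (auto simp: restr_mfd_def)
  from smooth_mapD[OF transition[OF c(1) c'(1)] this c'(2)]
  have s: "smooth_on (\<beta> ` {q \<in> B \<inter> ?P. (\<theta> \<circ> inv_into X \<psi>) q \<in> C}) (\<gamma> \<circ> (\<theta> \<circ> inv_into X \<psi>) \<circ> inv_into (B \<inter> ?P) \<beta>)" .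
  have inv: "inv_into X \<psi> (\<psi> z) = z" if "z \<in> X" for z using that glue_inj_on[OF c(1)] by simp
  show "smooth_on (\<kappa> ` (A \<inter> A')) (\<kappa>' \<circ> inv_into A \<kappa>)"
  proof (rule smooth_on_cong[OF smooth_on_subset[OF s]])
    show "\<kappa> ` (A \<inter> A') \<subseteq> \<beta> ` {q \<in> B \<inter> ?P. (\<theta> \<circ> inv_into X \<psi>) q \<in> C}" by (auto simp: A A' inv)
    fix w assume "w \<in> \<kappa> ` (A \<inter> A')"
    then obtain z where z: "z \<in> A" "z \<in> A'" "w = \<beta> (\<psi> z)" by (auto simp: A)
    have "inv_into A \<kappa> w = z" using z glued_chart_inv[OF c] by (simp add: A)
    moreover have "inv_into (B \<inter> ?P) \<beta> w = \<psi> z"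
      using z chart_inv_restr[OF Q c(2), of "\<psi> z" ?P] by (auto simp: A A')
    ultimately show "(\<gamma> \<circ> (\<theta> \<circ> inv_into X \<psi>) \<circ> inv_into (B \<inter> ?P) \<beta>) w = (\<kappa>' \<circ> inv_into A \<kappa>) w"
      using z by (simp add: A A' inv)
  qed
qed

lemma uniform_dim_glued:
  assumes "uniform_dim Q"
  shows "uniform_dim E"
proof -
  obtain d where d: "\<forall>(U, \<phi>)\<in>atlas Q. \<exists>V. subspace V \<and> dim V = d \<and> openin (top_of_set V) (\<phi> ` U)"
    using assms unfolding uniform_dim_def by blast
  have "\<exists>V. subspace V \<and> dim V = d \<and> openin (top_of_set V) (\<kappa> ` A)" if "(A, \<kappa>) \<in> atlas E" for A \<kappa>
  proof -
    from that obtain X \<psi> B \<beta> where c: "(X, \<psi>) \<in> I" "(B, \<beta>) \<in> atlas Q" and A: "A = {z \<in> X. \<psi> z \<in> B}" "\<kappa> = \<beta> \<circ> \<psi>"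
      by (rule glued_chartE)
    from d c obtain V where V: "subspace V" "dim V = d" "openin (top_of_set V) (\<beta> ` B)" by blast
    obtain T where "open T" "\<And>S. S \<subseteq> B \<Longrightarrow> \<beta> ` (S \<inter> \<psi> ` X) = \<beta> ` S \<inter> T"
      using chart_image_Int_open[OF Q c(2) open_image[OF c(1)]] by metis
    moreover have "\<kappa> ` A = \<beta> ` (B \<inter> \<psi> ` X)" unfolding A image_comp[symmetric] glued_chart_image by simp
    ultimately have "openin (top_of_set V) (\<kappa> ` A)" using V(3) by (simp add: openin_Int_open)
    then show ?thesis using V by blast
  qed
  then show ?thesis unfolding uniform_dim_def by (intro exI[of _ d]) auto
qed

text \<open>Read in the chart \<open>\<beta> \<circ> \<psi>\<close> and the chart
  \<open>\<beta>\<close> of \<open>Q\<close>, the map \<open>\<psi>\<close> is the identity; the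
  same holds for its inverse below.\<close>

lemma smooth_map_glue:
  assumes X: "(X, \<psi>) \<in> I"
  shows "smooth_map (restr_mfd E X) Q \<psi>"
proof (rule smooth_mapI_local[OF smooth_atlas_restr[OF smooth_atlas_glued] Q])
  show "openin (mtop E) X" using open_domain[OF X] by simp
  show "continuous_map (mtop (restr_mfd E X)) (mtop Q) \<psi>"
    using homeomorphic_imp_continuous_map[OF homeomorphic[OF X]] continuous_map_into_fulltopology by fastforce
  fix z assume "z \<in> mspace (restr_mfd E X)"
  then have z: "z \<in> X" by simp
  then have "\<psi> z \<in> mspace Q" using openin_subset[OF open_image[OF X]] by blast
  then obtain B \<beta> where B: "(B, \<beta>) \<in> atlas Q" "\<psi> z \<in> B" by (rule chart_at[OF Q])
  let ?A = "{z \<in> X. \<psi> z \<in> B}"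
  have "?A \<inter> X = ?A" by auto
  then have 1: "(?A, \<beta> \<circ> \<psi>) \<in> atlas (restr_mfd E X)"
    using restr_chartI[OF glued_chartI[OF X B(1)], of X] by (simp only:)
  have 2: "openin (mtop (restr_mfd E X)) ?A"
    using glued_chart_openin[OF X B(1)] openin_subtopology_Int[of T ?A X] \<open>?A \<inter> X = ?A\<close> by simp
  have "smooth_on ((\<beta> \<circ> \<psi>) ` ?A) (\<beta> \<circ> \<psi> \<circ> inv_into ?A (\<beta> \<circ> \<psi>))"
    by (rule smooth_on_cong[OF smooth_on_bounded_linear[OF bounded_linear_ident]])
      (auto simp: glued_chart_inv[OF X B(1)])
  with 1 2 show "smooth_near (restr_mfd E X) Q \<psi> z"
    using z B by (intro exI[of _ ?A] exI[of _ "\<beta> \<circ> \<psi>"] exI[of _ B] exI[of _ \<beta>]) auto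
qed

lemma smooth_map_glue_inv:
  assumes X: "(X, \<psi>) \<in> I"
  shows "smooth_map (restr_mfd Q (\<psi> ` X)) E (inv_into X \<psi>)"
proof (rule smooth_mapI_local[OF smooth_atlas_restr[OF Q open_image[OF X]] smooth_atlas_glued])
  have inv: "inv_into X \<psi> (\<psi> z) = z" if "z \<in> X" for z using that glue_inj_on[OF X] by simp
  have im: "mspace Q \<inter> \<psi> ` X = \<psi> ` X" using openin_subset[OF open_image[OF X]] by blast
  have tX: "topspace T \<inter> X = X" using openin_subset[OF open_domain[OF X]] by blast
  obtain g where g: "homeomorphic_maps (subtopology T X) (subtopology (mtop Q) (\<psi> ` X)) \<psi> g"
    using homeomorphic[OF X] by (auto simp: homeomorphic_map_maps)
  then have "continuous_map (subtopology (mtop Q) (\<psi> ` X)) (subtopology T X) g"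
    by (simp add: homeomorphic_maps_def)
  then have "continuous_map (subtopology (mtop Q) (\<psi> ` X)) T g" by (rule continuous_map_into_fulltopology)
  then show "continuous_map (mtop (restr_mfd Q (\<psi> ` X))) (mtop E) (inv_into X \<psi>)"
    unfolding mtop_restr mtop_glued
  proof (rule continuous_map_eq)
    fix q assume "q \<in> topspace (subtopology (mtop Q) (\<psi> ` X))"
    then obtain z where "z \<in> X" "q = \<psi> z" by auto
    then show "g q = inv_into X \<psi> q" using g tX by (simp add: homeomorphic_maps_def inv)
  qed
  fix q assume "q \<in> mspace (restr_mfd Q (\<psi> ` X))"
  then obtain z where z: "z \<in> X" "q = \<psi> z" "q \<in> mspace Q" by auto
  obtain B \<beta> where B: "(B, \<beta>) \<in> atlas Q" "\<psi> z \<in> B" using chart_at[OF Q] z by metis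
  let ?A = "{z \<in> X. \<psi> z \<in> B}" and ?D = "B \<inter> \<psi> ` X"
  have 1: "(?D, \<beta>) \<in> atlas (restr_mfd Q (\<psi> ` X))" using B(1) by (auto simp: restr_mfd_def)
  have 2: "openin (mtop (restr_mfd Q (\<psi> ` X))) ?D"
    using chart_openin[OF Q B(1)] by (simp add: openin_subtopology_Int)
  have "smooth_on (\<beta> ` ?D) ((\<beta> \<circ> \<psi>) \<circ> inv_into X \<psi> \<circ> inv_into ?D \<beta>)"
    by (rule smooth_on_cong[OF smooth_on_bounded_linear[OF bounded_linear_ident]])
      (auto simp: chart_inv_restr[OF Q B(1)] inv)
  with 1 2 show "smooth_near (restr_mfd Q (\<psi> ` X)) E (inv_into X \<psi>) q"
    using z B glued_chartI[OF X B(1)]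
    by (intro exI[of _ ?D] exI[of _ \<beta>] exI[of _ ?A] exI[of _ "\<beta> \<circ> \<psi>"]) (auto simp: inv)
qed

end


section \<open>Principal bundles and their pull-backs\<close>

locale principal_fibre_bundle =
  fixes G :: "('g, 'k::euclidean_space) lie_struct" and N :: "('b, 'f::euclidean_space) mfd"
    and \<xi> :: "('p, 'e::euclidean_space, 'b, 'g) pbundle"
  assumes principal: "principal_bundle G N \<xi>"
begin

abbreviation "P \<equiv> mspace (tot \<xi>)"
abbreviation "\<pi> \<equiv> bproj \<xi>"
abbreviation "L \<equiv> lmfd G"
abbreviation "triv \<equiv> local_trivialisation G N \<xi>"

definition over :: "'b set \<Rightarrow> 'p set" where
  "over U = {p \<in> P. \<pi> p \<in> U}"

text \<open>\<open>diffeomorphism\<close> only asserts that some smooth inverse exists.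
  \<open>inv_into\<close> turns the inverse into a function of \<open>U\<close> and \<tau>; its
  smoothness is transferred in \<open>smooth_tinv\<close>, by agreement with the asserted inverse
  over \<open>U\<close>.\<close>

definition tinv :: "'b set \<Rightarrow> ('p \<Rightarrow> 'b \<times> 'g) \<Rightarrow> 'b \<times> 'g \<Rightarrow> 'p" where
  "tinv U \<tau> = inv_into (over U) \<tau>"

lemma lie: "lie_group G"
  and N_manifold: "smooth_manifold N"
  and tot_manifold: "smooth_manifold (tot \<xi>)"
  and proj_smooth: "smooth_map (tot \<xi>) N \<pi>"
  and ract_smooth: "smooth_map (prod_mfd (tot \<xi>) L) (tot \<xi>) (\<lambda>(p, a). ract \<xi> p a)"
  using principal by (simp_all add: principal_bundle_def)

lemma group: "group G"
  and L_manifold: "smooth_manifold L"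
  and mspace_L [simp]: "mspace L = carrier G"
  and mult_smooth: "smooth_map (prod_mfd L L) L (\<lambda>(a, b). a \<otimes>\<^bsub>G\<^esub> b)"
  and inv_smooth: "smooth_map L L (\<lambda>a. inv\<^bsub>G\<^esub> a)"
  using lie by (simp_all add: lie_group_def)

sublocale group G by (rule group)

lemmas sN = smooth_manifold_imp_smooth_atlas[OF N_manifold]
  and sT = smooth_manifold_imp_smooth_atlas[OF tot_manifold]
  and sL = smooth_manifold_imp_smooth_atlas[OF L_manifold]

lemma ract_in: "p \<in> P \<Longrightarrow> a \<in> carrier G \<Longrightarrow> ract \<xi> p a \<in> P"
  using smooth_map_in[OF ract_smooth, of "(p, a)"] by simp

lemma ract_one: "p \<in> P \<Longrightarrow> ract \<xi> p \<one>\<^bsub>G\<^esub> = p"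
  and proj_ract: "p \<in> P \<Longrightarrow> a \<in> carrier G \<Longrightarrow> \<pi> (ract \<xi> p a) = \<pi> p"
  and ract_ract: "p \<in> P \<Longrightarrow> a \<in> carrier G \<Longrightarrow> b \<in> carrier G \<Longrightarrow>
    ract \<xi> (ract \<xi> p a) b = ract \<xi> p (a \<otimes>\<^bsub>G\<^esub> b)"
  using principal by (simp_all add: principal_bundle_def)

lemma triv_exists: "y \<in> mspace N \<Longrightarrow> \<exists>U \<tau>. y \<in> U \<and> triv U \<tau>"
  using principal by (simp add: principal_bundle_def)

lemma triv_openin: "triv U \<tau> \<Longrightarrow> openin (mtop N) U"
  by (simp add: local_trivialisation_def)

lemma triv_subset: "triv U \<tau> \<Longrightarrow> U \<subseteq> mspace N"
  using triv_openin openin_subset by blast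

lemma fst_triv: "triv U \<tau> \<Longrightarrow> p \<in> P \<Longrightarrow> \<pi> p \<in> U \<Longrightarrow> fst (\<tau> p) = \<pi> p"
  and snd_triv_ract: "triv U \<tau> \<Longrightarrow> p \<in> P \<Longrightarrow> \<pi> p \<in> U \<Longrightarrow> a \<in> carrier G \<Longrightarrow>
    snd (\<tau> (ract \<xi> p a)) = snd (\<tau> p) \<otimes>\<^bsub>G\<^esub> a"
  unfolding local_trivialisation_def by simp_all

lemma over_openin: "openin (mtop N) U \<Longrightarrow> openin (mtop (tot \<xi>)) (over U)"
  unfolding over_def by (rule openin_continuous_map_preimage[OF smooth_map_continuous[OF proj_smooth]])

lemma triv_diffeo:
  assumes "triv U \<tau>"
  obtains h where "smooth_map (restr_mfd (tot \<xi>) (over U)) (prod_mfd (restr_mfd N U) L) \<tau>"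
    "smooth_map (prod_mfd (restr_mfd N U) L) (restr_mfd (tot \<xi>) (over U)) h"
    "\<And>p. p \<in> over U \<Longrightarrow> h (\<tau> p) = p" "\<And>y a. y \<in> U \<Longrightarrow> a \<in> carrier G \<Longrightarrow> \<tau> (h (y, a)) = (y, a)"
proof -
  have "mspace N \<inter> U = U" using triv_subset[OF assms] by blast
  moreover have "P \<inter> over U = over U" by (auto simp: over_def)
  moreover have "diffeomorphism (restr_mfd (tot \<xi>) (over U)) (prod_mfd (restr_mfd N U) L) \<tau>"
    using assms unfolding local_trivialisation_def over_def by blast
  ultimately show thesis using that unfolding diffeomorphism_def by auto
qed

lemma triv_inj_on: "triv U \<tau> \<Longrightarrow> inj_on \<tau> (over U)"
  by (metis triv_diffeo inj_onI)

lemma snd_triv_in: "triv U \<tau> \<Longrightarrow> p \<in> P \<Longrightarrow> \<pi> p \<in> U \<Longrightarrow> snd (\<tau> p) \<in> carrier G"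
proof -
  assume t: "triv U \<tau>" "p \<in> P" "\<pi> p \<in> U"
  obtain h where "smooth_map (restr_mfd (tot \<xi>) (over U)) (prod_mfd (restr_mfd N U) L) \<tau>"
    using triv_diffeo[OF t(1)] by blast
  from smooth_map_in[OF this, of p] t show ?thesis by (auto simp: over_def)
qed

lemma tinv:
  assumes t: "triv U \<tau>" and y: "y \<in> U" and a: "a \<in> carrier G"
  shows triv_tinv: "\<tau> (tinv U \<tau> (y, a)) = (y, a)" and "tinv U \<tau> (y, a) \<in> P"
    and proj_tinv: "\<pi> (tinv U \<tau> (y, a)) = y"
proof -
  obtain h where h: "smooth_map (prod_mfd (restr_mfd N U) L) (restr_mfd (tot \<xi>) (over U)) h"
    "\<And>y a. y \<in> U \<Longrightarrow> a \<in> carrier G \<Longrightarrow> \<tau> (h (y, a)) = (y, a)"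
    using triv_diffeo[OF t] by metis
  have "h (y, a) \<in> over U" using smooth_map_in[OF h(1), of "(y, a)"] y a triv_subset[OF t] by auto
  then have "(y, a) \<in> \<tau> ` over U" using h(2)[OF y a] by (metis image_eqI)
  then have "tinv U \<tau> (y, a) \<in> over U" and *: "\<tau> (tinv U \<tau> (y, a)) = (y, a)"
    unfolding tinv_def by (auto intro: inv_into_into f_inv_into_f)
  then show "\<tau> (tinv U \<tau> (y, a)) = (y, a)" "tinv U \<tau> (y, a) \<in> P" "\<pi> (tinv U \<tau> (y, a)) = y"
    using fst_triv[OF t, of "tinv U \<tau> (y, a)"] by (auto simp: over_def)
qed

lemma tinv_triv: "triv U \<tau> \<Longrightarrow> p \<in> P \<Longrightarrow> \<pi> p \<in> U \<Longrightarrow> tinv U \<tau> (\<pi> p, snd (\<tau> p)) = p"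
  using inv_into_f_f[OF triv_inj_on, of U \<tau> p] fst_triv[of U \<tau> p]
  by (metis (no_types, lifting) mem_Collect_eq over_def prod.collapse tinv_def)

lemma tinv_unique:
  assumes "triv U \<tau>" "p \<in> P" "\<pi> p = y" "y \<in> U" "snd (\<tau> p) = a"
  shows "tinv U \<tau> (y, a) = p"
  using tinv_triv[OF assms(1,2)] assms(3-5) by simp

lemma tinv_ract:
  assumes t: "triv U \<tau>" and y: "y \<in> U" and a: "a \<in> carrier G" and b: "b \<in> carrier G"
  shows "tinv U \<tau> (y, a \<otimes>\<^bsub>G\<^esub> b) = ract \<xi> (tinv U \<tau> (y, a)) b"
  by (rule tinv_unique[OF t])
    (use tinv[OF t y a] snd_triv_ract[OF t _ _ b] y b in \<open>simp_all add: ract_in proj_ract\<close>)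

lemma smooth_tinv:
  assumes K: "smooth_atlas K" and t: "triv U \<tau>" and y: "smooth_map K N y" "\<And>x. x \<in> mspace K \<Longrightarrow> y x \<in> U"
    and a: "smooth_map K L a"
  shows "smooth_map K (tot \<xi>) (\<lambda>x. tinv U \<tau> (y x, a x))"
proof -
  obtain h where h: "smooth_map (prod_mfd (restr_mfd N U) L) (restr_mfd (tot \<xi>) (over U)) h"
    "\<And>p. p \<in> over U \<Longrightarrow> h (\<tau> p) = p"
    using triv_diffeo[OF t] by metis
  note sU = smooth_atlas_restr[OF sN triv_openin[OF t]]
  have "smooth_map K (prod_mfd (restr_mfd N U) L) (\<lambda>x. (y x, a x))"
    by (rule smooth_map_Pair[OF smooth_map_into_restr[OF y] a])
  from smooth_map_compose[OF K smooth_atlas_prod[OF sU sL] sT this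
      smooth_map_from_restr_codomain[OF smooth_atlas_prod[OF sU sL] sT over_openin[OF triv_openin[OF t]] h(1)]]
  show ?thesis
  proof (rule smooth_map_cong[OF K])
    fix x assume x: "x \<in> mspace K"
    note yx = y(2)[OF x]
    have ax: "a x \<in> carrier G" using smooth_map_in[OF a x] by simp
    have "tinv U \<tau> (y x, a x) \<in> over U" using tinv[OF t yx ax] yx by (simp add: over_def)
    from h(2)[OF this] show "h (y x, a x) = tinv U \<tau> (y x, a x)" by (simp add: triv_tinv[OF t yx ax])
  qed
qed

lemma smooth_snd_triv_over: "triv U \<tau> \<Longrightarrow> smooth_map (restr_mfd (tot \<xi>) (over U)) L (\<lambda>p. snd (\<tau> p))"
proof -
  assume t: "triv U \<tau>"
  obtain h where h: "smooth_map (restr_mfd (tot \<xi>) (over U)) (prod_mfd (restr_mfd N U) L) \<tau>"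
    using triv_diffeo[OF t] by metis
  note sU = smooth_atlas_restr[OF sN triv_openin[OF t]]
  show ?thesis
    by (rule smooth_map_compose[OF smooth_atlas_restr[OF sT over_openin[OF triv_openin[OF t]]]
          smooth_atlas_prod[OF sU sL] sL h smooth_map_snd[OF sU sL]])
qed

lemma smooth_snd_triv:
  assumes K: "smooth_atlas K" and t: "triv U \<tau>" and q: "smooth_map K (tot \<xi>) q"
    "\<And>x. x \<in> mspace K \<Longrightarrow> \<pi> (q x) \<in> U"
  shows "smooth_map K L (\<lambda>x. snd (\<tau> (q x)))"
  by (rule smooth_map_compose_restr[OF K sT sL q(1) smooth_snd_triv_over[OF t] over_openin[OF triv_openin[OF t]]])
    (use q smooth_map_in[OF q(1)] in \<open>auto simp: over_def\<close>)

lemma smooth_mult: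
  assumes K: "smooth_atlas K" and "smooth_map K L a" "smooth_map K L b"
  shows "smooth_map K L (\<lambda>x. a x \<otimes>\<^bsub>G\<^esub> b x)"
  using smooth_map_compose[OF K smooth_atlas_prod[OF sL sL] sL smooth_map_Pair[OF assms(2,3)] mult_smooth] by simp

lemma smooth_inv:
  assumes K: "smooth_atlas K" and "smooth_map K L a"
  shows "smooth_map K L (\<lambda>x. inv\<^bsub>G\<^esub> a x)"
  using smooth_map_compose[OF K sL sL assms(2) inv_smooth] .

end

section \<open>Smooth structure and bundle structure of the pull-back\<close>

locale pullback = principal_fibre_bundle G N \<xi>
  for G :: "('g, 'k::euclidean_space) lie_struct" and N :: "('b, 'f::euclidean_space) mfd"
    and \<xi> :: "('p, 'e::euclidean_space, 'b, 'g) pbundle" +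
  fixes M :: "('a, 'h::euclidean_space) mfd" and f :: "'a \<Rightarrow> 'b"
  assumes M: "smooth_manifold M" and f: "smooth_map M N f"
begin

abbreviation "E \<equiv> pullback_space M f \<xi>"
abbreviation "T \<equiv> subtopology (prod_topology (mtop M) (mtop (tot \<xi>))) E"
abbreviation "Q \<equiv> prod_mfd M L"

definition edom :: "'b set \<Rightarrow> ('a \<times> 'p) set" where
  "edom U = {z \<in> E. f (fst z) \<in> U}"

definition base :: "'b set \<Rightarrow> 'a set" where
  "base U = {x \<in> mspace M. f x \<in> U}"

definition ptriv :: "('p \<Rightarrow> 'b \<times> 'g) \<Rightarrow> 'a \<times> 'p \<Rightarrow> 'a \<times> 'g" where
  "ptriv \<tau> z = (fst z, snd (\<tau> (snd z)))"

definition charts :: "(('a \<times> 'p) set \<times> ('a \<times> 'p \<Rightarrow> 'a \<times> 'g)) set" where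
  "charts = {(edom U, ptriv \<tau>) | U \<tau>. triv U \<tau>}"

lemmas sM = smooth_manifold_imp_smooth_atlas[OF M]
lemmas sQ = smooth_atlas_prod[OF sM sL]

lemma f_in: "x \<in> mspace M \<Longrightarrow> f x \<in> mspace N"
  by (rule smooth_map_in[OF f])

lemma mem_E: "(x, p) \<in> E \<longleftrightarrow> x \<in> mspace M \<and> p \<in> P \<and> \<pi> p = f x"
  by (auto simp: pullback_space_def)

lemma topspace_T [simp]: "topspace T = E"
  by (auto simp: pullback_space_def)

lemma base_openin: "openin (mtop N) U \<Longrightarrow> openin (mtop M) (base U)"
  unfolding base_def by (rule openin_continuous_map_preimage[OF smooth_map_continuous[OF f]])

lemma ptriv_in: "triv U \<tau> \<Longrightarrow> z \<in> edom U \<Longrightarrow> ptriv \<tau> z \<in> base U \<times> carrier G"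
  by (cases z) (auto simp: edom_def ptriv_def base_def mem_E snd_triv_in)

lemma ptriv_tinv:
  assumes t: "triv U \<tau>" and x: "x \<in> base U" and a: "a \<in> carrier G"
  shows "(x, tinv U \<tau> (f x, a)) \<in> edom U" "ptriv \<tau> (x, tinv U \<tau> (f x, a)) = (x, a)"
  using tinv[OF t _ a, of "f x"] x by (auto simp: edom_def mem_E base_def ptriv_def)

lemma tinv_ptriv: "triv U \<tau> \<Longrightarrow> (x, p) \<in> edom U \<Longrightarrow> (x, tinv U \<tau> (f x, snd (\<tau> p))) = (x, p)"
  by (auto simp: edom_def mem_E intro!: tinv_unique)

lemma ptriv_image: "triv U \<tau> \<Longrightarrow> ptriv \<tau> ` edom U = base U \<times> carrier G"
proof (intro subset_antisym subsetI)
  fix w assume t: "triv U \<tau>" and "w \<in> base U \<times> carrier G"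
  then obtain x a where w: "w = (x, a)" "x \<in> base U" "a \<in> carrier G" by auto
  then show "w \<in> ptriv \<tau> ` edom U" using ptriv_tinv[OF t w(2,3)] by (metis image_eqI)
qed (use ptriv_in in blast)

lemma ptriv_inj_on: "triv U \<tau> \<Longrightarrow> inj_on (ptriv \<tau>) (edom U)"
proof (rule inj_onI)
  fix z w assume t: "triv U \<tau>" and zw: "z \<in> edom U" "w \<in> edom U" "ptriv \<tau> z = ptriv \<tau> w"
  have "(fst z, tinv U \<tau> (f (fst z), snd (\<tau> (snd z)))) = z" "(fst w, tinv U \<tau> (f (fst w), snd (\<tau> (snd w)))) = w"
    using tinv_ptriv[OF t, of "fst z" "snd z"] tinv_ptriv[OF t, of "fst w" "snd w"] zw(1,2) by simp_all
  then show "z = w" using zw(3) unfolding ptriv_def by (metis prod.inject)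
qed

lemma inv_ptriv:
  assumes t: "triv U \<tau>" and x: "x \<in> base U" and a: "a \<in> carrier G"
  shows "inv_into (edom U) (ptriv \<tau>) (x, a) = (x, tinv U \<tau> (f x, a))"
  by (rule inv_into_f_eq[OF ptriv_inj_on[OF t] ptriv_tinv[OF t x a]])

lemma chartsE:
  assumes "(X, \<psi>) \<in> charts"
  obtains U \<tau> where "triv U \<tau>" "X = edom U" "\<psi> = ptriv \<tau>"
  using assms unfolding charts_def by auto

lemma chartsI: "triv U \<tau> \<Longrightarrow> (edom U, ptriv \<tau>) \<in> charts"
  unfolding charts_def by auto

lemma edom_openin: "openin (mtop N) U \<Longrightarrow> openin T (edom U)"
proof -
  assume U: "openin (mtop N) U"
  have "continuous_map T (mtop N) (f \<circ> fst)"
    by (rule continuous_map_compose[OF continuous_map_from_subtopology[OF continuous_map_fst] smooth_map_continuous[OF f]])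
  from openin_continuous_map_preimage[OF this U] show ?thesis by (simp only: topspace_T o_apply edom_def)
qed

lemma smooth_f_tinv:
  assumes t: "triv U \<tau>"
  shows "smooth_map (restr_mfd Q (base U \<times> carrier G)) (tot \<xi>) (\<lambda>z. tinv U \<tau> (f (fst z), snd z))"
proof -
  have o: "openin (mtop Q) (base U \<times> carrier G)"
    using base_openin[OF triv_openin[OF t]] by (simp add: openin_prod_Times_iff flip: mspace_L)
  note sR = smooth_atlas_restr[OF sQ o]
  show ?thesis
  proof (rule smooth_tinv[OF sR t])
    show "smooth_map (restr_mfd Q (base U \<times> carrier G)) N (\<lambda>z. f (fst z))"
      by (rule smooth_map_compose[OF sR sM sN smooth_map_restr[OF sQ smooth_map_fst[OF sM sL]] f])
    show "smooth_map (restr_mfd Q (base U \<times> carrier G)) L snd"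
      by (rule smooth_map_restr[OF sQ smooth_map_snd[OF sM sL]])
  qed (auto simp: base_def)
qed

lemma base_carrier_openin: "openin (mtop N) U \<Longrightarrow> openin (mtop Q) (base U \<times> carrier G)"
  using base_openin by (simp add: openin_prod_Times_iff flip: mspace_L)

lemma homeomorphic_map_ptriv:
  assumes t: "triv U \<tau>"
  shows "homeomorphic_map (subtopology T (edom U)) (subtopology (mtop Q) (ptriv \<tau> ` edom U)) (ptriv \<tau>)"
proof -
  \<comment> \<open>The inverse is explicit: it picks the point of the fibre over \<open>f x\<close>
    with the given group coordinate. Both directions are continuous because the trivialisation and
    its inverse are.\<close>
  let ?k = "\<lambda>z. (fst z, tinv U \<tau> (f (fst z), snd z))"
  let ?B = "base U \<times> carrier G"
  have dT: "topspace (subtopology T (edom U)) = edom U" by (auto simp: edom_def mem_E)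
  have B: "topspace (subtopology (mtop Q) ?B) = ?B" by (auto simp: base_def)
  have c1: "continuous_map (subtopology T (edom U)) (mtop M) fst"
    by (intro continuous_map_from_subtopology continuous_map_fst)
  have "continuous_map (subtopology T (edom U)) (mtop (tot \<xi>)) snd"
    by (intro continuous_map_from_subtopology continuous_map_snd)
  then have "continuous_map (subtopology T (edom U)) (mtop (restr_mfd (tot \<xi>) (over U))) snd"
    unfolding mtop_restr
    by (rule continuous_map_into_subtopology) (auto simp: dT edom_def mem_E over_def)
  from continuous_map_compose[OF this smooth_map_continuous[OF smooth_snd_triv_over[OF t]]]
  have "continuous_map (subtopology T (edom U)) (mtop Q) (ptriv \<tau>)"
    using c1 by (simp add: ptriv_def[abs_def] continuous_map_paired o_def)
  then have 1: "continuous_map (subtopology T (edom U)) (subtopology (mtop Q) ?B) (ptriv \<tau>)"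
    by (rule continuous_map_into_subtopology) (use ptriv_in[OF t] dT in auto)
  have "continuous_map (subtopology (mtop Q) ?B) (mtop M) fst"
    using continuous_map_from_subtopology[OF continuous_map_fst] by simp
  then have "continuous_map (subtopology (mtop Q) ?B) (prod_topology (mtop M) (mtop (tot \<xi>))) ?k"
    using smooth_map_continuous[OF smooth_f_tinv[OF t]] by (simp add: continuous_map_paired)
  moreover have k: "?k z \<in> edom U" if "z \<in> ?B" for z
    using that ptriv_tinv(1)[OF t] by (cases z) auto
  moreover have "subtopology T (edom U) = subtopology (prod_topology (mtop M) (mtop (tot \<xi>))) (edom U)"
    by (simp add: subtopology_subtopology inf.absorb2 edom_def)
  ultimately have 2: "continuous_map (subtopology (mtop Q) ?B) (subtopology T (edom U)) ?k"
    using B by (auto intro!: continuous_map_into_subtopology)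
  have "homeomorphic_maps (subtopology T (edom U)) (subtopology (mtop Q) ?B) (ptriv \<tau>) ?k"
    unfolding homeomorphic_maps_def
  proof (intro conjI ballI 1 2)
    fix z assume "z \<in> topspace (subtopology T (edom U))"
    then show "?k (ptriv \<tau> z) = z" unfolding dT using tinv_ptriv[OF t, of "fst z" "snd z"] by (simp add: ptriv_def)
  next
    fix w assume "w \<in> topspace (subtopology (mtop Q) ?B)"
    then show "ptriv \<tau> (?k w) = w" unfolding B using ptriv_tinv(2)[OF t] by (cases w) auto
  qed
  then show ?thesis unfolding ptriv_image[OF t] homeomorphic_map_maps by blast
qed

text \<open>The transition from \<tau> to \<sigma> keeps \<open>x\<close> and replaces
  \<open>a\<close> by the \<sigma>-coordinate of the point over \<open>f x\<close> with
  \<tau>-coordinate \<open>a\<close>. This is the transition of \<xi> composed with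
  \<open>f\<close>, hence smooth.\<close>

lemma gluing_charts: "gluing T Q charts"
proof
  show "smooth_atlas Q" by (rule sQ)
  have "z \<in> (\<Union>(X, \<psi>)\<in>charts. X)" if "z \<in> E" for z
  proof -
    obtain U \<tau> where "f (fst z) \<in> U" "triv U \<tau>"
      using triv_exists[OF f_in, of "fst z"] \<open>z \<in> E\<close> by (cases z) (auto simp: mem_E)
    then show ?thesis using \<open>z \<in> E\<close> chartsI by (intro UN_I[of "(edom U, ptriv \<tau>)"]) (auto simp: edom_def)
  qed
  moreover have "z \<in> E" if "(X, \<psi>) \<in> charts" "z \<in> X" for X \<psi> z
    using that by (auto elim!: chartsE simp: edom_def)
  ultimately show "(\<Union>(X, \<psi>)\<in>charts. X) = topspace T"
    unfolding topspace_T by (intro subset_antisym subsetI) auto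
next
  fix X \<psi> assume "(X, \<psi>) \<in> charts"
  then obtain U \<tau> where t: "triv U \<tau>" "X = edom U" "\<psi> = ptriv \<tau>" by (rule chartsE)
  show "openin T X" unfolding t by (rule edom_openin[OF triv_openin[OF t(1)]])
  show "openin (mtop Q) (\<psi> ` X)" unfolding t ptriv_image[OF t(1)]
    by (rule base_carrier_openin[OF triv_openin[OF t(1)]])
  show "homeomorphic_map (subtopology T X) (subtopology (mtop Q) (\<psi> ` X)) \<psi>"
    unfolding t by (rule homeomorphic_map_ptriv[OF t(1)])
next
  fix X \<psi> Y \<theta> assume "(X, \<psi>) \<in> charts" "(Y, \<theta>) \<in> charts"
  then obtain U \<tau> V \<sigma> where t: "triv U \<tau>" "X = edom U" "\<psi> = ptriv \<tau>" and s: "triv V \<sigma>" "Y = edom V" "\<theta> = ptriv \<sigma>"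
    by (metis chartsE)
  let ?W = "base (U \<inter> V) \<times> carrier G"
  have im: "\<psi> ` (X \<inter> Y) = ?W"
  proof (intro subset_antisym subsetI)
    fix w assume "w \<in> \<psi> ` (X \<inter> Y)"
    then obtain z where z: "z \<in> edom U" "z \<in> edom V" "w = ptriv \<tau> z" by (auto simp: t s)
    then show "w \<in> ?W" using ptriv_in[OF t(1) z(1)] by (auto simp: base_def edom_def ptriv_def)
  next
    fix w assume "w \<in> ?W"
    then obtain x a where w: "w = (x, a)" "x \<in> base U" "x \<in> base V" "a \<in> carrier G" by (auto simp: base_def)
    have "(x, tinv U \<tau> (f x, a)) \<in> X \<inter> Y"
      using ptriv_tinv(1)[OF t(1) w(2,4)] w(3) by (auto simp: t s edom_def base_def)
    then show "w \<in> \<psi> ` (X \<inter> Y)" using ptriv_tinv(2)[OF t(1) w(2,4)] by (metis image_eqI t(3) w(1))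
  qed
  have o: "openin (mtop Q) ?W"
    by (intro base_carrier_openin openin_Int triv_openin[OF t(1)] triv_openin[OF s(1)])
  note sR = smooth_atlas_restr[OF sQ o]
  have "smooth_map (restr_mfd Q ?W) (tot \<xi>) (\<lambda>z. tinv U \<tau> (f (fst z), snd z))"
    by (rule smooth_map_restr_mono[OF sQ base_carrier_openin[OF triv_openin[OF t(1)]] smooth_f_tinv[OF t(1)]])
      (auto simp: base_def)
  then have "smooth_map (restr_mfd Q ?W) L (\<lambda>z. snd (\<sigma> (tinv U \<tau> (f (fst z), snd z))))"
    by (rule smooth_snd_triv[OF sR s(1)]) (auto simp: base_def proj_tinv[OF t(1)])
  then have "smooth_map (restr_mfd Q ?W) Q (\<lambda>z. (fst z, snd (\<sigma> (tinv U \<tau> (f (fst z), snd z)))))"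
    by (rule smooth_map_Pair[OF smooth_map_restr[OF sQ smooth_map_fst[OF sM sL]]])
  then show "smooth_map (restr_mfd Q (\<psi> ` (X \<inter> Y))) Q (\<theta> \<circ> inv_into X \<psi>)"
    unfolding im
  proof (rule smooth_map_cong[OF sR])
    fix z assume "z \<in> mspace (restr_mfd Q ?W)"
    then obtain x a where "z = (x, a)" "x \<in> base U" "a \<in> carrier G" by (auto simp: base_def)
    then show "(fst z, snd (\<sigma> (tinv U \<tau> (f (fst z), snd z)))) = (\<theta> \<circ> inv_into X \<psi>) z"
      using inv_ptriv[OF t(1)] by (simp add: t(2,3) s(3) ptriv_def)
  qed
qed

sublocale glue: gluing T Q charts by (rule gluing_charts)

abbreviation "PB \<equiv> pullback_bundle G M N f \<xi>"

text \<open>The atlas written out in \<open>pullback_bundle\<close> is the glued one because the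
  charts of \<open>prod_mfd M L\<close> are by definition the product charts; this makes the gluing
  results available.\<close>

lemma tot_pullback: "tot PB = glue.E"
proof -
  have edom_eq: "{(x, p) \<in> E. f x \<in> U \<and> x \<in> A \<and> snd (\<tau> p) \<in> C} = {z \<in> edom U. ptriv \<tau> z \<in> A \<times> C}" for U A \<tau> C
    by (auto simp: edom_def ptriv_def)
  have map_eq: "(\<lambda>(x, p). (\<alpha> x, \<gamma> (snd (\<tau> p)))) = map_prod \<alpha> \<gamma> \<circ> ptriv \<tau>" for \<alpha> :: "'a \<Rightarrow> 'h" and \<gamma> :: "'g \<Rightarrow> 'k" and \<tau>
    by (auto simp: ptriv_def)
  have "{({(x, p) \<in> E. f x \<in> U \<and> x \<in> A \<and> snd (\<tau> p) \<in> C}, \<lambda>(x, p). (\<alpha> x, \<gamma> (snd (\<tau> p)))) | U \<tau> A \<alpha> C \<gamma>.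
      triv U \<tau> \<and> (A, \<alpha>) \<in> atlas M \<and> (C, \<gamma>) \<in> atlas L}
    = {({z \<in> X. \<psi> z \<in> B}, \<beta> \<circ> \<psi>) | X \<psi> B \<beta>. (X, \<psi>) \<in> charts \<and> (B, \<beta>) \<in> atlas Q}"
    (is "?l = ?r")
  proof (intro subset_antisym subsetI)
    fix c assume "c \<in> ?l"
    then obtain U \<tau> A \<alpha> C \<gamma> where c: "c = ({z \<in> edom U. ptriv \<tau> z \<in> A \<times> C}, map_prod \<alpha> \<gamma> \<circ> ptriv \<tau>)"
      and "triv U \<tau>" "(A, \<alpha>) \<in> atlas M" "(C, \<gamma>) \<in> atlas L"
      unfolding edom_eq map_eq by blast
    then have "(edom U, ptriv \<tau>) \<in> charts" "(A \<times> C, map_prod \<alpha> \<gamma>) \<in> atlas Q"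
      by (auto intro: chartsI prod_chartI)
    then show "c \<in> ?r" unfolding c by blast
  next
    fix c assume "c \<in> ?r"
    then obtain X \<psi> B \<beta> where c: "c = ({z \<in> X. \<psi> z \<in> B}, \<beta> \<circ> \<psi>)" "(X, \<psi>) \<in> charts" "(B, \<beta>) \<in> atlas Q"
      by blast
    obtain U \<tau> where "triv U \<tau>" "X = edom U" "\<psi> = ptriv \<tau>" using c(2) by (rule chartsE)
    moreover obtain A \<alpha> C \<gamma> where "(A, \<alpha>) \<in> atlas M" "(C, \<gamma>) \<in> atlas L" "B = A \<times> C" "\<beta> = map_prod \<alpha> \<gamma>"
      using c(3) by (rule prod_chartE)
    ultimately show "c \<in> ?l" unfolding c(1) edom_eq map_eq by blast
  qed
  then show ?thesis by (simp add: pullback_bundle_def glued_mfd_def)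
qed

lemma proj_pullback [simp]: "bproj PB = fst"
  and ract_pullback [simp]: "ract PB (x, p) a = (x, ract \<xi> p a)"
  by (simp_all add: pullback_bundle_def)

lemma mspace_glue [simp]: "mspace glue.E = E"
  unfolding glue.mtop_glued by (rule topspace_T)

lemma glue_manifold: "smooth_manifold glue.E"
  using M L_manifold tot_manifold
  by (auto simp: smooth_manifold_iff glue.smooth_atlas_glued Hausdorff_space_subtopology Hausdorff_space_prod_topology
      intro!: glue.uniform_dim_glued uniform_dim_prod)

lemma edom_openin_glue: "openin (mtop N) U \<Longrightarrow> openin (mtop glue.E) (edom U)"
  using edom_openin by simp

lemma smooth_fst_pullback: "smooth_map glue.E M fst"
proof (rule smooth_map_local[OF glue.smooth_atlas_glued sM])
  fix z assume "z \<in> mspace glue.E"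
  then have z: "z \<in> E" by simp
  then obtain U \<tau> where t: "f (fst z) \<in> U" "triv U \<tau>"
    using triv_exists[OF f_in, of "fst z"] by (cases z) (auto simp: mem_E)
  note o = edom_openin_glue[OF triv_openin[OF t(2)]]
  have "smooth_map (restr_mfd glue.E (edom U)) M (\<lambda>z. fst (ptriv \<tau> z))"
    by (rule smooth_map_compose[OF smooth_atlas_restr[OF glue.smooth_atlas_glued o] sQ sM
          glue.smooth_map_glue[OF chartsI[OF t(2)]] smooth_map_fst[OF sM sL]])
  then have "smooth_map (restr_mfd glue.E (edom U)) M fst" by (simp add: ptriv_def)
  then show "\<exists>D. openin (mtop glue.E) D \<and> z \<in> D \<and> smooth_map (restr_mfd glue.E D) M fst"
    using o z t(1) by (auto simp: edom_def)
qed

lemma smooth_ptriv_coord: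
  assumes t: "triv U \<tau>"
  shows "smooth_map (restr_mfd glue.E (edom U)) L (\<lambda>z. snd (\<tau> (snd z)))"
  using smooth_map_compose[OF smooth_atlas_restr[OF glue.smooth_atlas_glued edom_openin_glue[OF triv_openin[OF t]]] sQ sL
          glue.smooth_map_glue[OF chartsI[OF t]] smooth_map_snd[OF sM sL]] by (simp add: ptriv_def)

text \<open>The smoothness criterion for maps into the pull-back: over one trivialising set it is
  enough that the base component and the group coordinate are smooth. It serves both for the action
  and for morphisms.\<close>

lemma smooth_into_pullback:
  assumes K: "smooth_atlas K" and t: "triv U \<tau>" and x: "smooth_map K M x" "\<And>w. w \<in> mspace K \<Longrightarrow> f (x w) \<in> U"
    and a: "smooth_map K L a"
  shows "smooth_map K glue.E (\<lambda>w. (x w, tinv U \<tau> (f (x w), a w)))"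
proof -
  have in_base: "x w \<in> base U" "a w \<in> carrier G" if "w \<in> mspace K" for w
    using smooth_map_in[OF x(1) that] x(2)[OF that] smooth_map_in[OF a that] by (auto simp: base_def)
  have "smooth_map K glue.E (\<lambda>w. inv_into (edom U) (ptriv \<tau>) (x w, a w))"
    by (rule smooth_map_compose_restr[OF K sQ glue.smooth_atlas_glued smooth_map_Pair[OF x(1) a]
          glue.smooth_map_glue_inv[OF chartsI[OF t]] glue.open_image[OF chartsI[OF t]]])
      (use in_base ptriv_image[OF t] in auto)
  then show ?thesis
    by (rule smooth_map_cong[OF K]) (simp add: inv_ptriv[OF t in_base])
qed

text \<open>In a trivialisation the action is right multiplication on the group coordinate.\<close>

lemma smooth_ract_pullback: "smooth_map (prod_mfd glue.E L) glue.E (\<lambda>(z, a). ract PB z a)"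
proof (rule smooth_map_local)
  note sE = glue.smooth_atlas_glued
  show sEL: "smooth_atlas (prod_mfd glue.E L)" by (rule smooth_atlas_prod[OF sE sL])
  show "smooth_atlas glue.E" by (rule sE)
  fix w assume "w \<in> mspace (prod_mfd glue.E L)"
  then obtain x p b where w: "w = ((x, p), b)" "(x, p) \<in> E" "b \<in> carrier G" by auto
  then obtain U \<tau> where t: "f x \<in> U" "triv U \<tau>"
    using triv_exists[OF f_in, of x] by (auto simp: mem_E)
  let ?X = "edom U \<times> mspace L"
  let ?R = "restr_mfd (prod_mfd glue.E L) ?X"
  have o: "openin (mtop (prod_mfd glue.E L)) ?X"
    using edom_openin_glue[OF triv_openin[OF t(2)]] by (auto simp: openin_prod_Times_iff simp del: glue.mtop_glued mspace_L)
  note sR = smooth_atlas_restr[OF sEL o]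
  have sX: "smooth_atlas (restr_mfd glue.E (edom U))"
    by (rule smooth_atlas_restr[OF sE edom_openin_glue[OF triv_openin[OF t(2)]]])
  have eq: "?R = prod_mfd (restr_mfd glue.E (edom U)) L"
    by (rule prod_restr_left[OF sL, symmetric])
  have xs: "smooth_map ?R M (\<lambda>w. fst (fst w))"
    by (rule smooth_map_compose[OF sR sE sM smooth_map_restr[OF sEL smooth_map_fst[OF sE sL]] smooth_fst_pullback])
  have "smooth_map ?R L (\<lambda>w. snd (\<tau> (snd (fst w))))"
    unfolding eq by (rule smooth_map_compose[OF smooth_atlas_prod[OF sX sL] sX sL smooth_map_fst[OF sX sL] smooth_ptriv_coord[OF t(2)]])
  moreover have "smooth_map ?R L snd"
    by (rule smooth_map_restr[OF sEL smooth_map_snd[OF sE sL]])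
  ultimately have as: "smooth_map ?R L (\<lambda>w. snd (\<tau> (snd (fst w))) \<otimes>\<^bsub>G\<^esub> snd w)"
    by (rule smooth_mult[OF sR])
  have "smooth_map ?R glue.E
      (\<lambda>w. (fst (fst w), tinv U \<tau> (f (fst (fst w)), snd (\<tau> (snd (fst w))) \<otimes>\<^bsub>G\<^esub> snd w)))"
    by (rule smooth_into_pullback[OF sR t(2) xs _ as]) (auto simp: edom_def)
  then have "smooth_map ?R glue.E (\<lambda>(z, a). ract PB z a)"
  proof (rule smooth_map_cong[OF sR])
    fix v assume "v \<in> mspace ?R"
    then obtain x p a where v: "v = ((x, p), a)" "x \<in> mspace M" "p \<in> P" "\<pi> p = f x" "f x \<in> U" "a \<in> carrier G"
      by (auto simp: edom_def mem_E)
    then show "(fst (fst v), tinv U \<tau> (f (fst (fst v)), snd (\<tau> (snd (fst v))) \<otimes>\<^bsub>G\<^esub> snd v)) = (\<lambda>(z, a). ract PB z a) v"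
      using tinv_ract[OF t(2), of "f x" "snd (\<tau> p)" a] snd_triv_in[OF t(2), of p] tinv_triv[OF t(2), of p] by simp
  qed
  moreover have "w \<in> ?X" using w t by (auto simp: edom_def)
  ultimately show "\<exists>D. openin (mtop (prod_mfd glue.E L)) D \<and> w \<in> D \<and>
      smooth_map (restr_mfd (prod_mfd glue.E L) D) glue.E (\<lambda>(z, a). ract PB z a)" using o by blast
qed

lemma triv_pullback:
  assumes t: "triv U \<tau>"
  shows "local_trivialisation G M PB (base U) (ptriv \<tau>)"
  unfolding local_trivialisation_def
proof (intro conjI ballI impI)
  show "openin (mtop M) (base U)" by (rule base_openin[OF triv_openin[OF t]])
  have edom: "{z \<in> mspace (tot PB). bproj PB z \<in> base U} = edom U"
    by (auto simp: tot_pullback edom_def base_def mem_E)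
  have cod: "prod_mfd (restr_mfd M (base U)) L = restr_mfd Q (ptriv \<tau> ` edom U)"
    using prod_restr_left[OF sL] ptriv_image[OF t] by simp
  have im: "mspace (restr_mfd Q (ptriv \<tau> ` edom U)) = ptriv \<tau> ` edom U"
    unfolding ptriv_image[OF t] by (auto simp: base_def)
  have dE: "mspace (restr_mfd glue.E (edom U)) = edom U" unfolding mspace_restr mspace_glue by (auto simp: edom_def)
  show "diffeomorphism (restr_mfd (tot PB) {z \<in> mspace (tot PB). bproj PB z \<in> base U})
      (prod_mfd (restr_mfd M (base U)) L) (ptriv \<tau>)"
    unfolding edom unfolding cod tot_pullback diffeomorphism_def
  proof (intro conjI exI ballI)
    show "smooth_map (restr_mfd glue.E (edom U)) (restr_mfd Q (ptriv \<tau> ` edom U)) (ptriv \<tau>)"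
      by (rule smooth_map_into_restr[OF glue.smooth_map_glue[OF chartsI[OF t]]]) (use dE in auto)
    show "smooth_map (restr_mfd Q (ptriv \<tau> ` edom U)) (restr_mfd glue.E (edom U)) (inv_into (edom U) (ptriv \<tau>))"
      by (rule smooth_map_into_restr[OF glue.smooth_map_glue_inv[OF chartsI[OF t]]])
        (use im in \<open>auto intro: inv_into_into\<close>)
    show "inv_into (edom U) (ptriv \<tau>) (ptriv \<tau> z) = z" if "z \<in> mspace (restr_mfd glue.E (edom U))" for z
      using that ptriv_inj_on[OF t] unfolding dE by simp
    show "ptriv \<tau> (inv_into (edom U) (ptriv \<tau>) w) = w" if "w \<in> mspace (restr_mfd Q (ptriv \<tau> ` edom U))" for w
      using that unfolding im by (rule f_inv_into_f)
  qed
  fix z assume "z \<in> mspace (tot PB)" and b: "bproj PB z \<in> base U"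
  then obtain x p where z: "z = (x, p)" "p \<in> P" "\<pi> p = f x" by (cases z) (auto simp: tot_pullback mem_E)
  show "fst (ptriv \<tau> z) = bproj PB z" by (simp add: ptriv_def)
  show "snd (ptriv \<tau> (ract PB z a)) = snd (ptriv \<tau> z) \<otimes>\<^bsub>G\<^esub> a" if "a \<in> carrier G" for a
    using z b that snd_triv_ract[OF t z(2) _ that] by (simp add: ptriv_def base_def)
qed

text \<open>Part of the final claim, since \<open>pb_morphism\<close> demands that its source and
  its target be principal bundles.\<close>

lemma principal_pullback: "principal_bundle G M PB"
  unfolding principal_bundle_def
proof (intro conjI)
  show "lie_group G" "smooth_manifold M" by (rule lie M)+
  show "smooth_manifold (tot PB)" unfolding tot_pullback by (rule glue_manifold)
  show "smooth_map (tot PB) M (bproj PB)" by (simp add: tot_pullback smooth_fst_pullback)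
  show "smooth_map (prod_mfd (tot PB) L) (tot PB) (\<lambda>(p, a). ract PB p a)"
    unfolding tot_pullback by (rule smooth_ract_pullback)
  show "\<forall>z\<in>mspace (tot PB). ract PB z \<one>\<^bsub>G\<^esub> = z \<and> (\<forall>a\<in>carrier G. bproj PB (ract PB z a) = bproj PB z \<and>
      (\<forall>b\<in>carrier G. ract PB (ract PB z a) b = ract PB z (a \<otimes>\<^bsub>G\<^esub> b)))"
    unfolding tot_pullback mspace_glue by (auto simp: mem_E ract_one ract_ract)
  show "\<forall>x\<in>mspace M. \<exists>U \<tau>. x \<in> U \<and> local_trivialisation G M PB U \<tau>"
  proof
    fix x assume x: "x \<in> mspace M"
    then obtain U \<tau> where "f x \<in> U" "triv U \<tau>" using triv_exists[OF f_in] by blast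
    then show "\<exists>U \<tau>. x \<in> U \<and> local_trivialisation G M PB U \<tau>"
      using triv_pullback x by (intro exI[of _ "base U"] exI[of _ "ptriv \<tau>"]) (simp add: base_def)
  qed
qed

end


section \<open>Gauge maps\<close>

locale bundle_over = principal_fibre_bundle G N \<xi>
  for G :: "('g, 'k::euclidean_space) lie_struct" and N :: "('b, 'f::euclidean_space) mfd"
    and \<xi> :: "('p, 'e::euclidean_space, 'b, 'g) pbundle" +
  fixes M :: "('a, 'h::euclidean_space) mfd"
  assumes M: "smooth_manifold M"
begin

lemmas sM = smooth_manifold_imp_smooth_atlas[OF M]

text \<open>\<open>\<theta> x\<close> maps the fibre of \<open>\<xi>\<close> over \<open>f x\<close> to the fibre over \<open>g x\<close>; in suitable local trivialisations
  it is left multiplication by a smooth function \<open>c\<close>. This makes sense without charts on the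
  total spaces of the pull-backs.\<close>

definition gauge_rep where
  "gauge_rep f g \<theta> D U \<tau> V \<sigma> c \<longleftrightarrow>
     openin (mtop M) D \<and> triv U \<tau> \<and> triv V \<sigma> \<and> (\<forall>x\<in>D. f x \<in> U \<and> g x \<in> V) \<and>
     smooth_map (restr_mfd M D) L c \<and>
     (\<forall>x\<in>D. \<forall>p\<in>P. \<pi> p = f x \<longrightarrow> \<theta> x p = tinv V \<sigma> (g x, c x \<otimes>\<^bsub>G\<^esub> snd (\<tau> p)))"

definition gauge :: "('a \<Rightarrow> 'b) \<Rightarrow> ('a \<Rightarrow> 'b) \<Rightarrow> ('a \<Rightarrow> 'p \<Rightarrow> 'p) \<Rightarrow> bool" where
  "gauge f g \<theta> \<longleftrightarrow> (\<forall>x\<in>mspace M. \<exists>D U \<tau> V \<sigma> c. x \<in> D \<and> gauge_rep f g \<theta> D U \<tau> V \<sigma> c)"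

lemma gaugeE:
  assumes "gauge f g \<theta>" "x \<in> mspace M"
  obtains D U \<tau> V \<sigma> c where "x \<in> D" "gauge_rep f g \<theta> D U \<tau> V \<sigma> c"
  using assms(1)[unfolded gauge_def, rule_format, OF assms(2)] that by (elim exE conjE)

lemma gauge_repD:
  assumes "gauge_rep f g \<theta> D U \<tau> V \<sigma> c"
  shows "openin (mtop M) D" "triv U \<tau>" "triv V \<sigma>" "\<And>x. x \<in> D \<Longrightarrow> f x \<in> U" "\<And>x. x \<in> D \<Longrightarrow> g x \<in> V"
    "smooth_map (restr_mfd M D) L c"
    "\<And>x p. x \<in> D \<Longrightarrow> p \<in> P \<Longrightarrow> \<pi> p = f x \<Longrightarrow> \<theta> x p = tinv V \<sigma> (g x, c x \<otimes>\<^bsub>G\<^esub> snd (\<tau> p))"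
    "\<And>x. x \<in> D \<Longrightarrow> x \<in> mspace M" "\<And>x. x \<in> D \<Longrightarrow> c x \<in> carrier G"
proof -
  show o: "openin (mtop M) D" and c: "smooth_map (restr_mfd M D) L c"
    using assms by (simp_all add: gauge_rep_def)
  show "x \<in> mspace M" if "x \<in> D" for x using openin_subset[OF o] that by blast
  then show "c x \<in> carrier G" if "x \<in> D" for x using smooth_map_in[OF c, of x] that by simp
qed (use assms in \<open>simp_all add: gauge_rep_def\<close>)

lemma gauge_rep_fibre:
  assumes r: "gauge_rep f g \<theta> D U \<tau> V \<sigma> c" and x: "x \<in> D" and p: "p \<in> P" "\<pi> p = f x"
  shows "\<theta> x p \<in> P" "\<pi> (\<theta> x p) = g x" "snd (\<sigma> (\<theta> x p)) = c x \<otimes>\<^bsub>G\<^esub> snd (\<tau> p)"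
proof -
  note r = gauge_repD[OF r]
  have "snd (\<tau> p) \<in> carrier G" using snd_triv_in[OF r(2) p(1)] r(4)[OF x] p(2) by simp
  then have "c x \<otimes>\<^bsub>G\<^esub> snd (\<tau> p) \<in> carrier G" using r(9)[OF x] by simp
  from tinv[OF r(3) r(5)[OF x] this] r(7)[OF x p]
  show "\<theta> x p \<in> P" "\<pi> (\<theta> x p) = g x" "snd (\<sigma> (\<theta> x p)) = c x \<otimes>\<^bsub>G\<^esub> snd (\<tau> p)" by simp_all
qed

lemma gauge_fibre:
  assumes "gauge f g \<theta>" "x \<in> mspace M" "p \<in> P" "\<pi> p = f x"
  shows "\<theta> x p \<in> P" "\<pi> (\<theta> x p) = g x"
proof -
  obtain D U \<tau> V \<sigma> c where "x \<in> D" "gauge_rep f g \<theta> D U \<tau> V \<sigma> c" by (rule gaugeE[OF assms(1,2)])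
  from gauge_rep_fibre(1,2)[OF this(2,1) assms(3,4)] show "\<theta> x p \<in> P" "\<pi> (\<theta> x p) = g x" .
qed

text \<open>Left multiplication by \<open>c x\<close> commutes with right multiplication by
  \<open>a\<close>; this is associativity in \<open>G\<close>.\<close>

lemma gauge_ract:
  assumes g: "gauge f g \<theta>" and x: "x \<in> mspace M" and p: "p \<in> P" "\<pi> p = f x" and a: "a \<in> carrier G"
  shows "\<theta> x (ract \<xi> p a) = ract \<xi> (\<theta> x p) a"
proof -
  obtain D U \<tau> V \<sigma> c where xD: "x \<in> D" and r: "gauge_rep f g \<theta> D U \<tau> V \<sigma> c" by (rule gaugeE[OF g x])
  note r = gauge_repD[OF r]
  have pU: "\<pi> p \<in> U" using r(4)[OF xD] p(2) by simp
  note s = snd_triv_in[OF r(2) p(1) pU]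
  have "\<theta> x (ract \<xi> p a) = tinv V \<sigma> (g x, c x \<otimes>\<^bsub>G\<^esub> (snd (\<tau> p) \<otimes>\<^bsub>G\<^esub> a))"
    using r(7)[OF xD ract_in[OF p(1) a]] p a pU by (simp add: proj_ract snd_triv_ract[OF r(2)])
  also have "\<dots> = tinv V \<sigma> (g x, (c x \<otimes>\<^bsub>G\<^esub> snd (\<tau> p)) \<otimes>\<^bsub>G\<^esub> a)"
    using r(9)[OF xD] s a by (simp add: m_assoc)
  also have "\<dots> = ract \<xi> (\<theta> x p) a"
    using tinv_ract[OF r(3) r(5)[OF xD] _ a] r(9)[OF xD] s r(7)[OF xD p] by simp
  finally show ?thesis .
qed

lemma gauge_rep_subset:
  assumes r: "gauge_rep f g \<theta> D U \<tau> V \<sigma> c" and D': "openin (mtop M) D'" "D' \<subseteq> D"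
    and eq: "\<And>x. x \<in> D' \<Longrightarrow> f' x = f x" "\<And>x. x \<in> D' \<Longrightarrow> g' x = g x"
      "\<And>x p. x \<in> D' \<Longrightarrow> p \<in> P \<Longrightarrow> \<pi> p = f x \<Longrightarrow> \<theta>' x p = \<theta> x p"
  shows "gauge_rep f' g' \<theta>' D' U \<tau> V \<sigma> c"
  unfolding gauge_rep_def
proof (intro conjI ballI impI)
  note r' = gauge_repD[OF r]
  show "smooth_map (restr_mfd M D') L c" by (rule smooth_map_restr_mono[OF sM r'(1,6) D'(2)])
  show "openin (mtop M) D'" "triv U \<tau>" "triv V \<sigma>" by (rule D'(1) r')+
  fix x assume x: "x \<in> D'"
  then have xD: "x \<in> D" using D'(2) by blast
  show "f' x \<in> U" "g' x \<in> V" using r'(4,5)[OF xD] eq(1,2)[OF x] by simp_all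
  show "\<theta>' x p = tinv V \<sigma> (g' x, c x \<otimes>\<^bsub>G\<^esub> snd (\<tau> p))" if "p \<in> P" "\<pi> p = f' x" for p
    using r'(7)[OF xD that(1)] that eq[OF x] by simp
qed

text \<open>Only the values on the fibres over \<open>f\<close> near each point matter. This turns
  constructions that are finite near every point, though infinite globally, into gauges.\<close>

lemma gauge_local:
  assumes "\<And>x. x \<in> mspace M \<Longrightarrow> \<exists>D f' g' \<theta>'. openin (mtop M) D \<and> x \<in> D \<and> gauge f' g' \<theta>' \<and>
    (\<forall>y\<in>D. f y = f' y \<and> g y = g' y \<and> (\<forall>p\<in>P. \<pi> p = f y \<longrightarrow> \<theta> y p = \<theta>' y p))"
  shows "gauge f g \<theta>"
  unfolding gauge_def
proof
  fix x assume x: "x \<in> mspace M"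
  from assms[OF this] obtain D f' g' \<theta>' where D: "openin (mtop M) D" "x \<in> D" "gauge f' g' \<theta>'"
    "\<forall>y\<in>D. f y = f' y \<and> g y = g' y \<and> (\<forall>p\<in>P. \<pi> p = f y \<longrightarrow> \<theta> y p = \<theta>' y p)" by blast
  obtain D' U \<tau> V \<sigma> c where r: "x \<in> D'" "gauge_rep f' g' \<theta>' D' U \<tau> V \<sigma> c" by (rule gaugeE[OF D(3) x])
  have "gauge_rep f g \<theta> (D \<inter> D') U \<tau> V \<sigma> c"
    by (rule gauge_rep_subset[OF r(2)]) (use D gauge_repD(1)[OF r(2)] in auto)
  then show "\<exists>D U \<tau> V \<sigma> c. x \<in> D \<and> gauge_rep f g \<theta> D U \<tau> V \<sigma> c" using D(2) r(1) by blast
qed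

lemma preimage_openin:
  "smooth_map M K f \<Longrightarrow> openin (mtop K) U \<Longrightarrow> openin (mtop M) {x \<in> mspace M. f x \<in> U}"
  by (rule openin_continuous_map_preimage[OF smooth_map_continuous])

text \<open>The shape of an elementary step. Where the point moves inside \<open>U\<close> it keeps
  its group coordinate, so \<open>c\<close> is constant 1. Where nothing moves, \<open>f\<close> may
  lie outside \<open>U\<close>; there any trivialisation around \<open>f x\<close> is used, again
  with \<open>c\<close> constant 1.\<close>

lemma gauge_stepI:
  assumes f: "smooth_map M N f" and t: "triv U \<tau>"
    and loc: "\<And>x. x \<in> mspace M \<Longrightarrow> \<exists>D. openin (mtop M) D \<and> x \<in> D \<and>
      ((\<forall>y\<in>D. f y \<in> U \<and> g y \<in> U \<and> (\<forall>p\<in>P. \<pi> p = f y \<longrightarrow> \<theta> y p = tinv U \<tau> (g y, snd (\<tau> p)))) \<or>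
       (\<forall>y\<in>D. f y = g y \<and> (\<forall>p\<in>P. \<pi> p = f y \<longrightarrow> \<theta> y p = p)))"
  shows "gauge f g \<theta>"
  unfolding gauge_def
proof
  fix x assume x: "x \<in> mspace M"
  from loc[OF this] obtain D where D: "openin (mtop M) D" "x \<in> D" and
    c: "(\<forall>y\<in>D. f y \<in> U \<and> g y \<in> U \<and> (\<forall>p\<in>P. \<pi> p = f y \<longrightarrow> \<theta> y p = tinv U \<tau> (g y, snd (\<tau> p)))) \<or>
       (\<forall>y\<in>D. f y = g y \<and> (\<forall>p\<in>P. \<pi> p = f y \<longrightarrow> \<theta> y p = p))" by blast
  have one: "smooth_map (restr_mfd M D') L (\<lambda>x. \<one>\<^bsub>G\<^esub>)" for D'
    by (rule smooth_map_const) simp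
  from c show "\<exists>D U \<tau> V \<sigma> c. x \<in> D \<and> gauge_rep f g \<theta> D U \<tau> V \<sigma> c"
  proof
    assume a: "\<forall>y\<in>D. f y \<in> U \<and> g y \<in> U \<and> (\<forall>p\<in>P. \<pi> p = f y \<longrightarrow> \<theta> y p = tinv U \<tau> (g y, snd (\<tau> p)))"
    have "gauge_rep f g \<theta> D U \<tau> U \<tau> (\<lambda>x. \<one>\<^bsub>G\<^esub>)"
      unfolding gauge_rep_def using a t D one snd_triv_in[OF t] by (auto simp: l_one)
    then show ?thesis using D(2) by blast
  next
    assume a: "\<forall>y\<in>D. f y = g y \<and> (\<forall>p\<in>P. \<pi> p = f y \<longrightarrow> \<theta> y p = p)"
    obtain V \<sigma> where s: "f x \<in> V" "triv V \<sigma>" using triv_exists[OF smooth_map_in[OF f x]] by blast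
    let ?D = "D \<inter> {x \<in> mspace M. f x \<in> V}"
    have "openin (mtop M) ?D" using D(1) preimage_openin[OF f triv_openin[OF s(2)]] by (rule openin_Int)
    then have "gauge_rep f g \<theta> ?D V \<sigma> V \<sigma> (\<lambda>x. \<one>\<^bsub>G\<^esub>)"
      unfolding gauge_rep_def using a s one snd_triv_in[OF s(2)] tinv_unique[OF s(2), symmetric] by (auto simp: l_one)
    moreover have "x \<in> ?D" using D(2) x s(1) by simp
    ultimately show ?thesis by (intro exI conjI)
  qed
qed

lemma gauge_id: "smooth_map M N f \<Longrightarrow> gauge f f (\<lambda>x p. p)"
proof -
  assume f: "smooth_map M N f"
  show ?thesis
  proof (cases "mspace M = {}")
    case False
    then obtain U \<tau> where "triv U \<tau>" using triv_exists smooth_map_in[OF f] by blast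
    from gauge_stepI[OF f this] show ?thesis by (metis openin_topspace)
  qed (simp add: gauge_def)
qed

lemma gauge_compose:
  assumes fg: "gauge f g \<theta>" and gh: "gauge g h \<eta>" and g: "smooth_map M N g"
  shows "gauge f h (\<lambda>x p. \<eta> x (\<theta> x p))"
  unfolding gauge_def
proof
  fix x assume x: "x \<in> mspace M"
  obtain D1 U \<tau> V \<sigma> c where x1: "x \<in> D1" and rep1: "gauge_rep f g \<theta> D1 U \<tau> V \<sigma> c" by (rule gaugeE[OF fg x])
  obtain D2 V' \<sigma>' W \<rho> d where x2: "x \<in> D2" and rep2: "gauge_rep g h \<eta> D2 V' \<sigma>' W \<rho> d" by (rule gaugeE[OF gh x])
  note r1 = gauge_repD[OF rep1] and r2 = gauge_repD[OF rep2]
  let ?D = "D1 \<inter> D2"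
  have D: "openin (mtop M) ?D" using r1(1) r2(1) by (rule openin_Int)
  note sD = smooth_atlas_restr[OF sM D]
  \<comment> \<open>The two gauges may use different trivialisations over \<open>g x\<close>.
    \<open>?t\<close> is the transition function from \<sigma> to \<sigma>', read off at the point
    whose \<sigma>-coordinate is the unit; it is smooth in \<open>x\<close> because \<open>g\<close>
    is.\<close>
  let ?t = "\<lambda>x. snd (\<sigma>' (tinv V \<sigma> (g x, \<one>\<^bsub>G\<^esub>)))"
  let ?c = "\<lambda>x. d x \<otimes>\<^bsub>G\<^esub> (?t x \<otimes>\<^bsub>G\<^esub> c x)"
  have "smooth_map (restr_mfd M ?D) (tot \<xi>) (\<lambda>x. tinv V \<sigma> (g x, \<one>\<^bsub>G\<^esub>))"
    by (rule smooth_tinv[OF sD r1(3) smooth_map_restr[OF sM g]]) (auto simp: r1 intro: smooth_map_const)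
  then have "smooth_map (restr_mfd M ?D) L ?t"
    by (rule smooth_snd_triv[OF sD r2(2)]) (auto simp: proj_tinv[OF r1(3)] r1 r2)
  then have sc: "smooth_map (restr_mfd M ?D) L ?c"
    by (intro smooth_mult[OF sD] smooth_map_restr_mono[OF sM r1(1,6)] smooth_map_restr_mono[OF sM r2(1,6)]) auto
  have "gauge_rep f h (\<lambda>x p. \<eta> x (\<theta> x p)) ?D U \<tau> W \<rho> ?c"
    unfolding gauge_rep_def
  proof (intro conjI ballI impI D sc r1(2) r2(3))
    fix y assume "y \<in> ?D"
    then have y: "y \<in> D1" "y \<in> D2" by auto
    show "f y \<in> U" "h y \<in> W" by (rule r1(4)[OF y(1)], rule r2(5)[OF y(2)])
    fix p assume p: "p \<in> P" "\<pi> p = f y"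
    let ?s = "snd (\<tau> p)" and ?o = "tinv V \<sigma> (g y, \<one>\<^bsub>G\<^esub>)"
    have s: "?s \<in> carrier G" using snd_triv_in[OF r1(2) p(1)] r1(4)[OF y(1)] p(2) by simp
    have cs: "c y \<otimes>\<^bsub>G\<^esub> ?s \<in> carrier G" using r1(9)[OF y(1)] s by simp
    note o = tinv[OF r1(3) r1(5)[OF y(1)] one_closed]
    \<comment> \<open>Writing the point as a translate of \<open>?o\<close> lets the equivariance of
      \<sigma>' compute its coordinate.\<close>
    have "\<theta> y p = ract \<xi> ?o (c y \<otimes>\<^bsub>G\<^esub> ?s)"
      using r1(7)[OF y(1) p] tinv_ract[OF r1(3) r1(5)[OF y(1)] one_closed cs] cs by simp
    then have t: "snd (\<sigma>' (\<theta> y p)) = ?t y \<otimes>\<^bsub>G\<^esub> (c y \<otimes>\<^bsub>G\<^esub> ?s)"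
      using snd_triv_ract[OF r2(2) o(2) _ cs] o(3) r2(4)[OF y(2)] by simp
    have ty: "?t y \<in> carrier G" using snd_triv_in[OF r2(2) o(2)] o(3) r2(4)[OF y(2)] by simp
    have "\<eta> y (\<theta> y p) = tinv W \<rho> (h y, d y \<otimes>\<^bsub>G\<^esub> snd (\<sigma>' (\<theta> y p)))"
      by (rule r2(7)[OF y(2) gauge_rep_fibre(1,2)[OF rep1 y(1) p]])
    then show "\<eta> y (\<theta> y p) = tinv W \<rho> (h y, ?c y \<otimes>\<^bsub>G\<^esub> ?s)"
      using t ty s r1(9)[OF y(1)] r2(9)[OF y(2)] by (simp add: m_assoc)
  qed
  then show "\<exists>D U \<tau> V \<sigma> c. x \<in> D \<and> gauge_rep f h (\<lambda>x p. \<eta> x (\<theta> x p)) D U \<tau> V \<sigma> c" using x1 x2 by blast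
qed

lemma gauge_inverse:
  assumes fg: "gauge f g \<theta>"
  obtains \<eta> where "gauge g f \<eta>"
    "\<And>x p. x \<in> mspace M \<Longrightarrow> p \<in> P \<Longrightarrow> \<pi> p = f x \<Longrightarrow> \<eta> x (\<theta> x p) = p"
    "\<And>x q. x \<in> mspace M \<Longrightarrow> q \<in> P \<Longrightarrow> \<pi> q = g x \<Longrightarrow> \<theta> x (\<eta> x q) = q"
proof
  \<comment> \<open>Defined without reference to a trivialisation, so that the local formulas given
    by \<open>key\<close>, in which \<open>c x\<close> is inverted, automatically agree on
    overlaps.\<close>
  define \<eta> where "\<eta> = (\<lambda>x q. THE p. p \<in> P \<and> \<pi> p = f x \<and> \<theta> x p = q)"
  have key: "\<eta> x q = tinv U \<tau> (f x, inv\<^bsub>G\<^esub> (c x) \<otimes>\<^bsub>G\<^esub> snd (\<sigma> q)) \<and> \<eta> x q \<in> P \<and> \<pi> (\<eta> x q) = f x \<and> \<theta> x (\<eta> x q) = q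
      \<and> (\<forall>p\<in>P. \<pi> p = f x \<longrightarrow> \<theta> x p = q \<longrightarrow> \<eta> x q = p)"
    if rep: "gauge_rep f g \<theta> D U \<tau> V \<sigma> c" and x: "x \<in> D" and q: "q \<in> P" "\<pi> q = g x" for D U \<tau> V \<sigma> c x q
  proof -
    note r = gauge_repD[OF rep]
    have c: "c x \<in> carrier G" and s: "snd (\<sigma> q) \<in> carrier G"
      using r(9)[OF x] snd_triv_in[OF r(3) q(1)] r(5)[OF x] q(2) by simp_all
    let ?b = "inv\<^bsub>G\<^esub> (c x) \<otimes>\<^bsub>G\<^esub> snd (\<sigma> q)" and ?p = "tinv U \<tau> (f x, inv\<^bsub>G\<^esub> (c x) \<otimes>\<^bsub>G\<^esub> snd (\<sigma> q))"
    have b: "?b \<in> carrier G" using c s by simp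
    note p = tinv[OF r(2) r(4)[OF x] b]
    have "\<theta> x ?p = tinv V \<sigma> (g x, snd (\<sigma> q))"
      using r(7)[OF x p(2,3)] p(1) c s by (simp add: m_assoc[symmetric])
    then have 1: "\<theta> x ?p = q" using tinv_unique[OF r(3) q] r(5)[OF x] by simp
    have 2: "p' = ?p" if p': "p' \<in> P" "\<pi> p' = f x" "\<theta> x p' = q" for p'
    proof -
      have s': "snd (\<tau> p') \<in> carrier G" using snd_triv_in[OF r(2) p'(1)] r(4)[OF x] p'(2) by simp
      have "snd (\<sigma> q) = c x \<otimes>\<^bsub>G\<^esub> snd (\<tau> p')" using gauge_rep_fibre(3)[OF rep x p'(1,2)] p'(3) by simp
      then have "snd (\<tau> p') = ?b" using c s s' by (simp add: inv_solve_left)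
      then show ?thesis using tinv_unique[OF r(2) p'(1,2)] r(4)[OF x] by simp
    qed
    have e: "\<eta> x q = ?p" unfolding \<eta>_def
    proof (rule the_equality)
      show "?p \<in> P \<and> \<pi> ?p = f x \<and> \<theta> x ?p = q" using p(2,3) 1 by (intro conjI)
      show "p' = ?p" if "p' \<in> P \<and> \<pi> p' = f x \<and> \<theta> x p' = q" for p'
        using that by (intro 2) simp_all
    qed
    show ?thesis unfolding e using p(2,3) 1 2[symmetric] by (intro conjI refl ballI impI)
  qed
  show "gauge g f \<eta>" unfolding gauge_def
  proof
    fix x assume x: "x \<in> mspace M"
    obtain D U \<tau> V \<sigma> c where xD: "x \<in> D" and rep: "gauge_rep f g \<theta> D U \<tau> V \<sigma> c" by (rule gaugeE[OF fg x])
    note r = gauge_repD[OF rep]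
    have "gauge_rep g f \<eta> D V \<sigma> U \<tau> (\<lambda>x. inv\<^bsub>G\<^esub> (c x))"
      unfolding gauge_rep_def
      using r(1-5) smooth_inv[OF smooth_atlas_restr[OF sM r(1)] r(6)] key[OF rep] by blast
    then show "\<exists>D U \<tau> V \<sigma> c. x \<in> D \<and> gauge_rep g f \<eta> D U \<tau> V \<sigma> c" using xD by blast
  qed
  fix x assume x: "x \<in> mspace M"
  obtain D U \<tau> V \<sigma> c where xD: "x \<in> D" and rep: "gauge_rep f g \<theta> D U \<tau> V \<sigma> c" by (rule gaugeE[OF fg x])
  show "\<eta> x (\<theta> x p) = p" if "p \<in> P" "\<pi> p = f x" for p
    using key[OF rep xD gauge_rep_fibre(1,2)[OF rep xD that]] that by blast
  show "\<theta> x (\<eta> x q) = q" if "q \<in> P" "\<pi> q = g x" for q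
    using key[OF rep xD that] by blast
qed

section \<open>From gauges to isomorphisms of the pull-backs\<close>

lemma gauge_morphism:
  assumes f: "smooth_map M N f" and g: "smooth_map M N g" and \<theta>: "gauge f g \<theta>"
  shows "pb_morphism G M (pullback_bundle G M N f \<xi>) (pullback_bundle G M N g \<xi>) (\<lambda>z. (fst z, \<theta> (fst z) (snd z)))"
proof -
  interpret f: pullback G N \<xi> M f by unfold_locales (rule M f)+
  interpret g: pullback G N \<xi> M g by unfold_locales (rule M g)+
  let ?\<Phi> = "\<lambda>z. (fst z, \<theta> (fst z) (snd z))"
  note sf = f.glue.smooth_atlas_glued and sg = g.glue.smooth_atlas_glued
  have "smooth_map f.glue.E g.glue.E ?\<Phi>"
  proof (rule smooth_map_local[OF sf sg])
    fix z assume "z \<in> mspace f.glue.E"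
    then have z: "z \<in> f.E" unfolding f.mspace_glue .
    then have z1: "fst z \<in> mspace M" by (cases z) (simp add: f.mem_E)
    obtain D U \<tau> V \<sigma> c where xD: "fst z \<in> D" and rep: "gauge_rep f g \<theta> D U \<tau> V \<sigma> c" by (rule gaugeE[OF \<theta> z1])
    note r = gauge_repD[OF rep]
    let ?X = "{z \<in> mspace f.glue.E. fst z \<in> D}"
    let ?R = "restr_mfd f.glue.E ?X"
    have X: "openin (mtop f.glue.E) ?X"
      by (rule openin_continuous_map_preimage[OF smooth_map_continuous[OF f.smooth_fst_pullback] r(1)])
    note sX = smooth_atlas_restr[OF sf X]
    have XU: "?X \<subseteq> f.edom U" using r(4) unfolding f.mspace_glue by (auto simp: f.edom_def)
    have fst: "smooth_map ?R M fst" by (rule smooth_map_restr[OF sf f.smooth_fst_pullback])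
    have "smooth_map ?R L (\<lambda>z. c (fst z))"
      by (rule smooth_map_compose_restr[OF sX sM sL fst r(6) r(1)]) simp
    moreover have "smooth_map ?R L (\<lambda>z. snd (\<tau> (snd z)))"
      by (rule smooth_map_restr_mono[OF sf f.edom_openin_glue[OF triv_openin[OF r(2)]] f.smooth_ptriv_coord[OF r(2)] XU])
    ultimately have a: "smooth_map ?R L (\<lambda>z. c (fst z) \<otimes>\<^bsub>G\<^esub> snd (\<tau> (snd z)))"
      by (rule smooth_mult[OF sX])
    \<comment> \<open>In group coordinates the map multiplies from the left by \<open>c\<close>,
      evaluated at the base point.\<close>
    have "smooth_map ?R g.glue.E
        (\<lambda>z. (fst z, tinv V \<sigma> (g (fst z), c (fst z) \<otimes>\<^bsub>G\<^esub> snd (\<tau> (snd z)))))"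
      by (rule g.smooth_into_pullback[OF sX r(3) fst _ a]) (auto simp: r(5))
    then have "smooth_map ?R g.glue.E ?\<Phi>"
    proof (rule smooth_map_cong[OF sX])
      fix w assume "w \<in> mspace ?R"
      then have "w \<in> f.E" "fst w \<in> D" by (simp_all only: mspace_restr f.mspace_glue) auto
      then have "fst w \<in> D" "snd w \<in> P" "\<pi> (snd w) = f (fst w)" by (cases w; simp add: f.mem_E)+
      from r(7)[OF this] show "(fst w, tinv V \<sigma> (g (fst w), c (fst w) \<otimes>\<^bsub>G\<^esub> snd (\<tau> (snd w)))) = ?\<Phi> w" by simp
    qed
    moreover have "z \<in> ?X" using z xD unfolding f.mspace_glue by simp
    ultimately show "\<exists>D. openin (mtop f.glue.E) D \<and> z \<in> D \<and> smooth_map (restr_mfd f.glue.E D) g.glue.E ?\<Phi>"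
      using X by blast
  qed
  moreover have "\<theta> x (ract \<xi> p a) = ract \<xi> (\<theta> x p) a" if "(x, p) \<in> f.E" "a \<in> carrier G" for x p a
    using that gauge_ract[OF \<theta>] by (simp add: f.mem_E)
  ultimately show ?thesis
    unfolding pb_morphism_def f.tot_pullback g.tot_pullback f.mspace_glue
    using f.principal_pullback g.principal_pullback by auto
qed

lemma gauge_isomorphism:
  assumes f: "smooth_map M N f" and g: "smooth_map M N g" and \<theta>: "gauge f g \<theta>"
  shows "\<exists>\<Phi>. pb_isomorphism G M (pullback_bundle G M N f \<xi>) (pullback_bundle G M N g \<xi>) \<Phi>"
proof -
  interpret f: pullback G N \<xi> M f by unfold_locales (rule M f)+
  interpret g: pullback G N \<xi> M g by unfold_locales (rule M g)+
  obtain \<eta> where \<eta>: "gauge g f \<eta>"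
    "\<And>x p. x \<in> mspace M \<Longrightarrow> p \<in> P \<Longrightarrow> \<pi> p = f x \<Longrightarrow> \<eta> x (\<theta> x p) = p"
    "\<And>x q. x \<in> mspace M \<Longrightarrow> q \<in> P \<Longrightarrow> \<pi> q = g x \<Longrightarrow> \<theta> x (\<eta> x q) = q"
    using gauge_inverse[OF \<theta>] by metis
  have "pb_isomorphism G M f.PB g.PB (\<lambda>z. (fst z, \<theta> (fst z) (snd z)))"
    unfolding pb_isomorphism_def
  proof (intro conjI exI)
    show "pb_morphism G M f.PB g.PB (\<lambda>z. (fst z, \<theta> (fst z) (snd z)))" by (rule gauge_morphism[OF f g \<theta>])
    show "pb_morphism G M g.PB f.PB (\<lambda>z. (fst z, \<eta> (fst z) (snd z)))" by (rule gauge_morphism[OF g f \<eta>(1)])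
  qed (unfold f.tot_pullback g.tot_pullback f.mspace_glue g.mspace_glue,
      auto simp: f.mem_E g.mem_E \<eta>(2,3))
  then show ?thesis by blast
qed

end


section \<open>Weights with a uniform threshold\<close>

text \<open>Dividing a partition of unity \<open>\<rho>\<close> by \<open>\<Sum> \<rho>\<^sup>2 \<le> max \<rho>\<close> gives functions \<open>q\<close>, at every point
  one of which is at least 1, however many of the \<open>\<rho>\<close> are nonzero there. So weights can be
  cut off at a threshold for \<open>q\<close> that does not depend on the point.\<close>

lemma paracompact_weights:
  fixes N :: "('b, 'f::euclidean_space) mfd"
  assumes N: "smooth_atlas N" and "paracompact_manifold N"
    and \<U>: "\<And>U. U \<in> \<U> \<Longrightarrow> openin (mtop N) U" "\<Union>\<U> = mspace N"
  obtains q w :: "'b set \<Rightarrow> 'b \<Rightarrow> real" where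
    "\<And>U. U \<in> \<U> \<Longrightarrow> smooth_map N real_mfd (q U)" "\<And>U. U \<in> \<U> \<Longrightarrow> smooth_map N real_mfd (w U)"
    "\<And>U y. U \<in> \<U> \<Longrightarrow> y \<in> mspace N \<Longrightarrow> q U y \<noteq> 0 \<Longrightarrow> y \<in> U"
    "\<And>U y. U \<in> \<U> \<Longrightarrow> y \<in> mspace N \<Longrightarrow> 0 \<le> w U y"
    "\<And>U y. q U y \<le> 1/2 \<Longrightarrow> w U y = 0"
    "\<And>y. y \<in> mspace N \<Longrightarrow> locally_finite_near (mtop N) \<U> q y"
    "\<And>y. y \<in> mspace N \<Longrightarrow> (\<Sum>U\<in>{U\<in>\<U>. w U y \<noteq> 0}. w U y) = 1"
proof -
  have "(\<forall>U\<in>\<U>. openin (mtop N) U) \<and> \<Union>\<U> = mspace N" using \<U> by simp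
  then have "\<exists>\<rho>. smooth_partition_of_unity N \<U> \<rho>"
    by (rule assms(2)[unfolded paracompact_manifold_def, THEN spec, THEN mp])
  then obtain \<rho> where \<rho>: "smooth_partition_of_unity N \<U> \<rho>" ..
  note \<rho>' = \<rho>[unfolded smooth_partition_of_unity_def]
  note \<rho>1 = conjunct1[OF \<rho>', rule_format] and \<rho>2 = conjunct1[OF conjunct2[OF \<rho>'], rule_format]
    and \<rho>3 = conjunct2[OF conjunct2[OF \<rho>'], rule_format]
  have sm: "\<And>U. U \<in> \<U> \<Longrightarrow> smooth_map N real_mfd (\<rho> U)"
    and nn: "\<And>U y. U \<in> \<U> \<Longrightarrow> y \<in> mspace N \<Longrightarrow> 0 \<le> \<rho> U y"
    and supp: "\<And>U. U \<in> \<U> \<Longrightarrow> mtop N closure_of {x \<in> mspace N. \<rho> U x \<noteq> 0} \<subseteq> U"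
    and lf0: "\<And>x. x \<in> mspace N \<Longrightarrow> \<exists>W. openin (mtop N) W \<and> x \<in> W \<and>
            finite {U \<in> \<U>. W \<inter> mtop N closure_of {y \<in> mspace N. \<rho> U y \<noteq> 0} \<noteq> {}}"
    and one: "\<And>x. x \<in> mspace N \<Longrightarrow> (\<Sum>U\<in>{U \<in> \<U>. \<rho> U x \<noteq> 0}. \<rho> U x) = 1"
    by (use \<rho>1 in blast, use \<rho>1 in blast, use \<rho>1 in blast, rule \<rho>2, assumption, rule \<rho>3, assumption)
  have clo: "y \<in> mtop N closure_of {x \<in> mspace N. \<rho> U x \<noteq> 0}" if "y \<in> mspace N" "\<rho> U y \<noteq> 0" for U y
    using closure_of_subset[of "{x \<in> mspace N. \<rho> U x \<noteq> 0}" "mtop N"] that by blast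
  have lf: "locally_finite_near (mtop N) \<U> \<rho> y"
    if "y \<in> mspace N" for y
  proof -
    obtain W where W: "openin (mtop N) W" "y \<in> W"
      "finite {U \<in> \<U>. W \<inter> mtop N closure_of {y \<in> mspace N. \<rho> U y \<noteq> 0} \<noteq> {}}"
      using lf0[OF \<open>y \<in> mspace N\<close>] by blast
    have "\<rho> U z = 0" if "z \<in> W" "U \<in> \<U> - {U \<in> \<U>. W \<inter> mtop N closure_of {y \<in> mspace N. \<rho> U y \<noteq> 0} \<noteq> {}}" for z U
      using clo[of z U] openin_subset[OF W(1)] that by blast
    then show ?thesis using W by blast
  qed
  define A where "A = (\<lambda>y. {U \<in> \<U>. \<rho> U y \<noteq> 0})"
  have finA: "finite (A y)" if y: "y \<in> mspace N" for y
  proof -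
    obtain F where "finite F" "\<forall>U\<in>\<U> - F. \<rho> U y = 0" using lf[OF y] by blast
    then show ?thesis unfolding A_def by (auto elim: finite_subset[rotated])
  qed
  have A1: "(\<Sum>U\<in>A y. \<rho> U y) = 1" if "y \<in> mspace N" for y using one[OF that] by (simp add: A_def)
  define m where "m = (\<lambda>y. \<Sum>U\<in>{U\<in>\<U>. \<rho> U y * \<rho> U y \<noteq> 0}. \<rho> U y * \<rho> U y)"
  have m_eq: "m y = (\<Sum>U\<in>A y. \<rho> U y * \<rho> U y)" for y by (simp add: m_def A_def)
  have Ane: "A y \<noteq> {}" if "y \<in> mspace N" for y using A1[OF that] by auto
  have m_pos: "m y > 0" if "y \<in> mspace N" for y
    unfolding m_eq
  proof (rule sum_pos[OF finA[OF that] Ane[OF that]])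
    show "0 < \<rho> U y * \<rho> U y" if "U \<in> A y" for U
      using that by (auto simp: A_def zero_less_mult_iff not_less)
  qed
  have m_sm: "smooth_map N real_mfd m"
    unfolding m_def
  proof (rule smooth_map_real_sum_locally_finite[OF N])
    show "smooth_map N real_mfd (\<lambda>y. \<rho> U y * \<rho> U y)" if "U \<in> \<U>" for U
      by (intro smooth_map_real_mult[OF N] sm that)
    show "locally_finite_near (mtop N) \<U> (\<lambda>U z. \<rho> U z * \<rho> U z) y"
      if "y \<in> mspace N" for y using lf[OF that] by simp
  qed
  define q where "q = (\<lambda>U y. \<rho> U y / m y)"
  have q_sm: "smooth_map N real_mfd (q U)" if "U \<in> \<U>" for U
    unfolding q_def by (rule smooth_map_real_divide[OF N sm[OF that] m_sm]) (use m_pos in force)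
  have q_lf: "locally_finite_near (mtop N) \<U> q y"
    if y: "y \<in> mspace N" for y
  proof -
    obtain W F where "openin (mtop N) W" "y \<in> W" "finite F" "F \<subseteq> \<U>" "\<forall>z\<in>W. \<forall>U\<in>\<U> - F. \<rho> U z = 0"
      using lf[OF y] by blast
    then show ?thesis by (intro exI[of _ W] exI[of _ F]) (simp add: q_def)
  qed
  have q_large: "\<exists>U\<in>\<U>. 1 \<le> q U y" if y: "y \<in> mspace N" for y
  proof (rule ccontr)
    assume "\<not> (\<exists>U\<in>\<U>. 1 \<le> q U y)"
    then have small: "\<rho> U y < m y" if "U \<in> \<U>" for U
      using that m_pos[OF y] by (auto simp: q_def not_le divide_less_eq)
    \<comment> \<open>If all \<open>\<rho> U y\<close> were below \<open>m y\<close>, then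
      \<open>m y = \<Sum> \<rho>\<^sup>2 < m y * \<Sum> \<rho> = m y\<close>; the inequality is
      strict because the support is nonempty and \<rho> is positive on it.\<close>
    have "m y < (\<Sum>U\<in>A y. m y * \<rho> U y)"
      unfolding m_eq[of y]
    proof (rule sum_strict_mono[OF finA[OF y] Ane[OF y]])
      fix U assume "U \<in> A y"
      then have "U \<in> \<U>" "\<rho> U y > 0" using nn[OF _ y, of U] by (auto simp: A_def)
      then show "\<rho> U y * \<rho> U y < (\<Sum>U\<in>A y. \<rho> U y * \<rho> U y) * \<rho> U y"
        using small[of U] m_eq[of y] by simp
    qed
    also have "\<dots> = m y" using A1[OF y] by (simp add: sum_distrib_left[symmetric])
    finally show False by simp
  qed
  \<comment> \<open>The cut-off 1/2 lies strictly below 1, so some \<open>u U y\<close> is positive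
    at every point and their sum may be divided by; it also exceeds the 1/4 by which
    \<open>q\<close> may drop during a step.\<close>
  define u where "u = (\<lambda>U y. flat (q U y - 1/2))"
  have u0: "0 \<le> u U y" for U y by (simp add: u_def flat_nonneg)
  have u_sm: "smooth_map N real_mfd (u U)" if "U \<in> \<U>" for U
  proof -
    have "smooth_map N real_mfd (\<lambda>y. q U y + (- 1/2))"
      by (intro smooth_map_real_add[OF N] q_sm[OF that] smooth_map_const) simp
    from smooth_map_flat[OF N this] show ?thesis by (simp add: u_def)
  qed
  have uq: "u U y = 0" if "q U y \<le> 1/2" for U y using that by (simp add: u_def flat_eq_0_iff)
  define S where "S = (\<lambda>y. \<Sum>U\<in>{U\<in>\<U>. u U y \<noteq> 0}. u U y)"
  have u_lf: "locally_finite_near (mtop N) \<U> u y"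
    if y: "y \<in> mspace N" for y
  proof -
    obtain W F where "openin (mtop N) W" "y \<in> W" "finite F" "F \<subseteq> \<U>" "\<forall>z\<in>W. \<forall>U\<in>\<U> - F. q U z = 0"
      using q_lf[OF y] by blast
    then show ?thesis by (intro exI[of _ W] exI[of _ F]) (simp add: uq)
  qed
  have S_sm: "smooth_map N real_mfd S"
    unfolding S_def by (rule smooth_map_real_sum_locally_finite[OF N u_sm u_lf])
  have S_pos: "S y > 0" if y: "y \<in> mspace N" for y
  proof -
    obtain F where F: "finite F" "\<forall>U\<in>\<U> - F. u U y = 0" using u_lf[OF y] by blast
    then have fin: "finite {U\<in>\<U>. u U y \<noteq> 0}" by (auto elim: finite_subset[rotated])
    obtain U where U: "U \<in> \<U>" "1 \<le> q U y" using q_large[OF y] by blast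
    then have "u U y > 0" using u0[of U y] flat_eq_0_iff[of "q U y - 1/2"] by (simp add: u_def less_le)
    then show ?thesis unfolding S_def using U(1) u0 by (intro sum_pos2[OF fin, of U]) auto
  qed
  define w where "w = (\<lambda>U y. u U y / S y)"
  show thesis
  proof (rule that[of q w])
    show "smooth_map N real_mfd (w U)" if "U \<in> \<U>" for U
      unfolding w_def by (rule smooth_map_real_divide[OF N u_sm[OF that] S_sm]) (use S_pos in force)
    show "y \<in> U" if "U \<in> \<U>" "y \<in> mspace N" "q U y \<noteq> 0" for U y
      using clo[of y U] supp[OF that(1)] that by (auto simp: q_def)
    show "0 \<le> w U y" if "U \<in> \<U>" "y \<in> mspace N" for U y
      using u0[of U y] S_pos[OF that(2)] by (simp add: w_def)
    show "w U y = 0" if "q U y \<le> 1/2" for U y using uq[OF that] by (simp add: w_def)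
    show "(\<Sum>U\<in>{U\<in>\<U>. w U y \<noteq> 0}. w U y) = 1" if y: "y \<in> mspace N" for y
    proof -
      have "{U\<in>\<U>. w U y \<noteq> 0} = {U\<in>\<U>. u U y \<noteq> 0}" using S_pos[OF y] by (simp add: w_def)
      then have "(\<Sum>U\<in>{U\<in>\<U>. w U y \<noteq> 0}. w U y) = (\<Sum>U\<in>{U\<in>\<U>. u U y \<noteq> 0}. u U y / S y)"
        by (simp only: w_def)
      also have "\<dots> = S y / S y" by (simp only: S_def sum_divide_distrib)
      finally have "(\<Sum>U\<in>{U\<in>\<U>. w U y \<noteq> 0}. w U y) = S y / S y" .
      then show ?thesis using S_pos[OF y] by simp
    qed
  qed (use q_sm q_lf in auto)
qed


section \<open>Transport along a short piece of the homotopy\<close>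

text \<open>Elementary steps need not commute, so neighbouring points must take them in the same
  order although different sets are active there. A fixed linear order, from the well-ordering
  theorem, provides this; the filter property says that dropping inactive sets does not rearrange
  the rest.\<close>

lemma consistent_listing:
  obtains ord :: "'x set \<Rightarrow> 'x list" where
    "\<And>F. finite F \<Longrightarrow> set (ord F) = F" "\<And>F. finite F \<Longrightarrow> distinct (ord F)"
    "\<And>F Q. finite F \<Longrightarrow> filter Q (ord F) = ord {x\<in>F. Q x}"
proof -
  obtain r :: "'x rel" where r: "Well_order r" "Field r = UNIV"
    using well_ordering[where 'a='x] by (elim exE conjE)
  define le where "le = (\<lambda>x y. (x, y) \<in> r)"
  interpret L: linorder le "\<lambda>x y. le x y \<and> x \<noteq> y"
  proof -
    have "refl r" "trans r" "antisym r" "total r"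
      using r unfolding well_order_on_def linear_order_on_def partial_order_on_def preorder_on_def by auto
    then show "class.linorder le (\<lambda>x y. le x y \<and> x \<noteq> y)"
      unfolding le_def refl_on_def total_on_def
      by unfold_locales (auto dest: antisymD transD, metis UNIV_I)
  qed
  define ord where "ord F = (THE xs. set xs = F \<and> sorted_wrt le xs \<and> distinct xs)" for F :: "'x set"
  have ord: "set (ord F) = F \<and> sorted_wrt le (ord F) \<and> distinct (ord F)" if "finite F" for F
    unfolding ord_def using L.finite_sorted_distinct_unique[OF that] by (rule theI')
  have "filter Q (ord F) = ord {x\<in>F. Q x}" if F: "finite F" for F Q
  proof -
    have "set (filter Q (ord F)) = {x\<in>F. Q x} \<and> sorted_wrt le (filter Q (ord F)) \<and> distinct (filter Q (ord F))"
      using ord[OF F] by (auto simp: sorted_wrt_filter)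
    then show ?thesis
      using ord[of "{x\<in>F. Q x}"] F L.finite_sorted_distinct_unique[of "{x\<in>F. Q x}"] by auto
  qed
  then show thesis using that ord by blast
qed

text \<open>One transport, from time \<open>a x\<close> to time \<open>a x + \<epsilon> x\<close>.
  The alternative in \<open>near\<close> is asked at every \<open>x\<close>, also where
  \<open>W U x = 0\<close>: on the boundary of the set where \<open>W U\<close> is nonzero the step
  must still be smooth, so there the path has to stay in \<open>U\<close>.\<close>

locale transport = bundle_over G N \<xi> M
  for G :: "('g, 'k::euclidean_space) lie_struct" and N :: "('b, 'f::euclidean_space) mfd"
    and \<xi> :: "('p, 'e::euclidean_space, 'b, 'g) pbundle" and M :: "('a, 'h::euclidean_space) mfd" +
  fixes H :: "real \<times> 'a \<Rightarrow> 'b" and \<U> :: "'b set set" and trv :: "'b set \<Rightarrow> 'p \<Rightarrow> 'b \<times> 'g"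
    and W :: "'b set \<Rightarrow> 'a \<Rightarrow> real" and a \<epsilon> :: "'a \<Rightarrow> real"
  assumes H: "smooth_map (prod_mfd real_mfd M) N H"
    and trv: "U \<in> \<U> \<Longrightarrow> triv U (trv U)"
    and W_smooth: "U \<in> \<U> \<Longrightarrow> smooth_map M real_mfd (W U)"
    and W_nonneg: "U \<in> \<U> \<Longrightarrow> x \<in> mspace M \<Longrightarrow> 0 \<le> W U x"
    and W_lf: "x \<in> mspace M \<Longrightarrow> locally_finite_near (mtop M) \<U> W x"
    and W_sum: "x \<in> mspace M \<Longrightarrow> (\<Sum>U\<in>{U\<in>\<U>. W U x \<noteq> 0}. W U x) = 1"
    and a_smooth: "smooth_map M real_mfd a" and \<epsilon>_smooth: "smooth_map M real_mfd \<epsilon>"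
    and \<epsilon>_nonneg: "x \<in> mspace M \<Longrightarrow> 0 \<le> \<epsilon> x"
    and near: "U \<in> \<U> \<Longrightarrow> x \<in> mspace M \<Longrightarrow>
      (\<exists>D. openin (mtop M) D \<and> x \<in> D \<and> (\<forall>y\<in>D. W U y = 0)) \<or> (\<forall>s\<in>{a x..a x + \<epsilon> x}. H (s, x) \<in> U)"
begin

definition time :: "'b set list \<Rightarrow> 'a \<Rightarrow> real" where
  "time l x = a x + \<epsilon> x * (\<Sum>U\<leftarrow>l. W U x)"

text \<open>The head of the list is the last set used. The case \<open>W U x = 0\<close> is separate
  because the base point may then lie outside \<open>U\<close>, where \<open>tinv U (trv U)\<close>
  has no meaning.\<close>

primrec walk :: "'b set list \<Rightarrow> 'a \<Rightarrow> 'p \<Rightarrow> 'p" where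
  "walk [] x p = p"
| "walk (U # l) x p = (if W U x = 0 then walk l x p
     else tinv U (trv U) (H (time (U # l) x, x), snd (trv U (walk l x p))))"

lemma time_Cons: "time (U # l) x = time l x + \<epsilon> x * W U x"
  by (simp add: time_def algebra_simps)

lemma time_filter: "time (filter (\<lambda>U. W U x \<noteq> 0) l) x = time l x"
  unfolding time_def by (induction l) (auto simp: algebra_simps)

text \<open>Inactive sets change neither the time nor the point, so a list may be enlarged by them;
  this allows one list throughout a neighbourhood.\<close>

lemma walk_filter: "walk (filter (\<lambda>U. W U x \<noteq> 0) l) x p = walk l x p"
  by (induction l) (simp_all add: time_Cons time_filter)

text \<open>A sum over an infinite set is 0 by convention, whereas this one is 1.\<close>

lemma finite_support: "x \<in> mspace M \<Longrightarrow> finite {U\<in>\<U>. W U x \<noteq> 0}"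
  using W_sum[of x] by (metis (no_types, lifting) sum.infinite zero_neq_one)

lemma smooth_time: "set l \<subseteq> \<U> \<Longrightarrow> smooth_map M real_mfd (time l)"
proof -
  assume "set l \<subseteq> \<U>"
  then have "smooth_map M real_mfd (\<lambda>x. \<Sum>U\<leftarrow>l. W U x)"
  proof (induction l)
    case (Cons U l)
    then show ?case using smooth_map_real_add[OF sM W_smooth[of U]] by simp
  qed (simp add: smooth_map_const)
  then show ?thesis unfolding time_def[abs_def]
    by (intro smooth_map_real_add[OF sM] smooth_map_real_mult[OF sM] a_smooth \<epsilon>_smooth)
qed

lemma smooth_H_at:
  "smooth_map M real_mfd s \<Longrightarrow> smooth_map M N (\<lambda>x. H (s x, x))"
  by (rule smooth_map_compose[OF sM smooth_atlas_prod[OF smooth_atlas_real sM] sN smooth_map_Pair[OF _ smooth_map_id[OF sM]] H])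

text \<open>Partial sums of nonnegative weights of total 1 lie between 0 and 1, so every
  intermediate time lies in the interval controlled by \<open>near\<close>.\<close>

lemma time_bounds:
  assumes l: "distinct l" "set l \<subseteq> \<U>" and x: "x \<in> mspace M"
  shows "time l x \<in> {a x..a x + \<epsilon> x}"
proof -
  have s: "(\<Sum>U\<leftarrow>l. W U x) = (\<Sum>U\<in>set l. W U x)" using l(1) by (rule sum_list_distinct_conv_sum_set)
  have 0: "0 \<le> (\<Sum>U\<in>set l. W U x)" using W_nonneg x l(2) by (intro sum_nonneg) auto
  have "(\<Sum>U\<in>set l. W U x) = (\<Sum>U\<in>{U\<in>set l. W U x \<noteq> 0}. W U x)"
    by (rule sum.mono_neutral_right) auto
  also have "\<dots> \<le> (\<Sum>U\<in>{U\<in>\<U>. W U x \<noteq> 0}. W U x)"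
    using W_nonneg x l(2) by (intro sum_mono2[OF finite_support[OF x]]) auto
  finally have 1: "(\<Sum>U\<in>set l. W U x) \<le> 1" using W_sum[OF x] by simp
  have "\<epsilon> x * (\<Sum>U\<in>set l. W U x) \<le> \<epsilon> x * 1" using 1 \<epsilon>_nonneg[OF x] by (rule mult_left_mono)
  then show ?thesis unfolding time_def s using 0 \<epsilon>_nonneg[OF x] by simp
qed

lemma gauge_walk:
  assumes "distinct l" "set l \<subseteq> \<U>"
  shows "gauge (\<lambda>x. H (a x, x)) (\<lambda>x. H (time l x, x)) (walk l)"
  using assms
proof (induction l)
  case Nil
  have "gauge (\<lambda>x. H (a x, x)) (\<lambda>x. H (a x, x)) (\<lambda>x p. p)" by (rule gauge_id[OF smooth_H_at[OF a_smooth]])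
  then show ?case by (simp add: time_def)
next
  case (Cons U l)
  then have U: "U \<in> \<U>" and l: "distinct l" "set l \<subseteq> \<U>" by auto
  let ?s = "\<lambda>x. H (time l x, x)" and ?s' = "\<lambda>x. H (time (U # l) x, x)"
  let ?step = "\<lambda>x p. if W U x = 0 then p else tinv U (trv U) (?s' x, snd (trv U p))"
  note t = trv[OF U]
  have ss: "smooth_map M N ?s" "smooth_map M N ?s'"
    using smooth_H_at[OF smooth_time] l Cons.prems(2) by blast+
  have eq: "?s' x = ?s x" if "W U x = 0" for x using that by (simp add: time_def)
  have "gauge ?s ?s' ?step"
  proof (rule gauge_stepI[OF ss(1) t])
    fix x assume x: "x \<in> mspace M"
    show "\<exists>D. openin (mtop M) D \<and> x \<in> D \<and>
      ((\<forall>y\<in>D. ?s y \<in> U \<and> ?s' y \<in> U \<and> (\<forall>p\<in>P. \<pi> p = ?s y \<longrightarrow> ?step y p = tinv U (trv U) (?s' y, snd (trv U p)))) \<or>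
       (\<forall>y\<in>D. ?s y = ?s' y \<and> (\<forall>p\<in>P. \<pi> p = ?s y \<longrightarrow> ?step y p = p)))"
      using near[OF U x]
    proof
      assume "\<exists>D. openin (mtop M) D \<and> x \<in> D \<and> (\<forall>y\<in>D. W U y = 0)"
      then obtain D where "openin (mtop M) D" "x \<in> D" "\<forall>y\<in>D. W U y = 0" by blast
      then show ?thesis using eq by (intro exI[of _ D]) auto
    next
      assume n: "\<forall>s\<in>{a x..a x + \<epsilon> x}. H (s, x) \<in> U"
      let ?D = "{x \<in> mspace M. ?s x \<in> U} \<inter> {x \<in> mspace M. ?s' x \<in> U}"
      have D: "openin (mtop M) ?D"
        by (intro openin_Int preimage_openin[OF ss(1)] preimage_openin[OF ss(2)] triv_openin[OF t])
      have xD: "x \<in> ?D" using n time_bounds[OF l x] time_bounds[OF Cons.prems x] x by blast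
      \<comment> \<open>On \<open>?D\<close> the two branches of \<open>?step\<close> agree: if
        \<open>W U y = 0\<close> the two times coincide, and rebuilding \<open>p\<close> from its
        own coordinates returns \<open>p\<close>. So the case distinction does no harm to
        smoothness.\<close>
      have "?step y p = tinv U (trv U) (?s' y, snd (trv U p))" if "y \<in> ?D" "p \<in> P" "\<pi> p = ?s y" for y p
        using that eq[of y] tinv_unique[OF t that(2,3)] by auto
      then show ?thesis using D xD by (intro exI[of _ ?D] conjI disjI1) auto
    qed
  qed
  from gauge_compose[OF Cons.IH[OF l] this ss(1)]
  have g: "gauge (\<lambda>x. H (a x, x)) ?s' (\<lambda>x p. ?step x (walk l x p))" .
  have "(\<lambda>x p. ?step x (walk l x p)) = walk (U # l)" by (intro ext) simp
  with g show ?case by simp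
qed

text \<open>Each step ends over the point where it started, and keeping the group coordinate over a
  fixed base point keeps the point. Transports after time 1 are therefore exactly the identity, as
  the infinite composition requires.\<close>

lemma walk_stationary:
  assumes l: "distinct l" "set l \<subseteq> \<U>" and x: "x \<in> mspace M" and p: "p \<in> P" "\<pi> p = H (a x, x)"
    and stat: "\<And>s. a x \<le> s \<Longrightarrow> H (s, x) = H (a x, x)"
  shows "walk l x p = p"
  using l
proof (induction l)
  case (Cons U l)
  then have U: "U \<in> \<U>" and IH: "walk l x p = p" by auto
  show ?case
  proof (cases "W U x = 0")
    case False
    then have "H (a x, x) \<in> U" using near[OF U x] \<epsilon>_nonneg[OF x] by force
    moreover have "H (time (U # l) x, x) = H (a x, x)"
      using time_bounds[OF Cons.prems x] by (intro stat) simp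
    ultimately show ?thesis using False IH tinv_unique[OF trv[OF U] p] by simp
  qed (use IH in simp)
qed simp

lemma transport_exists:
  "\<exists>\<theta>. gauge (\<lambda>x. H (a x, x)) (\<lambda>x. H (a x + \<epsilon> x, x)) \<theta> \<and>
    (\<forall>x\<in>mspace M. \<forall>p\<in>P. \<pi> p = H (a x, x) \<longrightarrow> (\<forall>s\<ge>a x. H (s, x) = H (a x, x)) \<longrightarrow> \<theta> x p = p)"
proof -
  obtain ord :: "'b set set \<Rightarrow> 'b set list" where ord: "\<And>F. finite F \<Longrightarrow> set (ord F) = F" "\<And>F. finite F \<Longrightarrow> distinct (ord F)"
    "\<And>F Q. finite F \<Longrightarrow> filter Q (ord F) = ord {x\<in>F. Q x}"
    using consistent_listing by metis
  define \<theta> where "\<theta> = (\<lambda>x. walk (ord {U\<in>\<U>. W U x \<noteq> 0}) x)"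
  have 1: "gauge (\<lambda>x. H (a x, x)) (\<lambda>x. H (a x + \<epsilon> x, x)) \<theta>"
  proof (rule gauge_local)
    fix x assume x: "x \<in> mspace M"
    obtain D F where D: "openin (mtop M) D" "x \<in> D" "finite F" "F \<subseteq> \<U>" "\<forall>y\<in>D. \<forall>U\<in>\<U> - F. W U y = 0"
      using W_lf[OF x] by blast
    let ?l = "ord F"
    have "H (a y + \<epsilon> y, y) = H (time ?l y, y) \<and> \<theta> y = walk ?l y" if y: "y \<in> D" for y
    proof -
      have yM: "y \<in> mspace M" using y openin_subset[OF D(1)] by blast
      \<comment> \<open>The active sets at \<open>y\<close> form a part of \<open>F\<close> that
        varies with \<open>y\<close>; the consistent order presents the walk along them as the walk
        along the fixed list \<open>ord F\<close>.\<close>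
      have e: "{U\<in>\<U>. W U y \<noteq> 0} = {U\<in>F. W U y \<noteq> 0}" using D(4,5) y by blast
      have "\<theta> y = walk ?l y" unfolding \<theta>_def e ord(3)[OF D(3), symmetric] by (intro ext walk_filter)
      moreover have "(\<Sum>U\<leftarrow>?l. W U y) = (\<Sum>U\<in>F. W U y)"
        using sum_list_distinct_conv_sum_set[OF ord(2)[OF D(3)]] ord(1)[OF D(3)] by simp
      moreover have "(\<Sum>U\<in>F. W U y) = (\<Sum>U\<in>{U\<in>F. W U y \<noteq> 0}. W U y)"
        by (rule sum.mono_neutral_right) (use D(3) in auto)
      ultimately show ?thesis using W_sum[OF yM] by (simp add: e time_def)
    qed
    moreover have "gauge (\<lambda>x. H (a x, x)) (\<lambda>x. H (time ?l x, x)) (walk ?l)"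
      by (rule gauge_walk) (use ord D(3,4) in auto)
    ultimately show "\<exists>D f' g' \<theta>'. openin (mtop M) D \<and> x \<in> D \<and> gauge f' g' \<theta>' \<and>
      (\<forall>y\<in>D. H (a y, y) = f' y \<and> H (a y + \<epsilon> y, y) = g' y \<and> (\<forall>p\<in>P. \<pi> p = H (a y, y) \<longrightarrow> \<theta> y p = \<theta>' y p))"
      using D(1,2) by (intro exI[of _ D] exI[of _ "\<lambda>x. H (a x, x)"] exI[of _ "\<lambda>x. H (time ?l x, x)"] exI[of _ "walk ?l"]) simp
  qed
  have 2: "\<theta> x p = p" if x: "x \<in> mspace M" and p: "p \<in> P" "\<pi> p = H (a x, x)" and s: "\<forall>s\<ge>a x. H (s, x) = H (a x, x)" for x p
    unfolding \<theta>_def by (rule walk_stationary[OF _ _ x p s[rule_format]]) (use ord finite_support[OF x] in auto)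
  show ?thesis by (intro exI[of _ \<theta>] conjI ballI impI 1 2)
qed

end

section \<open>Step sizes\<close>

text \<open>The tube argument: each time has a product neighbourhood meeting finitely many relevant
  sets, finitely many of these neighbourhoods cover \<open>[0, 1]\<close>, and by
  \<open>stat\<close> other times add no new values. Local finiteness on \<open>M\<close> is thus
  inherited from \<open>Y\<close>, whatever the space \<open>X\<close> of parameters.\<close>

lemma locally_finite_along_homotopy:
  fixes H :: "real \<times> 'a \<Rightarrow> 'b"
  assumes H: "continuous_map (prod_topology euclidean X) Y H"
    and stat: "\<And>t x. x \<in> topspace X \<Longrightarrow> \<exists>s\<in>{0..1}. H (t, x) = H (s, x)"
    and lf: "\<And>y. y \<in> topspace Y \<Longrightarrow> \<exists>W F. openin Y W \<and> y \<in> W \<and> finite F \<and> F \<subseteq> \<U> \<and> (\<forall>z\<in>W. \<forall>U\<in>\<U> - F. Q U z)"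
    and x: "x \<in> topspace X"
  shows "\<exists>D F. openin X D \<and> x \<in> D \<and> finite F \<and> F \<subseteq> \<U> \<and> (\<forall>y\<in>D. \<forall>t. \<forall>U\<in>\<U> - F. Q U (H (t, y)))"
proof -
  have "\<exists>A D F. open A \<and> s \<in> A \<and> openin X D \<and> x \<in> D \<and> finite F \<and> F \<subseteq> \<U> \<and>
      (\<forall>t\<in>A. \<forall>y\<in>D. \<forall>U\<in>\<U> - F. Q U (H (t, y)))" for s
  proof -
    have sx: "(s, x) \<in> topspace (prod_topology euclidean X)" using x by simp
    then have "H (s, x) \<in> topspace Y" using continuous_map_image_subset_topspace[OF H] by blast
    from lf[OF this] obtain W F where W: "openin Y W" "H (s, x) \<in> W" "finite F" "F \<subseteq> \<U>" "\<forall>z\<in>W. \<forall>U\<in>\<U> - F. Q U z"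
      by blast
    let ?V = "{z \<in> topspace (prod_topology euclidean X). H z \<in> W}"
    have V: "openin (prod_topology euclidean X) ?V" by (rule openin_continuous_map_preimage[OF H W(1)])
    have "(s, x) \<in> ?V" using sx W(2) by simp
    then obtain A D where "openin euclidean A" "openin X D" "s \<in> A" "x \<in> D" "A \<times> D \<subseteq> ?V"
      using V unfolding openin_prod_topology_alt by meson
    then show ?thesis using W by (intro exI[of _ A] exI[of _ D] exI[of _ F]) (auto simp: subset_iff)
  qed
  then obtain A D F where A: "\<And>s. open (A s)" "\<And>s. s \<in> A s" and D: "\<And>s. openin X (D s)" "\<And>s. x \<in> D s"
    and F: "\<And>s. finite (F s)" "\<And>s. F s \<subseteq> \<U>" "\<And>s. \<forall>t\<in>A s. \<forall>y\<in>D s. \<forall>U\<in>\<U> - F s. Q U (H (t, y))"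
    by metis
  obtain C where C: "C \<subseteq> {0..1}" "finite C" "{0..1::real} \<subseteq> (\<Union>s\<in>C. A s)"
    by (rule compactE_image[OF compact_Icc, of "{0..1}" A 0 1]) (use A in auto)
  let ?D = "(\<Inter>s\<in>C. D s) \<inter> topspace X" and ?F = "\<Union>s\<in>C. F s"
  have "Q U (H (t, y))" if y: "y \<in> ?D" and U: "U \<in> \<U> - ?F" for y t U
  proof -
    obtain s where s: "s \<in> {0..1}" "H (t, y) = H (s, y)" using stat y by blast
    then obtain c where "c \<in> C" "s \<in> A c" using C(3) by blast
    then show ?thesis using F(3)[of c] y U s(2) by auto
  qed
  moreover have "openin X ?D" using C(2) D(1) by (intro openin_INT) auto
  moreover have "x \<in> ?D" "finite ?F" "?F \<subseteq> \<U>" using x C(2) D(2) F(1,2) by auto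
  ultimately show ?thesis by (intro exI[of _ ?D] exI[of _ ?F]) blast
qed

text \<open>At each \<open>x\<close> the sum \<open>E x\<close> dominates the energies of all
  functions \<open>q U\<close> along the path at once; local finiteness makes it smooth, and
  \<open>energy_bound\<close> turns it into a common step length.\<close>

lemma step_size:
  fixes M :: "('a, 'h::euclidean_space) mfd" and H :: "real \<times> 'a \<Rightarrow> 'b"
  assumes M: "smooth_manifold M" and h: "\<And>U. U \<in> \<U> \<Longrightarrow> smooth_map (prod_mfd real_mfd M) real_mfd (\<lambda>z. q U (H z))"
    and stat: "\<And>t x. x \<in> mspace M \<Longrightarrow> t \<le> 0 \<Longrightarrow> H (t, x) = H (0, x)"
      "\<And>t x. x \<in> mspace M \<Longrightarrow> 1 \<le> t \<Longrightarrow> H (t, x) = H (1, x)"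
    and lf: "\<And>x. x \<in> mspace M \<Longrightarrow> \<exists>D F. openin (mtop M) D \<and> x \<in> D \<and> finite F \<and> F \<subseteq> \<U> \<and>
      (\<forall>y\<in>D. \<forall>t. \<forall>U\<in>\<U> - F. q U (H (t, y)) = (0::real))"
  obtains \<epsilon> where "smooth_map M real_mfd \<epsilon>" "\<And>x. x \<in> mspace M \<Longrightarrow> 0 < \<epsilon> x"
    "\<And>U x s t. U \<in> \<U> \<Longrightarrow> x \<in> mspace M \<Longrightarrow> s \<le> t \<Longrightarrow> t \<le> s + \<epsilon> x \<Longrightarrow> \<bar>q U (H (t, x)) - q U (H (s, x))\<bar> \<le> 1/4"
proof -
  note sM = smooth_manifold_imp_smooth_atlas[OF M]
  define e where "e = (\<lambda>U. energy (\<lambda>z. q U (H z)))"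
  have e0: "0 \<le> e U x" for U x by (simp add: e_def energy_nonneg)
  have e_lf: "locally_finite_near (mtop M) \<U> e x"
    if x: "x \<in> mspace M" for x
  proof -
    obtain D F where D: "openin (mtop M) D" "x \<in> D" "finite F" "F \<subseteq> \<U>" "\<forall>y\<in>D. \<forall>t. \<forall>U\<in>\<U> - F. q U (H (t, y)) = 0"
      using lf[OF x] by blast
    have "e U y = 0" if "y \<in> D" "U \<in> \<U> - F" for U y
    proof -
      have "(\<lambda>s. q U (H (s, y))) = (\<lambda>s. 0)" using D(5) that by blast
      then show ?thesis by (simp add: e_def energy_def)
    qed
    then show ?thesis using D(1-4) by blast
  qed
  define E where "E = (\<lambda>x. \<Sum>U\<in>{U\<in>\<U>. e U x \<noteq> 0}. e U x)"
  have E_sm: "smooth_map M real_mfd E"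
    unfolding E_def
    by (rule smooth_map_real_sum_locally_finite[OF sM _ e_lf]) (unfold e_def, rule smooth_map_energy[OF M h])
  have E0: "0 \<le> E x" for x unfolding E_def by (intro sum_nonneg e0)
  have eE: "e U x \<le> E x" if U: "U \<in> \<U>" and x: "x \<in> mspace M" for U x
  proof (cases "e U x = 0")
    case False
    obtain F where "finite F" "\<forall>U\<in>\<U> - F. e U x = 0" using e_lf[OF x] by blast
    then have "finite {U\<in>\<U>. e U x \<noteq> 0}" by (auto elim: finite_subset[rotated])
    then show ?thesis unfolding E_def using U False e0 by (intro member_le_sum) auto
  qed (simp add: E0)
  \<comment> \<open>The longest duration that \<open>energy_bound\<close> allows.\<close>
  define \<epsilon> where "\<epsilon> = (\<lambda>x. 1 / (16 * (1 + E x)))"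
  have pos: "0 < \<epsilon> x" for x using E0[of x] by (simp add: \<epsilon>_def)
  show thesis
  proof (rule that)
    show "smooth_map M real_mfd \<epsilon>" unfolding \<epsilon>_def
      by (intro smooth_map_real_divide[OF sM] smooth_map_real_mult[OF sM] smooth_map_real_add[OF sM] E_sm smooth_map_const)
        (use E0 in \<open>auto simp: add_nonneg_eq_0_iff\<close>)
    show "0 < \<epsilon> x" for x by (rule pos)
    fix U x s t assume U: "U \<in> \<U>" and x: "x \<in> mspace M" and st: "s \<le> t" "t \<le> s + \<epsilon> x"
    \<comment> \<open>The energy only sees \<open>[0, 1]\<close>. Clamping times to this interval
      does not change \<open>H\<close>, by \<open>stat\<close>, and does not lengthen
      durations.\<close>
    define k where "k = (\<lambda>r::real. max 0 (min 1 r))"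
    have k: "H (r, x) = H (k r, x)" for r using stat[OF x, of r] by (auto simp: k_def max_def min_def)
    have "k t - k s \<le> \<epsilon> x" using st pos[of x] by (auto simp: k_def max_def min_def)
    then have "16 * (1 + E x) * (k t - k s) \<le> 16 * (1 + E x) * \<epsilon> x"
      using E0[of x] by (intro mult_left_mono) auto
    also have "\<dots> = 1" using E0[of x] by (simp add: \<epsilon>_def)
    finally have d: "16 * (1 + E x) * (k t - k s) \<le> 1" .
    have "\<bar>q U (H (k t, x)) - q U (H (k s, x))\<bar> \<le> 1/4"
      by (rule energy_bound[OF smooth_map_slice[OF sM smooth_atlas_real smooth_atlas_real h[OF U] x] _ _ _ _ d])
        (use st eE[OF U x] in \<open>auto simp: k_def e_def\<close>)
    then show "\<bar>q U (H (t, x)) - q U (H (s, x))\<bar> \<le> 1/4" using k[of s] k[of t] by simp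
  qed
qed


section \<open>Homotopy invariance\<close>

context bundle_over
begin

lemma homotopy_gauge:
  assumes N_para: "paracompact_manifold N" and fg: "smoothly_homotopic M N f g"
  obtains \<theta> where "gauge f g \<theta>"
proof -
  obtain H where H: "smooth_map (prod_mfd real_mfd M) N H"
    and H0: "\<And>t x. x \<in> mspace M \<Longrightarrow> t \<le> 0 \<Longrightarrow> H (t, x) = f x"
    and H1: "\<And>t x. x \<in> mspace M \<Longrightarrow> 1 \<le> t \<Longrightarrow> H (t, x) = g x"
    using smoothly_homotopic_extend[OF sM sN fg] by metis
  note sRM = smooth_atlas_prod[OF smooth_atlas_real sM]
  define \<U> where "\<U> = {U. \<exists>\<tau>. triv U \<tau>}"
  \<comment> \<open>Partitions of unity are indexed by the sets themselves, so one trivialisation is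
    fixed for each set.\<close>
  define trv where "trv U = (SOME \<tau>. triv U \<tau>)" for U
  have trv: "triv U (trv U)" if "U \<in> \<U>" for U
  proof -
    have "\<exists>\<tau>. triv U \<tau>" using that by (simp add: \<U>_def)
    then show ?thesis unfolding trv_def by (rule someI_ex)
  qed
  have cover: "\<Union>\<U> = mspace N"
    unfolding \<U>_def using triv_exists triv_subset by blast
  obtain q w where q: "\<And>U. U \<in> \<U> \<Longrightarrow> smooth_map N real_mfd (q U)"
    and w: "\<And>U. U \<in> \<U> \<Longrightarrow> smooth_map N real_mfd (w U)"
    and qU: "\<And>U y. U \<in> \<U> \<Longrightarrow> y \<in> mspace N \<Longrightarrow> q U y \<noteq> 0 \<Longrightarrow> y \<in> U"
    and w0: "\<And>U y. U \<in> \<U> \<Longrightarrow> y \<in> mspace N \<Longrightarrow> 0 \<le> w U y"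
    and qw: "\<And>U y. q U y \<le> 1/2 \<Longrightarrow> w U y = 0"
    and lf: "\<And>y. y \<in> mspace N \<Longrightarrow> locally_finite_near (mtop N) \<U> q y"
    and w1: "\<And>y. y \<in> mspace N \<Longrightarrow> (\<Sum>U\<in>{U\<in>\<U>. w U y \<noteq> 0}. w U y) = 1"
  proof (rule paracompact_weights[OF sN N_para triv_openin[OF trv] cover], goal_cases)
    case (2 q w)
    show ?case by (rule 2(1)[OF 2(2-8)])
  qed
  have stat: "\<exists>s\<in>{0..1}. H (t, x) = H (s, x)" if x: "x \<in> mspace M" for t x
  proof (rule bexI[of _ "max 0 (min 1 t)"])
    show "H (t, x) = H (max 0 (min 1 t), x)"
      using H0[OF x, of t] H0[OF x, of 0] H1[OF x, of t] H1[OF x, of 1] by (auto simp: max_def min_def)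
  qed simp
  have lfM: "\<exists>D F. openin (mtop M) D \<and> x \<in> D \<and> finite F \<and> F \<subseteq> \<U> \<and> (\<forall>y\<in>D. \<forall>t. \<forall>U\<in>\<U> - F. q U (H (t, y)) = 0)"
    if x: "x \<in> mspace M" for x
    by (rule locally_finite_along_homotopy[OF _ stat lf x]) (use smooth_map_continuous[OF H] in auto)
  obtain \<epsilon> where \<epsilon>: "smooth_map M real_mfd \<epsilon>" "\<And>x. x \<in> mspace M \<Longrightarrow> 0 < \<epsilon> x"
    and short: "\<And>U x s t. U \<in> \<U> \<Longrightarrow> x \<in> mspace M \<Longrightarrow> s \<le> t \<Longrightarrow> t \<le> s + \<epsilon> x \<Longrightarrow> \<bar>q U (H (t, x)) - q U (H (s, x))\<bar> \<le> 1/4"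
  proof (rule step_size[OF M, of \<U> q H])
    show "smooth_map (prod_mfd real_mfd M) real_mfd (\<lambda>z. q U (H z))" if "U \<in> \<U>" for U
      by (rule smooth_map_compose[OF sRM sN smooth_atlas_real H q[OF that]])
  qed (use H0 H1 lfM in auto)
  have Hin: "H (t, x) \<in> mspace N" if "x \<in> mspace M" for t x using smooth_map_in[OF H, of "(t, x)"] that by simp
  \<comment> \<open>The \<open>j\<close>-th transport runs between consecutive multiples of
    \<open>\<epsilon> x\<close>, with the weights taken at its starting time; it must be the
    identity once that time has reached 1.\<close>
  have "\<exists>\<eta>. gauge (\<lambda>x. H (real j * \<epsilon> x, x)) (\<lambda>x. H (real (Suc j) * \<epsilon> x, x)) \<eta> \<and>
      (\<forall>x\<in>mspace M. \<forall>p\<in>P. \<pi> p = H (real j * \<epsilon> x, x) \<longrightarrow> 1 \<le> real j * \<epsilon> x \<longrightarrow> \<eta> x p = p)" for j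
  proof -
    let ?a = "\<lambda>x. real j * \<epsilon> x"
    have a: "smooth_map M real_mfd ?a" by (intro smooth_map_real_mult[OF sM] \<epsilon>(1) smooth_map_const) simp
    have Ha: "smooth_map M N (\<lambda>x. H (?a x, x))"
      by (rule smooth_map_compose[OF sM sRM sN smooth_map_Pair[OF a smooth_map_id[OF sM]] H])
    interpret transport G N \<xi> M H \<U> trv "\<lambda>U x. w U (H (?a x, x))" ?a \<epsilon>
    proof
      show "smooth_map M real_mfd (\<lambda>x. w U (H (?a x, x)))" if "U \<in> \<U>" for U
        by (rule smooth_map_compose[OF sM sN smooth_atlas_real Ha w[OF that]])
      show "locally_finite_near (mtop M) \<U> (\<lambda>U y. w U (H (?a y, y))) x"
        if x: "x \<in> mspace M" for x
      proof -
        obtain D F where "openin (mtop M) D" "x \<in> D" "finite F" "F \<subseteq> \<U>" "\<forall>y\<in>D. \<forall>t. \<forall>U\<in>\<U> - F. q U (H (t, y)) = 0"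
          using lfM[OF x] by blast
        then show ?thesis by (intro exI[of _ D] exI[of _ F]) (simp add: qw)
      qed
      fix U x assume U: "U \<in> \<U>" and x: "x \<in> mspace M"
      show "(\<exists>D. openin (mtop M) D \<and> x \<in> D \<and> (\<forall>y\<in>D. w U (H (?a y, y)) = 0)) \<or>
          (\<forall>s\<in>{?a x..?a x + \<epsilon> x}. H (s, x) \<in> U)"
      \<comment> \<open>Being below 1/2 is an open condition that kills the weight nearby. Otherwise
        \<open>q\<close> starts at 1/2 or more and loses at most 1/4, so it stays positive and the
        path stays in \<open>U\<close>.\<close>
      proof (cases "q U (H (?a x, x)) < 1/2")
        case True
        let ?D = "{y \<in> mspace M. q U (H (?a y, y)) \<in> {..<1/2}}"
        have "openin (mtop M) ?D"
          by (rule preimage_openin[OF smooth_map_compose[OF sM sN smooth_atlas_real Ha q[OF U]]]) simp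
        moreover have "x \<in> ?D" using True x by simp
        moreover have "\<forall>y\<in>?D. w U (H (?a y, y)) = 0" using qw by simp
        ultimately show ?thesis by blast
      next
        case False
        have "H (s, x) \<in> U" if "s \<in> {?a x..?a x + \<epsilon> x}" for s
        proof -
          have "q U (H (s, x)) \<noteq> 0" using short[OF U x, of "?a x" s] that False by auto
          then show ?thesis using qU[OF U Hin[OF x]] by blast
        qed
        then show ?thesis by blast
      qed
    qed (use H trv w0 Hin w1 a \<epsilon> in \<open>auto intro: less_imp_le\<close>)
    obtain \<eta> where \<eta>: "gauge (\<lambda>x. H (?a x, x)) (\<lambda>x. H (?a x + \<epsilon> x, x)) \<eta>"
      and id: "\<forall>x\<in>mspace M. \<forall>p\<in>P. \<pi> p = H (?a x, x) \<longrightarrow> (\<forall>s\<ge>?a x. H (s, x) = H (?a x, x)) \<longrightarrow> \<eta> x p = p"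
      using transport_exists by (elim exE conjE)
    have "\<eta> x p = p" if x: "x \<in> mspace M" and p: "p \<in> P" "\<pi> p = H (?a x, x)" and 1: "1 \<le> ?a x" for x p
    proof -
      have "H (s, x) = H (?a x, x)" if "?a x \<le> s" for s
        using H1[OF x order_trans[OF 1 that]] H1[OF x 1] by simp
      then have "\<forall>s\<ge>?a x. H (s, x) = H (?a x, x)" by blast
      then show ?thesis using id x p by blast
    qed
    moreover have "real (Suc j) * \<epsilon> x = ?a x + \<epsilon> x" for x by (simp add: algebra_simps)
    ultimately show ?thesis using \<eta> by (intro exI[of _ \<eta>]) simp
  qed
  then have "\<exists>\<eta>. \<forall>j. gauge (\<lambda>x. H (real j * \<epsilon> x, x)) (\<lambda>x. H (real (Suc j) * \<epsilon> x, x)) (\<eta> j) \<and>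
      (\<forall>x\<in>mspace M. \<forall>p\<in>P. \<pi> p = H (real j * \<epsilon> x, x) \<longrightarrow> 1 \<le> real j * \<epsilon> x \<longrightarrow> \<eta> j x p = p)"
    by (intro choice allI)
  then obtain \<eta> where "\<forall>j. gauge (\<lambda>x. H (real j * \<epsilon> x, x)) (\<lambda>x. H (real (Suc j) * \<epsilon> x, x)) (\<eta> j) \<and>
      (\<forall>x\<in>mspace M. \<forall>p\<in>P. \<pi> p = H (real j * \<epsilon> x, x) \<longrightarrow> 1 \<le> real j * \<epsilon> x \<longrightarrow> \<eta> j x p = p)" ..
  then have \<eta>: "gauge (\<lambda>x. H (real j * \<epsilon> x, x)) (\<lambda>x. H (real (Suc j) * \<epsilon> x, x)) (\<eta> j)"
    and \<eta>_id: "x \<in> mspace M \<Longrightarrow> p \<in> P \<Longrightarrow> \<pi> p = H (real j * \<epsilon> x, x) \<Longrightarrow> 1 \<le> real j * \<epsilon> x \<Longrightarrow> \<eta> j x p = p"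
    for j x p by blast+
  define \<Theta> where "\<Theta> = rec_nat (\<lambda>x p. p) (\<lambda>j \<theta> x p. \<eta> j x (\<theta> x p))"
  have \<Theta>_Suc: "\<Theta> (Suc j) x p = \<eta> j x (\<Theta> j x p)" for j x p by (simp add: \<Theta>_def)
  have Hj: "smooth_map M N (\<lambda>x. H (real j * \<epsilon> x, x))" for j
    by (rule smooth_map_compose[OF sM sRM sN smooth_map_Pair[OF _ smooth_map_id[OF sM]] H])
      (intro smooth_map_real_mult[OF sM] \<epsilon>(1) smooth_map_const, simp)
  have \<Theta>: "gauge (\<lambda>x. H (0, x)) (\<lambda>x. H (real j * \<epsilon> x, x)) (\<Theta> j)" for j
  proof (induction j)
    case 0
    show ?case using gauge_id[OF Hj[of 0]] by (simp add: \<Theta>_def)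
  next
    case (Suc j)
    have "\<Theta> (Suc j) = (\<lambda>x p. \<eta> j x (\<Theta> j x p))" by (intro ext \<Theta>_Suc)
    then show ?case using gauge_compose[OF Suc \<eta> Hj] by simp
  qed
  have stable: "\<Theta> n x p = \<Theta> m x p"
    if "m \<le> n" and x: "x \<in> mspace M" and p: "p \<in> P" "\<pi> p = H (0, x)" and m: "1 \<le> real m * \<epsilon> x" for m n x p
    using \<open>m \<le> n\<close>
  proof (induction n rule: dec_induct)
    case (step n)
    have "real m * \<epsilon> x \<le> real n * \<epsilon> x" using step(1) \<epsilon>(2)[OF x] by (intro mult_right_mono) auto
    then have "\<eta> n x (\<Theta> n x p) = \<Theta> n x p"
      using m gauge_fibre[OF \<Theta> x p] by (intro \<eta>_id[OF x]) auto
    then show ?case using step by (simp add: \<Theta>_Suc)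
  qed simp
  \<comment> \<open>The number of steps needed to reach time 1 may jump with \<open>x\<close>, but
    by \<open>stable\<close> any larger number gives the same map, so the jumps are
    invisible.\<close>
  define n where "n x = (LEAST n. 1 \<le> real n * \<epsilon> x)" for x
  have "gauge f g (\<lambda>x. \<Theta> (n x) x)"
  proof (rule gauge_local)
    fix x assume x: "x \<in> mspace M"
    \<comment> \<open>The strict inequality persists near \<open>x\<close>, so the single
      composition \<open>\<Theta> k\<close> represents the map on a whole neighbourhood.\<close>
    obtain k where k: "1 < real k * \<epsilon> x" using reals_Archimedean3[OF \<epsilon>(2)[OF x]] by blast
    let ?D = "{y \<in> mspace M. real k * \<epsilon> y \<in> {1<..}}"
    have D: "openin (mtop M) ?D"
      by (rule preimage_openin[OF smooth_map_real_mult[OF sM smooth_map_const \<epsilon>(1)]]) auto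
    have "f y = H (0, y) \<and> g y = H (real k * \<epsilon> y, y) \<and> (\<forall>p\<in>P. \<pi> p = f y \<longrightarrow> \<Theta> (n y) y p = \<Theta> k y p)" if y: "y \<in> ?D" for y
    proof -
      have yM: "y \<in> mspace M" and ky: "1 \<le> real k * \<epsilon> y" using y by auto
      have "1 \<le> real (n y) * \<epsilon> y" unfolding n_def by (rule LeastI[of "\<lambda>n. 1 \<le> real n * \<epsilon> y", OF ky])
      moreover have "n y \<le> k" unfolding n_def by (rule Least_le[of "\<lambda>n. 1 \<le> real n * \<epsilon> y", OF ky])
      ultimately show ?thesis using stable[of "n y" k y] yM H0[OF yM, of 0] H1[OF yM ky] by simp
    qed
    then show "\<exists>D f' g' \<theta>'. openin (mtop M) D \<and> x \<in> D \<and> gauge f' g' \<theta>' \<and>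
      (\<forall>y\<in>D. f y = f' y \<and> g y = g' y \<and> (\<forall>p\<in>P. \<pi> p = f y \<longrightarrow> \<Theta> (n y) y p = \<theta>' y p))"
      using D x k \<Theta>[of k]
      by (intro exI[of _ ?D] exI[of _ "\<lambda>x. H (0, x)"] exI[of _ "\<lambda>x. H (real k * \<epsilon> x, x)"] exI[of _ "\<Theta> k"] conjI) auto
  qed
  then show thesis by (rule that)
qed

end

theorem mainTheorem1:
  fixes M :: "('a, 'h::euclidean_space) mfd"
    and N :: "('b, 'f::euclidean_space) mfd"
    and G :: "('g, 'k::euclidean_space) lie_struct"
    and \<xi> :: "('p, 'e::euclidean_space, 'b, 'g) pbundle"
    and f g :: "'a \<Rightarrow> 'b"
  assumes "smooth_manifold M"
    and "smooth_manifold N"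
    and "paracompact_manifold N"
    and "lie_group G"
    and "principal_bundle G N \<xi>"
    and "smooth_map M N f"
    and "smooth_map M N g"
    and "smoothly_homotopic M N f g"
  shows "\<exists>\<Phi>. pb_isomorphism G M (pullback_bundle G M N f \<xi>) (pullback_bundle G M N g \<xi>) \<Phi>"
proof -
  interpret bundle_over G N \<xi> M by unfold_locales (rule assms(5), rule assms(1))
  obtain \<theta> where "gauge f g \<theta>" by (rule homotopy_gauge[OF assms(3,8)])
  then show ?thesis by (rule gauge_isomorphism[OF assms(6,7)])
qed

end
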